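(* Let $\Sigma$ be a unimodular fan in $N_{\mathbb R}$. For every $p$, the cycle class map $\mathrm{cl}\colon\mathrm{MW}_p(\Sigma,\mathbb Z)\to H_{p,p}(\overline\Sigma,\mathbb Z)$ is an isomorphism. Moreover, $H_{p,q}(\overline\Sigma,\mathbb Z)$ is trivial in bidegree $(p,q)$ when $p<q$ and when $p>q=0$.
   Context: **Fans.** $N$ is a free $\mathbb Z$-module of finite rank, $N_{\mathbb R}=N\otimes\mathbb R$. Cones are strictly convex polyhedral cones, rational with respect to $N$; fans are finite. $\Sigma_k$ is the set of $k$-dimensional cones, $\underline 0=\{0\}$, $|\sigma|=\dim\sigma$, and $\tau\prec\sigma$ means that $\tau$ is a face of $\sigma$ (equality allowed). $N_{\sigma,\mathbb R}$ is the span of $\sigma$, $N_\sigma=N\cap N_{\sigma,\mathbb R}$, $N^\sigma=N/N_\sigma$, $N^\sigma_{\mathbb R}=N_{\mathbb R}/N_{\sigma,\mathbb R}$. If $\tau\prec\sigma$ has codimension one, $e^\tau_\sigma$ is the generator of $N_\sigma/N_\tau\simeq\mathbb Z$ lying in the image of $\sigma$. $\Sigma$ is unimodular if each cone is generated by as many rays as its dimension and the primitive vectors of its rays are part of a basis of $N$. **Canonical compactification.** Let $\mathbb T_+=\mathbb R_{\ge0}\cup\{\infty\}$. For a cone $\sigma$ with dual cone $\sigma^\vee$, $\overline\sigma=\mathrm{Hom}_{\mathbb R_+}(\sigma^\vee,\mathbb T_+)$ (morphisms of $\mathbb R_{+}$-modules); $\overline\Sigma$ is the union of the $\overline\sigma$,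 glued along $\overline\tau\subseteq\overline\sigma$ for $\tau\prec\sigma$. Its closed faces are hypercubes $\square^\tau_\sigma\simeq\mathbb T_+^{|\sigma|-|\tau|}$ indexed by pairs $\tau\prec\sigma$: $\square^\tau_\sigma$ is the closure of the copy, in the stratum at infinity $N^\tau_{\mathbb R}$, of the projection of $\sigma$ to $N^\tau_{\mathbb R}$. One has $\square^{\tau'}_{\sigma'}\subseteq\square^\tau_\sigma$ iff $\tau\prec\tau'\prec\sigma'\prec\sigma$; $\square^{\underline0}_\sigma=\overline\sigma$. **Tropical homology.** For $\delta=\square^\tau_\sigma$ put $N_\delta=N_\sigma/N_\tau$ and $\mathbf F_p(\delta)=\sum_{\eta\succ\sigma}\bigwedge^p(N_\eta/N_\tau)\subseteq\bigwedge^pN^\tau$. For $\gamma=\square^{\tau'}_{\sigma'}\subseteq\delta=\square^\tau_\sigma$, the projection $N^\tau\to N^{\tau'}$ induces $\mathbf F_p(\delta)\to\mathbf F_p(\gamma)$. Fix a generator $\nu_\delta$ of $\bigwedge^{\dim\delta}N_\delta$ for every face (equal to $1$ for points and to the primitive generator $e^\tau_\sigma$ in dimension one); write $\nu_\sigma=\nu_{\overline\sigma}$. For a codimension-one face $\gamma$ of $\delta=\square^\tau_\sigma$, $\mathrm{sign}(\gamma,\delta)\in\{\pm1\}$ is defined by $n\wedge\nu_\gamma=\mathrm{sign}(\gamma,\delta)\nu_\delta$ if $\gamma=\square^\tau_{\sigma'}$, $n$ any lift of $e^{\sigma'}_\sigma$; and by $e^\tau_{\tau'}\wedge\nu'=-\mathrm{sign}(\gamma,\delta)\nu_\delta$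 if $\gamma=\square^{\tau'}_\sigma$, $\nu'$ any lift of $\nu_\gamma$. $C_{p,q}(\overline\Sigma)=\bigoplus_{\dim\delta=q}\mathbf F_p(\delta)$ with $\partial$ the sum of the maps $\mathbf F_p(\delta)\to\mathbf F_p(\gamma)$ multiplied by $\mathrm{sign}(\gamma,\delta)$, and $H_{p,q}(\overline\Sigma,\mathbb Z)=H_q(C_{p,\bullet}(\overline\Sigma))$. **Minkowski weights and cycle class map.** $\mathrm{MW}_p(\Sigma,\mathbb Z)$ is the group of maps $w\colon\Sigma_p\to\mathbb Z$ such that $\sum_{\sigma\in\Sigma_p,\,\sigma\succ\tau}w(\sigma)e^\tau_\sigma=0$ in $N^\tau$ for all $\tau\in\Sigma_{p-1}$. The cycle class map sends $w$ to the class of (the closure in $\overline\Sigma$ of) the corresponding tropical cycle, i.e. to the class of the cycle in $C_{p,p}(\overline\Sigma)$ whose component on $\overline\sigma$ is $w(\sigma)\nu_\sigma\in\bigwedge^pN_\sigma\subseteq\mathbf F_p(\overline\sigma)$ for $\sigma\in\Sigma_p$, and whose other components vanish. *)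

theory Defs
  imports
    "HOL-Analysis.Polytope"
    "HOL-Algebra.Product_Groups"
    "HOL-Algebra.Free_Abelian_Groups"
begin

section \<open>Lattices, cones and fans\<close>

text \<open>
  A free abelian group of finite rank is given as the integer span of a finite linearly
  independent subset of some real vector space; its real scalar extension is then
  \<open>span N\<close>. The ambient type may be larger than \<open>span N\<close>, so that every rank, including 0,
  is covered.
\<close>

definition int_basis :: "'v::real_vector set \<Rightarrow> 'v set \<Rightarrow> bool" where
  "int_basis N B \<longleftrightarrow> finite B \<and> independent B \<and>
     N = range (\<lambda>c::'v \<Rightarrow> int. \<Sum>b\<in>B. real_of_int (c b) *\<^sub>R b)"

definition free_lattice :: "'v::real_vector set \<Rightarrow> bool" where
  "free_lattice N \<longleftrightarrow> (\<exists>B. int_basis N B)"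

definition rational_cone :: "'v::real_vector set \<Rightarrow> 'v set \<Rightarrow> bool" where
  "rational_cone N \<sigma> \<longleftrightarrow>
     (\<exists>A. finite A \<and> A \<subseteq> N \<and> \<sigma> = convex_cone hull A) \<and> \<sigma> \<inter> uminus ` \<sigma> = {0}"

text \<open>The library counts the empty set as a face of every convex set.\<close>

definition cone_face :: "'v::real_vector set \<Rightarrow> 'v set \<Rightarrow> bool" (infix \<open>\<preceq>\<^sub>c\<close> 50) where
  "\<tau> \<preceq>\<^sub>c \<sigma> \<longleftrightarrow> \<tau> face_of \<sigma> \<and> \<tau> \<noteq> {}"

definition fan :: "'v::real_vector set \<Rightarrow> 'v set set \<Rightarrow> bool" where
  "fan N \<Delta> \<longleftrightarrow> finite \<Delta> \<and> \<Delta> \<noteq> {} \<and>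
     (\<forall>\<sigma>\<in>\<Delta>. rational_cone N \<sigma>) \<and>
     (\<forall>\<sigma>\<in>\<Delta>. \<forall>\<tau>. \<tau> \<preceq>\<^sub>c \<sigma> \<longrightarrow> \<tau> \<in> \<Delta>) \<and>
     (\<forall>\<sigma>\<in>\<Delta>. \<forall>\<eta>\<in>\<Delta>. \<sigma> \<inter> \<eta> \<preceq>\<^sub>c \<sigma> \<and> \<sigma> \<inter> \<eta> \<preceq>\<^sub>c \<eta>)"

definition cones :: "'v::real_vector set set \<Rightarrow> nat \<Rightarrow> 'v set set" where
  "cones \<Delta> k = {\<sigma> \<in> \<Delta>. dim \<sigma> = k}"

definition rays :: "'v::real_vector set \<Rightarrow> 'v set set" where
  "rays \<sigma> = {\<rho>. \<rho> \<preceq>\<^sub>c \<sigma> \<and> dim \<rho> = 1}"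

definition primitive_vector :: "'v::real_vector set \<Rightarrow> 'v set \<Rightarrow> 'v" where
  "primitive_vector N \<rho> = (THE v. v \<noteq> 0 \<and> \<rho> \<inter> N = range (\<lambda>k::nat. real k *\<^sub>R v))"

definition unimodular :: "'v::real_vector set \<Rightarrow> 'v set set \<Rightarrow> bool" where
  "unimodular N \<Delta> \<longleftrightarrow>
     (\<forall>\<sigma>\<in>\<Delta>. \<sigma> = convex_cone hull (\<Union>(rays \<sigma>)) \<and> card (rays \<sigma>) = dim \<sigma> \<and>
        (\<exists>B. int_basis N B \<and> primitive_vector N ` rays \<sigma> \<subseteq> B))"


section \<open>Quotient lattices\<close>

text \<open>Following the algebra library, all abelian groups below are written multiplicatively.\<close>

definition lattice_group :: "'v::real_vector set \<Rightarrow> 'v monoid" where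
  "lattice_group N = \<lparr>carrier = N, monoid.mult = (+), one = 0\<rparr>"

definition sublattice :: "'v::real_vector set \<Rightarrow> 'v set \<Rightarrow> 'v set" where
  "sublattice N \<sigma> = N \<inter> span \<sigma>"

text \<open>\<open>quot_lattice N \<tau>\<close> is $N^\tau = N/N_\tau$.\<close>

definition quot_lattice :: "'v::real_vector set \<Rightarrow> 'v set \<Rightarrow> 'v set monoid" where
  "quot_lattice N \<tau> = lattice_group N Mod sublattice N \<tau>"

text \<open>\<open>rel_lattice N \<tau> \<sigma>\<close> is $N_\sigma/N_\tau$ as a subset of $N^\tau$.\<close>

definition rel_lattice :: "'v::real_vector set \<Rightarrow> 'v set \<Rightarrow> 'v set \<Rightarrow> 'v set set" where
  "rel_lattice N \<tau> \<sigma> = (\<lambda>n. sublattice N \<tau> #>\<^bsub>lattice_group N\<^esub> n) ` sublattice N \<sigma>"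

text \<open>The projection $N^\tau \to N^{\tau'}$ for $\tau \prec \tau'$.\<close>

definition quot_proj :: "'v::real_vector set \<Rightarrow> 'v set \<Rightarrow> 'v set \<Rightarrow> 'v set" where
  "quot_proj N \<tau>' X = sublattice N \<tau>' <#>\<^bsub>lattice_group N\<^esub> X"

text \<open>
  The generator $e^\tau_\sigma$, for \<open>\<tau>\<close> of codimension one in \<open>\<sigma>\<close>. The last conjunct says that
  the element lies in the image of \<open>\<sigma>\<close> under $N_{\mathbb R} \to N_{\mathbb R}/N_{\tau,\mathbb R}$.
\<close>

definition normal_gen :: "'v::real_vector set \<Rightarrow> 'v set \<Rightarrow> 'v set \<Rightarrow> 'v set" where
  "normal_gen N \<tau> \<sigma> = (THE x. x \<in> rel_lattice N \<tau> \<sigma> \<and>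
     generate (quot_lattice N \<tau>) {x} = rel_lattice N \<tau> \<sigma> \<and>
     (\<exists>n\<in>x. \<exists>s\<in>\<sigma>. n - s \<in> span \<tau>))"


section \<open>Exterior powers of abelian groups\<close>

text \<open>
  $\bigwedge^p G$ is the free abelian group on the \<open>p\<close>-tuples in \<open>G\<close> modulo additivity in each
  entry and the vanishing of tuples with a repeated entry.
\<close>

type_synonym 'a ext = "('a list \<Rightarrow>\<^sub>0 int) set"

definition tuples :: "nat \<Rightarrow> ('a, 'm) monoid_scheme \<Rightarrow> 'a list set" where
  "tuples p G = {xs. length xs = p \<and> set xs \<subseteq> carrier G}"

definition ext_relations :: "nat \<Rightarrow> ('a, 'm) monoid_scheme \<Rightarrow> ('a list \<Rightarrow>\<^sub>0 int) set" where
  "ext_relations p G =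
     {frag_of (xs @ [x \<otimes>\<^bsub>G\<^esub> y] @ ys) - frag_of (xs @ [x] @ ys) - frag_of (xs @ [y] @ ys) | xs x y ys.
        xs @ [x] @ ys \<in> tuples p G \<and> xs @ [y] @ ys \<in> tuples p G} \<union>
     {frag_of xs | xs. xs \<in> tuples p G \<and> \<not> distinct xs}"

definition ext_kernel :: "nat \<Rightarrow> ('a, 'm) monoid_scheme \<Rightarrow> ('a list \<Rightarrow>\<^sub>0 int) set" where
  "ext_kernel p G = generate (free_Abelian_group (tuples p G)) (ext_relations p G)"

definition ext_power :: "nat \<Rightarrow> ('a, 'm) monoid_scheme \<Rightarrow> 'a ext monoid" where
  "ext_power p G = free_Abelian_group (tuples p G) Mod ext_kernel p G"

definition ext_class :: "nat \<Rightarrow> ('a, 'm) monoid_scheme \<Rightarrow> ('a list \<Rightarrow>\<^sub>0 int) \<Rightarrow> 'a ext" where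
  "ext_class p G c = ext_kernel p G #>\<^bsub>free_Abelian_group (tuples p G)\<^esub> c"

definition wedge :: "('a, 'm) monoid_scheme \<Rightarrow> 'a list \<Rightarrow> 'a ext" where
  "wedge G xs = ext_class (length xs) G (frag_of xs)"

text \<open>
  The homomorphism $\bigwedge^p f$ into $\bigwedge^p H$ induced by a homomorphism \<open>f\<close> to \<open>H\<close>, and the map
  $x \mapsto n \wedge x$ from $\bigwedge^p G$ to $\bigwedge^{p+1} G$. Elements are cosets, and the value is the
  common class of the images of the representatives.
\<close>

definition ext_map :: "nat \<Rightarrow> ('b, 'm) monoid_scheme \<Rightarrow> ('a \<Rightarrow> 'b) \<Rightarrow> 'a ext \<Rightarrow> 'b ext" where
  "ext_map p H f X =
     the_elem ((\<lambda>c. ext_class p H (frag_extend (\<lambda>xs. frag_of (map f xs)) c)) ` X)"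

definition wedge_left :: "nat \<Rightarrow> ('a, 'm) monoid_scheme \<Rightarrow> 'a \<Rightarrow> 'a ext \<Rightarrow> 'a ext" where
  "wedge_left p G n X =
     the_elem ((\<lambda>c. ext_class (Suc p) G (frag_extend (\<lambda>xs. frag_of (n # xs)) c)) ` X)"

text \<open>The image of $\bigwedge^p K$ in $\bigwedge^p G$ for a subgroup \<open>K\<close> of \<open>G\<close>.\<close>

definition ext_sub :: "nat \<Rightarrow> ('a, 'm) monoid_scheme \<Rightarrow> 'a set \<Rightarrow> 'a ext set" where
  "ext_sub p G K = ext_map p G (\<lambda>x. x) ` carrier (ext_power p (G\<lparr>carrier := K\<rparr>))"


section \<open>Tropical homology of the canonical compactification\<close>

text \<open>
  The closed face $\square^\tau_\sigma$ of the canonical compactification is represented by the pair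
  \<open>(\<tau>, \<sigma>)\<close>. The degree \<open>q\<close> is an integer so that the complex is extended by zero to
  negative degrees.
\<close>

type_synonym 'v face = "'v set \<times> 'v set"

definition face_dim :: "'v::real_vector face \<Rightarrow> nat" where
  "face_dim \<delta> = dim (snd \<delta>) - dim (fst \<delta>)"

definition faces :: "'v::real_vector set set \<Rightarrow> int \<Rightarrow> 'v face set" where
  "faces \<Delta> q = {(\<tau>, \<sigma>). \<tau> \<in> \<Delta> \<and> \<sigma> \<in> \<Delta> \<and> \<tau> \<preceq>\<^sub>c \<sigma> \<and> int (face_dim (\<tau>, \<sigma>)) = q}"

definition subface :: "'v::real_vector face \<Rightarrow> 'v face \<Rightarrow> bool" where
  "subface \<gamma> \<delta> \<longleftrightarrow> fst \<delta> \<preceq>\<^sub>c fst \<gamma> \<and> fst \<gamma> \<preceq>\<^sub>c snd \<gamma> \<and> snd \<gamma> \<preceq>\<^sub>c snd \<delta>"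

text \<open>The coefficient group $\mathbf F_p(\delta) \subseteq \bigwedge^p N^\tau$ for $\delta = \square^\tau_\sigma$.\<close>

definition trop_coeff ::
    "'v::real_vector set \<Rightarrow> 'v set set \<Rightarrow> nat \<Rightarrow> 'v face \<Rightarrow> 'v set ext monoid" where
  "trop_coeff N \<Delta> p = (\<lambda>(\<tau>, \<sigma>).
     subgroup_generated (ext_power p (quot_lattice N \<tau>))
       (\<Union>\<eta>\<in>{\<eta> \<in> \<Delta>. \<sigma> \<preceq>\<^sub>c \<eta>}. ext_sub p (quot_lattice N \<tau>) (rel_lattice N \<tau> \<eta>)))"

text \<open>
  A choice of generators $\nu_\delta$ of $\bigwedge^{\dim\delta} N_\delta$, the latter regarded inside
  $\bigwedge^{\dim\delta} N^\tau$; \<open>wedge _ []\<close> is $1 \in \bigwedge^0 N^\tau = \mathbb Z$.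
\<close>

definition orientation ::
    "'v::real_vector set \<Rightarrow> 'v set set \<Rightarrow> ('v face \<Rightarrow> 'v set ext) \<Rightarrow> bool" where
  "orientation N \<Delta> \<nu> \<longleftrightarrow> (\<forall>\<tau>\<in>\<Delta>. \<forall>\<sigma>\<in>\<Delta>. \<tau> \<preceq>\<^sub>c \<sigma> \<longrightarrow>
     (let d = face_dim (\<tau>, \<sigma>); G = quot_lattice N \<tau> in
        \<nu> (\<tau>, \<sigma>) \<in> ext_sub d G (rel_lattice N \<tau> \<sigma>) \<and>
        generate (ext_power d G) {\<nu> (\<tau>, \<sigma>)} = ext_sub d G (rel_lattice N \<tau> \<sigma>) \<and>
        (d = 0 \<longrightarrow> \<nu> (\<tau>, \<sigma>) = wedge G []) \<and>
        (d = 1 \<longrightarrow> \<nu> (\<tau>, \<sigma>) = wedge G [normal_gen N \<tau> \<sigma>])))"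

text \<open>
  For \<open>\<gamma>\<close> of codimension one in \<open>\<delta>\<close>, either $\gamma = \square^\tau_{\sigma'}$ (first case) or
  $\gamma = \square^{\tau'}_\sigma$ (second case).
\<close>

definition face_sign ::
    "'v::real_vector set \<Rightarrow> ('v face \<Rightarrow> 'v set ext) \<Rightarrow> 'v face \<Rightarrow> 'v face \<Rightarrow> int" where
  "face_sign N \<nu> \<gamma> \<delta> =
     (let \<tau> = fst \<delta>; \<sigma> = snd \<delta>; \<tau>' = fst \<gamma>; \<sigma>' = snd \<gamma>;
          d = face_dim \<gamma>; G = quot_lattice N \<tau>; E = ext_power (Suc d) G
      in THE s. s \<in> {1, -1} \<and>
        (if \<tau>' = \<tau>
         then \<forall>n \<in> rel_lattice N \<tau> \<sigma>. quot_proj N \<sigma>' n = normal_gen N \<sigma>' \<sigma> \<longrightarrow>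
                wedge_left d G n (\<nu> \<gamma>) = \<nu> \<delta> [^]\<^bsub>E\<^esub> s
         else \<forall>\<nu>' \<in> ext_sub d G (rel_lattice N \<tau> \<sigma>).
                ext_map d (quot_lattice N \<tau>') (quot_proj N \<tau>') \<nu>' = \<nu> \<gamma> \<longrightarrow>
                wedge_left d G (normal_gen N \<tau> \<tau>') \<nu>' = \<nu> \<delta> [^]\<^bsub>E\<^esub> (- s)))"

definition trop_chains ::
    "'v::real_vector set \<Rightarrow> 'v set set \<Rightarrow> nat \<Rightarrow> int \<Rightarrow> ('v face \<Rightarrow> 'v set ext) monoid" where
  "trop_chains N \<Delta> p q = sum_group (faces \<Delta> q) (trop_coeff N \<Delta> p)"

definition trop_boundary ::
    "'v::real_vector set \<Rightarrow> 'v set set \<Rightarrow> ('v face \<Rightarrow> 'v set ext) \<Rightarrow> nat \<Rightarrow> int \<Rightarrow>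
     ('v face \<Rightarrow> 'v set ext) \<Rightarrow> ('v face \<Rightarrow> 'v set ext)" where
  "trop_boundary N \<Delta> \<nu> p q c = (\<lambda>\<gamma>\<in>faces \<Delta> (q - 1).
     \<Otimes>\<^bsub>trop_coeff N \<Delta> p \<gamma>\<^esub>\<delta>\<in>{\<delta> \<in> faces \<Delta> q. subface \<gamma> \<delta>}.
       ext_map p (quot_lattice N (fst \<gamma>)) (quot_proj N (fst \<gamma>)) (c \<delta>)
         [^]\<^bsub>trop_coeff N \<Delta> p \<gamma>\<^esub> face_sign N \<nu> \<gamma> \<delta>)"

definition trop_cycles ::
    "'v::real_vector set \<Rightarrow> 'v set set \<Rightarrow> ('v face \<Rightarrow> 'v set ext) \<Rightarrow> nat \<Rightarrow> int \<Rightarrow>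
     ('v face \<Rightarrow> 'v set ext) monoid" where
  "trop_cycles N \<Delta> \<nu> p q = (trop_chains N \<Delta> p q)
     \<lparr>carrier := kernel (trop_chains N \<Delta> p q) (trop_chains N \<Delta> p (q - 1)) (trop_boundary N \<Delta> \<nu> p q)\<rparr>"

definition trop_boundaries ::
    "'v::real_vector set \<Rightarrow> 'v set set \<Rightarrow> ('v face \<Rightarrow> 'v set ext) \<Rightarrow> nat \<Rightarrow> int \<Rightarrow>
     ('v face \<Rightarrow> 'v set ext) set" where
  "trop_boundaries N \<Delta> \<nu> p q =
     trop_boundary N \<Delta> \<nu> p (q + 1) ` carrier (trop_chains N \<Delta> p (q + 1))"

definition trop_homology ::
    "'v::real_vector set \<Rightarrow> 'v set set \<Rightarrow> ('v face \<Rightarrow> 'v set ext) \<Rightarrow> nat \<Rightarrow> int \<Rightarrow>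
     ('v face \<Rightarrow> 'v set ext) set monoid" where
  "trop_homology N \<Delta> \<nu> p q = trop_cycles N \<Delta> \<nu> p q Mod trop_boundaries N \<Delta> \<nu> p q"


section \<open>Minkowski weights and the cycle class map\<close>

text \<open>
  The condition $\tau \in \Sigma_{p-1}$ is written \<open>dim \<tau> + 1 = p\<close>, so that there is no balancing
  condition for \<open>p = 0\<close>. Weights are \<open>undefined\<close> off $\Sigma_p$.
\<close>

definition minkowski_weights ::
    "'v::real_vector set \<Rightarrow> 'v set set \<Rightarrow> nat \<Rightarrow> ('v set \<Rightarrow> int) monoid" where
  "minkowski_weights N \<Delta> p = (product_group (cones \<Delta> p) (\<lambda>_. integer_group))
     \<lparr>carrier := {w \<in> cones \<Delta> p \<rightarrow>\<^sub>E UNIV. \<forall>\<tau>\<in>\<Delta>. dim \<tau> + 1 = p \<longrightarrow>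
        (\<Otimes>\<^bsub>quot_lattice N \<tau>\<^esub>\<sigma>\<in>{\<sigma> \<in> cones \<Delta> p. \<tau> \<preceq>\<^sub>c \<sigma>}.
           normal_gen N \<tau> \<sigma> [^]\<^bsub>quot_lattice N \<tau>\<^esub> w \<sigma>) = \<one>\<^bsub>quot_lattice N \<tau>\<^esub>}\<rparr>"

definition weight_cycle ::
    "'v::real_vector set \<Rightarrow> 'v set set \<Rightarrow> ('v face \<Rightarrow> 'v set ext) \<Rightarrow> nat \<Rightarrow>
     ('v set \<Rightarrow> int) \<Rightarrow> ('v face \<Rightarrow> 'v set ext)" where
  "weight_cycle N \<Delta> \<nu> p w = (\<lambda>\<delta>\<in>faces \<Delta> (int p).
     if fst \<delta> = {0} then \<nu> \<delta> [^]\<^bsub>trop_coeff N \<Delta> p \<delta>\<^esub> w (snd \<delta>)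
     else \<one>\<^bsub>trop_coeff N \<Delta> p \<delta>\<^esub>)"

definition cycle_class ::
    "'v::real_vector set \<Rightarrow> 'v set set \<Rightarrow> ('v face \<Rightarrow> 'v set ext) \<Rightarrow> nat \<Rightarrow>
     ('v set \<Rightarrow> int) \<Rightarrow> ('v face \<Rightarrow> 'v set ext) set" where
  "cycle_class N \<Delta> \<nu> p w =
     trop_boundaries N \<Delta> \<nu> p (int p) #>\<^bsub>trop_cycles N \<Delta> \<nu> p (int p)\<^esub> weight_cycle N \<Delta> \<nu> p w"

end

(*
  The cell indexed by tau <= sigma corresponds to a pair T <= S of sets of primitive ray
  generators. Evaluating wedges by determinants on lists of linear functionals embeds the exterior
  power of N/N_tau into a space of real functions, and the projection to a deeper stratum becomes
  the restriction to functionals that vanish on more generators. Unimodularity splits these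
  restrictions: precomposing functionals with x - e_i^*(x) e_i is a section. For fixed sigma the
  faces tau of sigma thus form an exact cube except at tau = 0, and every cycle can be pushed into
  tau = 0, where it becomes a sum of forms on sigma that die under every projection to a ray of
  sigma. Such forms vanish if dim sigma > p, and are the multiples of nu_sigma if dim sigma = p.
  A sum of w(sigma) nu_sigma has boundary 0 exactly if w is balanced. If p > 0, then every form on
  the cone 0 is a sum of wedges with a ray generator, and these are boundaries.
*)
theory Submission
  imports Defs "Jordan_Normal_Form.Determinant" "HOL-Library.Function_Algebras"
begin

section \<open>Cubical systems over a simplicial complex\<close>

text \<open>A basis of N containing the generators S is chosen for each cone separately, so the
  sections for different cones need not be compatible, and they need not commute with the part of
  the boundary that passes to facets of sigma. The elimination is a descent on the size of T
  arranged around this: a filling placed at size n - 1 acts on size n only through the faces at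
  infinity, where S is fixed, and its other contributions stay at size n - 1, which is treated
  later. Only closedness at cells with T nonempty is used, so the same reduction applies to a chain
  whose boundary lives on T = {}; injectivity of the cycle class map rests on this. Real-valued
  functions lose no integral information: the exterior powers are free, the evaluation is injective,
  and the coefficient groups become integer spans. The sections respect these spans because a
  coordinate for a basis of N is integral on all of N, including cones not contained in the chosen
  basis. For the signs, \<open>nu\<close> is compared with the forms of enumerations of S - T; the
  sign of a face then records the effect of prepending one vector, and the anticommutation of
  squares comes down to one transposition.\<close>

definition sign_like :: "real \<Rightarrow> bool" where
  "sign_like s \<longleftrightarrow> s = 1 \<or> s = -1"

lemma sign_like_square: "sign_like s \<Longrightarrow> s * s = 1"
  by (auto simp: sign_like_def)

text \<open>Signs are real scalars for forms but integer exponents in the groups of the complex. The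
  computation of \<open>face_sign\<close> needs the integer version of a product of two real
  signs.\<close>

lemma sign_int:
  assumes "sign_like a" "sign_like b"
  obtains s :: int where "s = 1 \<or> s = - 1" "real_of_int s = a * b"
proof (cases "a = b")
  case True
  then show ?thesis using assms that[of 1] by (auto simp: sign_like_def)
next
  case False
  then show ?thesis using assms that[of "-1"] by (auto simp: sign_like_def)
qed

text \<open>Exchanging the two indices turns the sum into its negative, and a real vector space has
  no 2-torsion. Two moves of the same kind in the square of the boundary operator cancel by this
  rule.\<close>

lemma sum_antisymmetric_pairs:
  fixes g :: "'x \<Rightarrow> 'x \<Rightarrow> 'a::real_vector"
  assumes "finite P" and "\<And>i j. (i, j) \<in> P \<Longrightarrow> (j, i) \<in> P"
    and "\<And>i j. (i, j) \<in> P \<Longrightarrow> g i j = - g j i"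
  shows "(\<Sum>(i, j)\<in>P. g i j) = 0"
proof -
  have "(\<Sum>(i, j)\<in>P. g i j) = (\<Sum>(i, j)\<in>P. g j i)"
    by (rule sum.reindex_bij_witness[of _ prod.swap prod.swap]) (use assms(2) in auto)
  also have "\<dots> = (\<Sum>(i, j)\<in>P. - g i j)"
    using assms(2,3) by (intro sum.cong) (auto split: prod.splits)
  also have "\<dots> = - (\<Sum>(i, j)\<in>P. g i j)"
    by (simp add: sum_negf[symmetric] case_prod_unfold)
  finally have "2 *\<^sub>R (\<Sum>(i, j)\<in>P. g i j) = 0"
    by (simp add: scaleR_2 eq_neg_iff_add_eq_0)
  then show ?thesis by simp
qed

text \<open>
  A pair \<open>(T, S)\<close> with \<open>T \<subseteq> S \<in> K\<close> stands for a face of the compactification, with coefficients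
  \<open>res T ` V S\<close>. The operator \<open>sec S i\<close> is a section of the restriction from \<open>T\<close> to \<open>insert i T\<close>.
\<close>

locale cubical_system =
  fixes K :: "'x set set"
    and V :: "'x set \<Rightarrow> 'a::real_vector set"
    and res :: "'x set \<Rightarrow> 'a \<Rightarrow> 'a"
    and sec :: "'x set \<Rightarrow> 'x \<Rightarrow> 'a \<Rightarrow> 'a"
    and sg :: "'x set \<times> 'x set \<Rightarrow> 'x set \<times> 'x set \<Rightarrow> real"
  assumes finite_complex: "finite K"
    and finite_simplex: "S \<in> K \<Longrightarrow> finite S"
    and simplex_subset: "S \<in> K \<Longrightarrow> T \<subseteq> S \<Longrightarrow> T \<in> K"
    and V_zero: "S \<in> K \<Longrightarrow> 0 \<in> V S"
    and V_diff: "S \<in> K \<Longrightarrow> a \<in> V S \<Longrightarrow> b \<in> V S \<Longrightarrow> a - b \<in> V S"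
    and V_antimono: "S' \<in> K \<Longrightarrow> S \<subseteq> S' \<Longrightarrow> V S' \<subseteq> V S"
    and linear_res: "linear (res T)"
    and res_res: "res T (res T' a) = res (T \<union> T') a"
    and res_empty: "S \<in> K \<Longrightarrow> a \<in> V S \<Longrightarrow> res {} a = a"
    and linear_sec: "S \<in> K \<Longrightarrow> i \<in> S \<Longrightarrow> linear (sec S i)"
    and sec_V: "S \<in> K \<Longrightarrow> i \<in> S \<Longrightarrow> a \<in> V S \<Longrightarrow> sec S i a \<in> V S"
    and sec_res: "S \<in> K \<Longrightarrow> insert i T \<subseteq> S \<Longrightarrow> i \<notin> T \<Longrightarrow> sec S i (res (insert i T) a) = res T (sec S i a)"
    and res_sec: "S \<in> K \<Longrightarrow> i \<in> S \<Longrightarrow> res {i} (sec S i a) = res {i} a"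
    and sg_sign: "sign_like (sg c d)"
    and sg_square_up: "S \<in> K \<Longrightarrow> T \<subseteq> S - {i, j} \<Longrightarrow> i \<in> S \<Longrightarrow> j \<in> S \<Longrightarrow> i \<noteq> j \<Longrightarrow>
          sg (T, S - {i, j}) (T, S - {i}) * sg (T, S - {i}) (T, S) =
          - (sg (T, S - {i, j}) (T, S - {j}) * sg (T, S - {j}) (T, S))"
    and sg_square_down: "S \<in> K \<Longrightarrow> insert i (insert j T) \<subseteq> S \<Longrightarrow> i \<notin> T \<Longrightarrow> j \<notin> T \<Longrightarrow> i \<noteq> j \<Longrightarrow>
          sg (insert i (insert j T), S) (insert i T, S) * sg (insert i T, S) (T, S) =
          - (sg (insert i (insert j T), S) (insert j T, S) * sg (insert j T, S) (T, S))"
    and sg_square_mixed: "S \<in> K \<Longrightarrow> insert i T \<subseteq> S - {j} \<Longrightarrow> j \<in> S \<Longrightarrow> i \<notin> T \<Longrightarrow>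
          sg (insert i T, S - {j}) (T, S - {j}) * sg (T, S - {j}) (T, S) =
          - (sg (insert i T, S - {j}) (insert i T, S) * sg (insert i T, S) (T, S))"
begin

section \<open>Cells, chains and the boundary operator of a cubical system\<close>

definition link :: "'x set \<Rightarrow> 'x set" where
  "link S = {i. i \<notin> S \<and> insert i S \<in> K}"

definition cell :: "int \<Rightarrow> 'x set \<Rightarrow> 'x set \<Rightarrow> bool" where
  "cell q T S \<longleftrightarrow> S \<in> K \<and> T \<subseteq> S \<and> int (card S) = int (card T) + q"

text \<open>Chains are total functions that vanish off the cells of their degree, so that equality
  of chains is equality of functions and chains of one degree can be added pointwise.\<close>

definition chains :: "int \<Rightarrow> ('x set \<times> 'x set \<Rightarrow> 'a) set" where
  "chains q = {c. \<forall>T S. if cell q T S then c (T, S) \<in> res T ` V S else c (T, S) = 0}"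

text \<open>Written from the side of the target cell, whose cofaces are (T, insert i S) and (T -
  {i}, S). The first kind needs no map, since at fixed T the coefficients of a larger cone are
  contained in those of a smaller one. No degree occurs, so one operator serves all degrees.\<close>

definition boundary :: "('x set \<times> 'x set \<Rightarrow> 'a) \<Rightarrow> 'x set \<times> 'x set \<Rightarrow> 'a" where
  "boundary c = (\<lambda>(T, S). if S \<in> K \<and> T \<subseteq> S
     then (\<Sum>i\<in>link S. sg (T, S) (T, insert i S) *\<^sub>R c (T, insert i S)) +
          (\<Sum>i\<in>T. sg (T, S) (T - {i}, S) *\<^sub>R res T (c (T - {i}, S)))
     else 0)"

lemma finite_link: "finite (link S)"
proof (rule finite_subset)
  show "link S \<subseteq> \<Union>K" by (auto simp: link_def)
  show "finite (\<Union>K)" using finite_complex finite_simplex by blast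
qed

lemma finite_subsimplex: "S \<in> K \<Longrightarrow> T \<subseteq> S \<Longrightarrow> finite T"
  using finite_simplex finite_subset by blast

lemma image_V_diff:
  assumes "S \<in> K" "a \<in> res T ` V S" "b \<in> res T ` V S"
  shows "a - b \<in> res T ` V S"
proof -
  obtain a' b' where "a = res T a'" "b = res T b'" "a' \<in> V S" "b' \<in> V S"
    using assms by blast
  then have "a - b = res T (a' - b')" "a' - b' \<in> V S"
    using linear_diff[OF linear_res, of T a' b'] V_diff[OF assms(1), of a' b'] by auto
  then show ?thesis by blast
qed

lemma zero_image_V: "S \<in> K \<Longrightarrow> 0 \<in> res T ` V S"
  using V_zero linear_0[OF linear_res] by force

lemma image_V_minus: "S \<in> K \<Longrightarrow> a \<in> res T ` V S \<Longrightarrow> - a \<in> res T ` V S"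
  using image_V_diff[OF _ zero_image_V] by force

lemma image_V_add: "S \<in> K \<Longrightarrow> a \<in> res T ` V S \<Longrightarrow> b \<in> res T ` V S \<Longrightarrow> a + b \<in> res T ` V S"
  using image_V_diff[OF _ _ image_V_minus, of S a T b] by simp

lemma image_V_sum: "S \<in> K \<Longrightarrow> (\<And>i. i \<in> I \<Longrightarrow> f i \<in> res T ` V S) \<Longrightarrow> (\<Sum>i\<in>I. f i) \<in> res T ` V S"
  by (induction I rule: infinite_finite_induct) (auto intro: zero_image_V image_V_add)

lemma image_V_sign: "S \<in> K \<Longrightarrow> a \<in> res T ` V S \<Longrightarrow> sign_like s \<Longrightarrow> s *\<^sub>R a \<in> res T ` V S"
  using image_V_minus by (auto simp: sign_like_def)

lemma res_image_V: "a \<in> res T ` V S \<Longrightarrow> res T a = a"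
  by (auto simp: res_res)

lemma chainsI:
  assumes "\<And>T S. cell q T S \<Longrightarrow> c (T, S) \<in> res T ` V S"
    and "\<And>T S. \<not> cell q T S \<Longrightarrow> c (T, S) = 0"
  shows "c \<in> chains q"
  using assms by (auto simp: chains_def)

lemma cell_simplex: "cell q T S \<Longrightarrow> S \<in> K"
  by (simp add: cell_def)

lemma chains_cell: "c \<in> chains q \<Longrightarrow> cell q T S \<Longrightarrow> c (T, S) \<in> res T ` V S"
  by (auto simp: chains_def split: if_splits)

lemma chains_not_cell: "c \<in> chains q \<Longrightarrow> \<not> cell q T S \<Longrightarrow> c (T, S) = 0"
  by (auto simp: chains_def split: if_splits)

lemma chains_image: "c \<in> chains q \<Longrightarrow> S \<in> K \<Longrightarrow> c (T, S) \<in> res T ` V S"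
  using chains_cell chains_not_cell zero_image_V by metis

lemma chains_diff: "b \<in> chains q \<Longrightarrow> c \<in> chains q \<Longrightarrow> (\<lambda>x. b x - c x) \<in> chains q"
  by (rule chainsI) (simp_all add: chains_not_cell image_V_diff[OF cell_simplex] chains_cell)

lemma chains_add: "b \<in> chains q \<Longrightarrow> c \<in> chains q \<Longrightarrow> (\<lambda>x. b x + c x) \<in> chains q"
  by (rule chainsI) (simp_all add: chains_not_cell image_V_add[OF cell_simplex] chains_cell)

lemma chains_zero: "(\<lambda>x. 0) \<in> chains q"
  by (rule chainsI) (auto simp: cell_def zero_image_V)

lemma image_V_antimono: "S' \<in> K \<Longrightarrow> S \<subseteq> S' \<Longrightarrow> res T ` V S' \<subseteq> res T ` V S"
  using V_antimono by blast

lemma boundary_add: "boundary (\<lambda>x. b x + c x) x = boundary b x + boundary c x"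
  by (cases x) (simp add: boundary_def linear_add[OF linear_res] scaleR_add_right sum.distrib)

lemma boundary_diff: "boundary (\<lambda>x. b x - c x) x = boundary b x - boundary c x"
  by (cases x) (simp add: boundary_def linear_diff[OF linear_res] scaleR_diff_right sum_subtractf)

lemma boundary_chains:
  assumes c: "c \<in> chains q"
  shows "boundary c \<in> chains (q - 1)"
proof (rule chainsI)
  fix T S
  assume TS: "cell (q - 1) T S"
  then have S: "S \<in> K" "T \<subseteq> S" by (auto simp: cell_def)
  have 1: "sg (T, S) (T, insert i S) *\<^sub>R c (T, insert i S) \<in> res T ` V S" if "i \<in> link S" for i
    using that chains_image[OF c, of "insert i S" T] image_V_antimono[of "insert i S" S T]
    by (intro image_V_sign S sg_sign) (auto simp: link_def)
  have 2: "sg (T, S) (T - {i}, S) *\<^sub>R res T (c (T - {i}, S)) \<in> res T ` V S" if "i \<in> T" for i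
  proof -
    obtain a where "a \<in> V S" "c (T - {i}, S) = res (T - {i}) a"
      using chains_image[OF c S(1)] by blast
    then have "res T (c (T - {i}, S)) \<in> res T ` V S"
      by (auto simp: res_res Un_absorb2)
    then show ?thesis by (intro image_V_sign S sg_sign)
  qed
  show "boundary c (T, S) \<in> res T ` V S"
    using S 1 2 by (auto simp: boundary_def intro!: image_V_add image_V_sum)
next
  fix T S
  assume TS: "\<not> cell (q - 1) T S"
  show "boundary c (T, S) = 0"
  proof (cases "S \<in> K \<and> T \<subseteq> S")
    case True
    then have fin: "finite S" "finite T"
      using finite_simplex finite_subsimplex by auto
    have "c (T, insert i S) = 0" if "i \<in> link S" for i
      using TS True that fin by (intro chains_not_cell[OF c]) (auto simp: cell_def link_def)
    moreover have "c (T - {i}, S) = 0" if "i \<in> T" for i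
    proof -
      have "int (card (T - {i})) = int (card T) - 1"
        using card.remove[OF fin(2) that] by simp
      then show ?thesis
        using TS True that by (intro chains_not_cell[OF c]) (auto simp: cell_def)
    qed
    ultimately show ?thesis
      by (simp add: boundary_def linear_0[OF linear_res])
  qed (auto simp: boundary_def)
qed

text \<open>The terms run over ordered pairs of moves: two enlargements of S, two removals from T,
  or one of each. In the first two kinds the pairs (i, j) and (j, i) cancel, in the third the two
  orders of the moves. Only the sign rules and the linearity and composition of restrictions enter,
  so c may be any function.\<close>

lemma boundary_boundary:
  "boundary (boundary c) (T, S) = 0"
proof (cases "S \<in> K \<and> T \<subseteq> S")
  case True
  then have S: "S \<in> K" "T \<subseteq> S" and fT: "finite T"
    using finite_subsimplex by auto
  let ?A = "SIGMA i:link S. link (insert i S)"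
  let ?B = "SIGMA i:T. T - {i}"
  \<comment> \<open>\<open>?a\<close> and \<open>?b\<close> collect the pairs of like moves,
    \<open>?m\<close> and \<open>?n\<close> the mixed pairs in their two orders, where i is added to
    S and j is removed from T.\<close>
  let ?a = "\<lambda>i j. (sg (T, S) (T, insert i S) * sg (T, insert i S) (T, insert j (insert i S))) *\<^sub>R
                 c (T, insert j (insert i S))"
  let ?b = "\<lambda>i j. (sg (T, S) (T - {i}, S) * sg (T - {i}, S) (T - {i} - {j}, S)) *\<^sub>R
                 res T (c (T - {i} - {j}, S))"
  let ?m = "\<lambda>i j. (sg (T, S) (T, insert i S) * sg (T, insert i S) (T - {j}, insert i S)) *\<^sub>R
                 res T (c (T - {j}, insert i S))"
  let ?n = "\<lambda>i j. (sg (T, S) (T - {j}, S) * sg (T - {j}, S) (T - {j}, insert i S)) *\<^sub>R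
                 res T (c (T - {j}, insert i S))"
  have bd_up: "boundary c (T, insert i S) =
      (\<Sum>j\<in>link (insert i S). sg (T, insert i S) (T, insert j (insert i S)) *\<^sub>R c (T, insert j (insert i S))) +
      (\<Sum>j\<in>T. sg (T, insert i S) (T - {j}, insert i S) *\<^sub>R res T (c (T - {j}, insert i S)))"
    if "i \<in> link S" for i
    using that S by (auto simp: boundary_def link_def)
  have bd_down: "boundary c (T - {i}, S) =
      (\<Sum>j\<in>link S. sg (T - {i}, S) (T - {i}, insert j S) *\<^sub>R c (T - {i}, insert j S)) +
      (\<Sum>j\<in>T - {i}. sg (T - {i}, S) (T - {i} - {j}, S) *\<^sub>R res (T - {i}) (c (T - {i} - {j}, S)))"
    if "i \<in> T" for i
    using that S by (auto simp: boundary_def)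
  have "boundary (boundary c) (T, S) =
      (\<Sum>i\<in>link S. (\<Sum>j\<in>link (insert i S). ?a i j) + (\<Sum>j\<in>T. ?m i j)) +
      (\<Sum>i\<in>T. (\<Sum>j\<in>link S. ?n j i) + (\<Sum>j\<in>T - {i}. ?b i j))"
    by (subst boundary_def)
       (simp add: S bd_up bd_down scaleR_add_right scaleR_sum_right linear_add[OF linear_res]
         linear_sum[OF linear_res] linear_scale[OF linear_res] res_res Un_absorb2)
  also have "\<dots> = (\<Sum>(i, j)\<in>?A. ?a i j) + (\<Sum>(i, j)\<in>?B. ?b i j) +
      (\<Sum>i\<in>link S. \<Sum>j\<in>T. ?m i j + ?n i j)"
    by (simp add: sum.distrib sum.Sigma finite_link fT sum.swap[of _ "link S" T] algebra_simps)
  also have "(\<Sum>(i, j)\<in>?A. ?a i j) = 0"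
  proof (rule sum_antisymmetric_pairs)
    show "finite ?A" using finite_link by blast
    fix i j
    assume ij: "(i, j) \<in> ?A"
    then have K: "insert j (insert i S) \<in> K" "insert i S \<in> K" and ne: "i \<notin> S" "j \<notin> S" "i \<noteq> j"
      by (auto simp: link_def)
    then have "insert j S \<in> K" "insert i (insert j S) \<in> K"
      using simplex_subset[of "insert j (insert i S)" "insert j S"] by (auto simp: insert_commute)
    then show "(j, i) \<in> ?A" using ne by (auto simp: link_def)
    have "insert j (insert i S) - {i, j} = S" "insert j (insert i S) - {i} = insert j S"
      "insert j (insert i S) - {j} = insert i S" using ne by auto
    then have "sg (T, S) (T, insert i S) * sg (T, insert i S) (T, insert j (insert i S)) =
      - (sg (T, S) (T, insert j S) * sg (T, insert j S) (T, insert j (insert i S)))"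
      using sg_square_up[OF K(1), of T i j] ne S by auto
    then show "?a i j = - ?a j i"
      by (simp add: insert_commute)
  qed
  also have "(\<Sum>(i, j)\<in>?B. ?b i j) = 0"
  proof (rule sum_antisymmetric_pairs)
    show "finite ?B" using fT by blast
    fix i j
    assume ij: "(i, j) \<in> ?B"
    then show "(j, i) \<in> ?B" by auto
    have *: "T - {i} - {j} = T - {i, j}" "T - {j} - {i} = T - {i, j}"
      "insert j (T - {i, j}) = T - {i}" "insert i (T - {i, j}) = T - {j}"
      "insert i (T - {i}) = T"
      using ij by auto
    have "insert j (insert i (T - {i, j})) = T" using ij by blast
    then have "sg (T, S) (T - {i}, S) * sg (T - {i}, S) (T - {i, j}, S) =
        - (sg (T, S) (T - {j}, S) * sg (T - {j}, S) (T - {i, j}, S))"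
      using sg_square_down[OF S(1), of j i "T - {i, j}"] ij S(2) unfolding * by simp
    then show "?b i j = - ?b j i"
      by (simp only: * scaleR_minus_left)
  qed
  also have "(\<Sum>i\<in>link S. \<Sum>j\<in>T. ?m i j + ?n i j) = 0"
  proof (intro sum.neutral ballI)
    fix i j
    assume i: "i \<in> link S" and j: "j \<in> T"
    have eq: "insert i S - {i} = S" "insert j (T - {j}) = T"
      using i j by (auto simp: link_def)
    have "sg (T, S) (T - {j}, S) * sg (T - {j}, S) (T - {j}, insert i S) =
        - (sg (T, S) (T, insert i S) * sg (T, insert i S) (T - {j}, insert i S))"
      using sg_square_mixed[of "insert i S" j "T - {j}" i] i j S unfolding eq
      by (auto simp: link_def)
    then show "?m i j + ?n i j = 0"
      by simp
  qed
  finally show ?thesis by simp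
qed (auto simp: boundary_def[of "boundary c"])

text \<open>The set X contains the vertices already treated at size n. To treat i, each value at a
  set of size n containing i is lifted by the section to the set without i, and the boundary of the
  lift gives the value back. At sets of size n that avoid i but meet X nothing is spoiled:
  closedness one size higher shows that the boundary of the lift vanishes there.\<close>

lemma eliminate_vertex:
  assumes c: "c \<in> chains q"
    and closed: "\<And>T S. T \<noteq> {} \<Longrightarrow> boundary c (T, S) = 0"
    and top: "\<And>T S. card T > n \<Longrightarrow> c (T, S) = 0"
    and n: "n > 0"
    and X: "\<And>T S. card T = n \<Longrightarrow> T \<inter> X \<noteq> {} \<Longrightarrow> c (T, S) = 0"
  obtains b where "b \<in> chains (q + 1)"
    and "\<And>T S. card T > n \<Longrightarrow> c (T, S) - boundary b (T, S) = 0"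
    and "\<And>T S. card T = n \<Longrightarrow> T \<inter> insert i X \<noteq> {} \<Longrightarrow> c (T, S) - boundary b (T, S) = 0"
proof -
  define b where "b = (\<lambda>(T, S). if S \<in> K \<and> T \<subseteq> S \<and> i \<in> S - T \<and> Suc (card T) = n
      then sg (insert i T, S) (T, S) *\<^sub>R sec S i (c (insert i T, S)) else 0)"
  have b: "b \<in> chains (q + 1)"
  proof (rule chainsI)
    fix T S
    assume TS: "cell (q + 1) T S"
    show "b (T, S) \<in> res T ` V S"
    proof (cases "i \<in> S - T \<and> Suc (card T) = n")
      case True
      have S: "S \<in> K" "insert i T \<subseteq> S" using TS True by (auto simp: cell_def)
      obtain a where a: "a \<in> V S" "c (insert i T, S) = res (insert i T) a"
        using chains_image[OF c S(1)] by blast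
      have "sec S i (c (insert i T, S)) = res T (sec S i a)"
        using a sec_res[OF S] True by simp
      moreover have "sec S i a \<in> V S" using sec_V[OF S(1)] True a by simp
      ultimately show ?thesis
        using S(1) by (auto simp: b_def intro!: image_V_sign sg_sign zero_image_V)
    next
      case False
      with TS show ?thesis by (auto simp: b_def cell_def intro: zero_image_V)
    qed
  next
    fix T S
    assume TS: "\<not> cell (q + 1) T S"
    show "b (T, S) = 0"
    proof (cases "S \<in> K \<and> T \<subseteq> S \<and> i \<in> S - T")
      case True
      then have "\<not> cell q (insert i T) S"
        using TS finite_subsimplex[of S T] by (auto simp: cell_def)
      with c have "c (insert i T, S) = 0" by (rule chains_not_cell)
      then show ?thesis
        using True linear_0[OF linear_sec, of S i] by (simp add: b_def)
    qed (auto simp: b_def)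
  qed
  have b0: "b (T, S) = 0" if "Suc (card T) \<noteq> n" for T S
    using that by (auto simp: b_def)
  have bi: "b (T, S) = 0" if "i \<in> T \<or> i \<notin> S" for T S
    using that by (auto simp: b_def)
  \<comment> \<open>The other summand of the boundary evaluates b at the same T, whose size is not n
    - 1.\<close>
  have bd_b: "boundary b (T, S) = (\<Sum>k\<in>T. sg (T, S) (T - {k}, S) *\<^sub>R res T (b (T - {k}, S)))"
    if "card T \<ge> n" "S \<in> K" "T \<subseteq> S" for T S
    using that by (simp add: boundary_def b0)
  have bd_large: "boundary b (T, S) = 0" if "card T > n" for T S
  proof (cases "S \<in> K \<and> T \<subseteq> S")
    case True
    then have "finite T" using finite_subsimplex by blast
    then have "b (T - {k}, S) = 0" if "k \<in> T" for k
      using card.remove[OF _ that] \<open>card T > n\<close> by (intro b0) simp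
    then show ?thesis
      using True that by (simp add: bd_b linear_0[OF linear_res])
  qed (auto simp: boundary_def)
  have "c (T, S) - boundary b (T, S) = 0" if T: "card T = n" "T \<inter> insert i X \<noteq> {}" for T S
  proof (cases "S \<in> K \<and> T \<subseteq> S")
    case True
    then have S: "S \<in> K" "T \<subseteq> S" and fT: "finite T"
      using finite_subsimplex by auto
    show ?thesis
    proof (cases "i \<in> T")
      case True
      have card_T: "Suc (card (T - {i})) = n"
        using card.remove[OF fT True] T by simp
      have bi': "b (T - {k}, S) = 0" if "k \<in> T - {i}" for k
        using True that by (intro bi) auto
      have "boundary b (T, S) = sg (T, S) (T - {i}, S) *\<^sub>R res T (b (T - {i}, S))"
        using sum.remove[OF fT True, of "\<lambda>k. sg (T, S) (T - {k}, S) *\<^sub>R res T (b (T - {k}, S))"] S T True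
        by (simp add: bd_b bi' linear_0[OF linear_res])
      also have "b (T - {i}, S) = sg (T, S) (T - {i}, S) *\<^sub>R sec S i (c (T, S))"
        using S True card_T insert_absorb[OF True] by (auto simp: b_def)
      also have "sg (T, S) (T - {i}, S) *\<^sub>R res T (sg (T, S) (T - {i}, S) *\<^sub>R sec S i (c (T, S))) =
          res T (sec S i (c (T, S)))"
        using sign_like_square[OF sg_sign] by (simp add: linear_scale[OF linear_res])
      also have "\<dots> = res T (res {i} (sec S i (c (T, S))))"
        using True by (simp add: res_res insert_absorb)
      also have "\<dots> = res T (res {i} (c (T, S)))"
        using res_sec[OF S(1), of i] True S(2) by (simp only: subsetD)
      also have "\<dots> = res T (c (T, S))"
        using True by (simp add: res_res insert_absorb)
      also have "\<dots> = c (T, S)"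
        by (rule res_image_V[OF chains_image[OF c S(1)]])
      finally show ?thesis by simp
    next
      case False
      then have cTS: "c (T, S) = 0" using X T by blast
      show ?thesis
      proof (cases "i \<in> S")
        case iS: True
        \<comment> \<open>Here \<open>insert i T\<close> has size n + 1, where c vanishes by
          \<open>top\<close>, so closedness leaves a relation among the values of c at sets of size
          n. Its term k = i is \<open>c (T, S)\<close>, which is 0 by the hypothesis on X.\<close>
        have "boundary c (insert i T, S) = 0" by (rule closed) auto
        moreover have "boundary c (insert i T, S) =
          (\<Sum>k\<in>insert i T. sg (insert i T, S) (insert i T - {k}, S) *\<^sub>R res (insert i T) (c (insert i T - {k}, S)))"
          using S iS T fT False by (simp add: boundary_def top)
        moreover have "insert i T - {i} = T" using False by auto
        ultimately have "(\<Sum>k\<in>T. sg (insert i T, S) (insert i T - {k}, S) *\<^sub>R res (insert i T) (c (insert i T - {k}, S))) = 0"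
          using fT False cTS by (simp add: linear_0[OF linear_res])
        then have "sec S i (\<Sum>k\<in>T. sg (insert i T, S) (insert i T - {k}, S) *\<^sub>R res (insert i T) (c (insert i T - {k}, S))) = 0"
          using linear_0[OF linear_sec[OF S(1) iS]] by simp
        then have 0: "(\<Sum>k\<in>T. sg (insert i T, S) (insert i T - {k}, S) *\<^sub>R res T (sec S i (c (insert i T - {k}, S)))) = 0"
          using sec_res[OF S(1), of i T] iS S False
          by (simp add: linear_sum[OF linear_sec[OF S(1) iS]] linear_scale[OF linear_sec[OF S(1) iS]])
        have "boundary b (T, S) = (\<Sum>k\<in>T. sg (T, S) (T - {k}, S) *\<^sub>R res T (b (T - {k}, S)))"
          using T S by (simp add: bd_b)
        also have "\<dots> = (\<Sum>k\<in>T. - sg (insert i T, S) (T, S) *\<^sub>R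
            (sg (insert i T, S) (insert i T - {k}, S) *\<^sub>R res T (sec S i (c (insert i T - {k}, S)))))"
        proof (rule sum.cong)
          fix k
          assume k: "k \<in> T"
          have cT: "Suc (card (T - {k})) = n"
            using card.remove[OF fT k] T by simp
          have ins: "insert k (T - {k}) = T" "insert i (T - {k}) = insert i T - {k}"
            using k False by auto
          have "b (T - {k}, S) = sg (insert i T - {k}, S) (T - {k}, S) *\<^sub>R sec S i (c (insert i T - {k}, S))"
            using S iS False cT k by (auto simp: b_def ins)
          \<comment> \<open>Anticommutativity of the square at i and k replaces the signs by a
            factor independent of k times the sign in the closedness relation, so the factor can be
            pulled out of the sum.\<close>
          moreover have "sg (T, S) (T - {k}, S) * sg (insert i T - {k}, S) (T - {k}, S) =
              - sg (insert i T, S) (T, S) * sg (insert i T, S) (insert i T - {k}, S)"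
          proof -
            have "sg (insert i T, S) (insert i T - {k}, S) * sg (insert i T - {k}, S) (T - {k}, S) =
              - (sg (insert i T, S) (T, S) * sg (T, S) (T - {k}, S))"
              using sg_square_down[OF S(1), of i k "T - {k}"] k False iS S unfolding ins by auto
            moreover have "sign_like (sg (insert i T, S) (insert i T - {k}, S))"
              "sign_like (sg (insert i T - {k}, S) (T - {k}, S))"
              "sign_like (sg (insert i T, S) (T, S))" "sign_like (sg (T, S) (T - {k}, S))"
              by (rule sg_sign)+
            ultimately show ?thesis by (auto simp: sign_like_def)
          qed
          ultimately show "sg (T, S) (T - {k}, S) *\<^sub>R res T (b (T - {k}, S)) =
             - sg (insert i T, S) (T, S) *\<^sub>R
            (sg (insert i T, S) (insert i T - {k}, S) *\<^sub>R res T (sec S i (c (insert i T - {k}, S))))"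
            by (simp add: linear_scale[OF linear_res])
        qed simp
        also have "\<dots> = 0"
          unfolding scaleR_sum_right[symmetric] 0 by simp
        finally show ?thesis by (simp add: cTS)
      next
        case False
        then show ?thesis
          using T S by (simp add: cTS bd_b bi linear_0[OF linear_res])
      qed
    qed
  next
    case False
    then have "\<not> cell q T S" by (auto simp: cell_def)
    with False show ?thesis
      using chains_not_cell[OF c] by (auto simp: boundary_def)
  qed
  with b top bd_large show ?thesis
    by (intro that[of b]) auto
qed

lemma closed_diff_boundary:
  assumes "\<And>T S. T \<noteq> {} \<Longrightarrow> boundary c (T, S) = 0" and "T \<noteq> {}"
  shows "boundary (\<lambda>x. c x - boundary b x) (T, S) = 0"
  using assms by (simp add: boundary_diff boundary_boundary)

text \<open>One vertex at a time: subtracting the boundary for a new vertex keeps the zeros obtained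
  for the earlier ones, and the fillings add up.\<close>

lemma eliminate_vertices:
  assumes "finite X" and c: "c \<in> chains q"
    and closed: "\<And>T S. T \<noteq> {} \<Longrightarrow> boundary c (T, S) = 0"
    and top: "\<And>T S. card T > n \<Longrightarrow> c (T, S) = 0"
    and n: "n > 0"
  shows "\<exists>b\<in>chains (q + 1). (\<forall>T S. card T > n \<longrightarrow> c (T, S) - boundary b (T, S) = 0) \<and>
    (\<forall>T S. card T = n \<longrightarrow> T \<inter> X \<noteq> {} \<longrightarrow> c (T, S) - boundary b (T, S) = 0)"
  using \<open>finite X\<close>
proof (induction X)
  case empty
  have "boundary (\<lambda>x. 0) x = 0" for x
    by (cases x) (simp add: boundary_def linear_0[OF linear_res])
  then show ?case using top chains_zero by (intro bexI[of _ "\<lambda>x. 0"]) auto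
next
  case (insert i X)
  then obtain b where b: "b \<in> chains (q + 1)"
    "\<And>T S. card T > n \<Longrightarrow> c (T, S) - boundary b (T, S) = 0"
    "\<And>T S. card T = n \<Longrightarrow> T \<inter> X \<noteq> {} \<Longrightarrow> c (T, S) - boundary b (T, S) = 0"
    by blast
  let ?c = "\<lambda>x. c x - boundary b x"
  have c': "?c \<in> chains q"
    using chains_diff[OF c] boundary_chains[OF b(1)] by simp
  obtain b' where b': "b' \<in> chains (q + 1)"
    "\<And>T S. card T > n \<Longrightarrow> ?c (T, S) - boundary b' (T, S) = 0"
    "\<And>T S. card T = n \<Longrightarrow> T \<inter> insert i X \<noteq> {} \<Longrightarrow> ?c (T, S) - boundary b' (T, S) = 0"
    using eliminate_vertex[OF c' closed_diff_boundary[OF closed] b(2) n b(3)] by metis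
  then show ?case
    using chains_add[OF b(1) b'(1)]
    by (intro bexI[of _ "\<lambda>x. b x + b' x"]) (auto simp: boundary_add algebra_simps)
qed

text \<open>Descending on the bound n for the size of T. Applying the elimination with all vertices
  of the complex clears the whole stratum of the largest size, since a nonempty T always meets the
  vertex set.\<close>

lemma eliminate_strata:
  assumes c: "c \<in> chains q"
    and closed: "\<And>T S. T \<noteq> {} \<Longrightarrow> boundary c (T, S) = 0"
    and top: "\<And>T S. card T > n \<Longrightarrow> c (T, S) = 0"
  shows "\<exists>b\<in>chains (q + 1). \<forall>T S. T \<noteq> {} \<longrightarrow> c (T, S) - boundary b (T, S) = 0"
  using assms
proof (induction n arbitrary: c)
  case 0
  have "boundary (\<lambda>x. 0) x = 0" for x
    by (cases x) (simp add: boundary_def linear_0[OF linear_res])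
  moreover have "c (T, S) = 0" if "T \<noteq> {}" for T S
  proof (cases "cell q T S")
    case True
    then have "finite T" using finite_subsimplex by (auto simp: cell_def)
    then show ?thesis using 0(3)[of T S] that by (simp add: card_gt_0_iff)
  qed (use chains_not_cell[OF 0(1)] in auto)
  ultimately show ?case
    using chains_zero by (intro bexI[of _ "\<lambda>x. 0"]) auto
next
  case (Suc n)
  have finX: "finite (\<Union>K)" using finite_complex finite_simplex by blast
  obtain b where b: "b \<in> chains (q + 1)"
    "\<And>T S. card T > Suc n \<Longrightarrow> c (T, S) - boundary b (T, S) = 0"
    "\<And>T S. card T = Suc n \<Longrightarrow> T \<inter> \<Union>K \<noteq> {} \<Longrightarrow> c (T, S) - boundary b (T, S) = 0"
    using eliminate_vertices[OF finX Suc.prems(1,2,3)] by (metis zero_less_Suc)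
  let ?c = "\<lambda>x. c x - boundary b x"
  have c': "?c \<in> chains q"
    using chains_diff[OF Suc.prems(1)] boundary_chains[OF b(1)] by simp
  have top': "?c (T, S) = 0" if "card T > n" for T S
  proof (cases "cell q T S")
    case True
    then have "T \<noteq> {}" "T \<subseteq> \<Union>K" using that by (auto simp: cell_def)
    then have "T \<inter> \<Union>K \<noteq> {}" by blast
    then show ?thesis using b(2,3)[of T S] that by (cases "card T = Suc n") auto
  qed (use chains_not_cell[OF c'] in auto)
  obtain b' where b': "b' \<in> chains (q + 1)" "\<And>T S. T \<noteq> {} \<Longrightarrow> ?c (T, S) - boundary b' (T, S) = 0"
    using Suc.IH[OF c' closed_diff_boundary[OF Suc.prems(2)] top'] by blast
  then show ?case
    using chains_add[OF b(1) b'(1)]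
    by (intro bexI[of _ "\<lambda>x. b x + b' x"]) (auto simp: boundary_add algebra_simps)
qed

text \<open>For a chain concentrated on T = {}, the second condition says precisely that its
  boundary vanishes at the cells ({i}, S), hence at all cells with T nonempty.\<close>

definition core_chains :: "int \<Rightarrow> ('x set \<times> 'x set \<Rightarrow> 'a) set" where
  "core_chains q = {d \<in> chains q. (\<forall>T S. T \<noteq> {} \<longrightarrow> d (T, S) = 0) \<and>
     (\<forall>S\<in>K. \<forall>i\<in>S. res {i} (d ({}, S)) = 0)}"

text \<open>
  Exactness of the cubes in positive codimension at infinity pushes every cycle, and every chain
  bounding a core chain, into the finite part of the compactification.
\<close>

theorem core_reduction:
  assumes c: "c \<in> chains q"
    and closed: "\<And>T S. T \<noteq> {} \<Longrightarrow> boundary c (T, S) = 0"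
  obtains b where "b \<in> chains (q + 1)" and "(\<lambda>x. c x - boundary b x) \<in> core_chains q"
proof -
  have "finite (\<Union>K)" using finite_complex finite_simplex by blast
  then have "card T \<le> card (\<Union>K)" if "cell q T S" for T S
    using that by (intro card_mono) (auto simp: cell_def)
  then have "c (T, S) = 0" if "card T > card (\<Union>K)" for T S
    using that chains_not_cell[OF c, of T S] by (meson not_le)
  then obtain b where b: "b \<in> chains (q + 1)" "\<And>T S. T \<noteq> {} \<Longrightarrow> c (T, S) - boundary b (T, S) = 0"
    using eliminate_strata[OF c closed] by blast
  let ?d = "\<lambda>x. c x - boundary b x"
  have d: "?d \<in> chains q"
    using chains_diff[OF c] boundary_chains[OF b(1)] by simp
  have "res {i} (?d ({}, S)) = 0" if "S \<in> K" "i \<in> S" for S i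
  proof -
    have "boundary ?d ({i}, S) = sg ({i}, S) ({}, S) *\<^sub>R res {i} (?d ({}, S))"
      using that b(2) by (simp add: boundary_def[of ?d])
    moreover have "boundary ?d ({i}, S) = 0"
      by (rule closed_diff_boundary[OF closed]) auto
    ultimately show ?thesis
      using sg_sign[of "({i}, S)" "({}, S)"] by (auto simp: sign_like_def)
  qed
  then show ?thesis
    using that[OF b(1)] d b(2) by (simp add: core_chains_def)
qed

end

section \<open>Integer spans\<close>

text \<open>The additive subgroup generated by X. It is defined in any abelian group because it is
  applied to lattice vectors, to real functions on lists of functionals, and to the elements of free
  abelian groups.\<close>

inductive_set zspan :: "'a::ab_group_add set \<Rightarrow> 'a set" for X where
  zspan_zero: "0 \<in> zspan X"
| zspan_add_base: "a \<in> zspan X \<Longrightarrow> x \<in> X \<Longrightarrow> a + x \<in> zspan X"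
| zspan_diff_base: "a \<in> zspan X \<Longrightarrow> x \<in> X \<Longrightarrow> a - x \<in> zspan X"

lemma zspan_base: "x \<in> X \<Longrightarrow> x \<in> zspan X"
  using zspan_add_base[OF zspan_zero] by force

lemma zspan_add:
  assumes "a \<in> zspan X" "b \<in> zspan X" shows "a + b \<in> zspan X"
  using assms(2)
proof induction
  case (zspan_add_base b x)
  then show ?case using zspan.zspan_add_base[of "a + b" X x] by (simp add: add.assoc)
next
  case (zspan_diff_base b x)
  then show ?case using zspan.zspan_diff_base[of "a + b" X x] by (simp add: add_diff_eq)
qed (simp add: assms)

lemma zspan_minus:
  assumes "a \<in> zspan X" shows "- a \<in> zspan X"
  using assms
proof induction
  case (zspan_add_base b x)
  then show ?case using zspan.zspan_diff_base[of "- b" X x] by simp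
next
  case (zspan_diff_base b x)
  then show ?case using zspan.zspan_add_base[of "- b" X x] by (simp add: add.commute)
qed (simp add: zspan_zero)

lemma zspan_diff: "a \<in> zspan X \<Longrightarrow> b \<in> zspan X \<Longrightarrow> a - b \<in> zspan X"
  using zspan_add[OF _ zspan_minus, of a X b] by simp

lemma zspan_sum: "(\<And>i. i \<in> I \<Longrightarrow> f i \<in> zspan X) \<Longrightarrow> (\<Sum>i\<in>I. f i) \<in> zspan X"
  by (induction I rule: infinite_finite_induct) (auto intro: zspan_zero zspan_add)

text \<open>Closure under differences together with 0 already makes Y a subgroup. Most statements
  about integer spans below are proved by taking for Y the set of elements with the desired
  property.\<close>

lemma zspan_minimal:
  assumes "X \<subseteq> Y" "0 \<in> Y" "\<And>a b. a \<in> Y \<Longrightarrow> b \<in> Y \<Longrightarrow> a - b \<in> Y"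
  shows "zspan X \<subseteq> Y"
proof
  fix a assume "a \<in> zspan X"
  then show "a \<in> Y"
  proof induction
    case (zspan_add_base a x)
    then have "a - (0 - x) \<in> Y" using assms by blast
    then show ?case by simp
  qed (use assms in auto)
qed

lemma zspan_subset_iff: "zspan X \<subseteq> zspan Y \<longleftrightarrow> X \<subseteq> zspan Y"
proof
  show "X \<subseteq> zspan Y" if "zspan X \<subseteq> zspan Y"
    using that zspan_base by blast
  show "zspan X \<subseteq> zspan Y" if "X \<subseteq> zspan Y"
    using that zspan_zero zspan_diff by (rule zspan_minimal)
qed

lemma zspan_mono: "X \<subseteq> Y \<Longrightarrow> zspan X \<subseteq> zspan Y"
  by (auto simp: zspan_subset_iff intro: zspan_base)

lemma zspan_image:
  assumes "\<And>a b. f (a + b) = f a + f b"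
  shows "f ` zspan X = zspan (f ` X)"
proof -
  have 0: "f 0 = 0" using assms[of 0 0] by simp
  have diff: "f (a - b) = f a - f b" for a b using assms[of "a - b" b] by (simp add: algebra_simps)
  have "zspan X \<subseteq> {a. f a \<in> zspan (f ` X)}"
    by (rule zspan_minimal) (auto simp: 0 diff intro: zspan_base zspan_zero zspan_diff)
  moreover have "zspan (f ` X) \<subseteq> f ` zspan X"
  proof (rule zspan_minimal)
    show "0 \<in> f ` zspan X" using 0 zspan_zero by force
    fix a b assume "a \<in> f ` zspan X" "b \<in> f ` zspan X"
    then show "a - b \<in> f ` zspan X" by (auto simp: diff[symmetric] intro: zspan_diff)
  qed (auto intro: zspan_base)
  ultimately show ?thesis by blast
qed

lemma zspan_Union: "zspan (\<Union>i\<in>I. zspan (X i)) = zspan (\<Union>i\<in>I. X i)"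
proof
  show "zspan (\<Union>i\<in>I. zspan (X i)) \<subseteq> zspan (\<Union>i\<in>I. X i)"
    unfolding zspan_subset_iff using zspan_mono[of "X _" "\<Union>i\<in>I. X i"] by blast
qed (auto intro!: zspan_mono intro: zspan_base)

lemma zspan_Un_split:
  assumes "a \<in> zspan (X \<union> Y)"
  obtains b c where "b \<in> zspan X" "c \<in> zspan Y" "a = b + c"
proof -
  have "zspan (X \<union> Y) \<subseteq> {b + c | b c. b \<in> zspan X \<and> c \<in> zspan Y}"
  proof (rule zspan_minimal)
    show "X \<union> Y \<subseteq> {b + c | b c. b \<in> zspan X \<and> c \<in> zspan Y}"
    proof
      fix a assume "a \<in> X \<union> Y"
      then have "a + 0 = a" "0 + a = a" "a \<in> zspan X \<or> a \<in> zspan Y" "0 \<in> zspan X" "0 \<in> zspan Y"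
        using zspan_base zspan_zero by auto
      then show "a \<in> {b + c | b c. b \<in> zspan X \<and> c \<in> zspan Y}"
        unfolding mem_Collect_eq by metis
    qed
    show "0 \<in> {b + c | b c. b \<in> zspan X \<and> c \<in> zspan Y}"
      using zspan_zero[of X] zspan_zero[of Y] add_0_left[of 0] unfolding mem_Collect_eq by metis
    fix a a' assume "a \<in> {b + c | b c. b \<in> zspan X \<and> c \<in> zspan Y}" "a' \<in> {b + c | b c. b \<in> zspan X \<and> c \<in> zspan Y}"
    then obtain b c b' c' where "a = b + c" "a' = b' + c'" "b \<in> zspan X" "b' \<in> zspan X" "c \<in> zspan Y" "c' \<in> zspan Y"
      by blast
    then have "a - a' = (b - b') + (c - c')" "b - b' \<in> zspan X" "c - c' \<in> zspan Y"
      by (auto intro: zspan_diff)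
    then show "a - a' \<in> {b + c | b c. b \<in> zspan X \<and> c \<in> zspan Y}" by blast
  qed
  with assms that show ?thesis by blast
qed

lemma zspan_scale:
  fixes a :: "'a::real_vector"
  assumes "a \<in> zspan X" shows "real_of_int k *\<^sub>R a \<in> zspan X"
proof (induction k rule: int_induct[where k = 0])
  case base then show ?case by (simp add: zspan_zero)
next
  case (step1 i) then show ?case using zspan_add[OF _ assms] by (simp add: scaleR_add_left)
next
  case (step2 i) then show ?case using zspan_diff[OF _ assms] by (simp add: scaleR_diff_left)
qed

lemma zspan_finite:
  fixes B :: "'a::real_vector set"
  assumes "finite B"
  shows "zspan B = range (\<lambda>c. \<Sum>b\<in>B. real_of_int (c b) *\<^sub>R b)"
proof
  show "zspan B \<subseteq> range (\<lambda>c. \<Sum>b\<in>B. real_of_int (c b) *\<^sub>R b)"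
  proof (rule zspan_minimal)
    show "B \<subseteq> range (\<lambda>c. \<Sum>b\<in>B. real_of_int (c b) *\<^sub>R b)"
    proof
      fix x assume "x \<in> B"
      then have "x = (\<Sum>b\<in>B. real_of_int (if b = x then 1 else 0) *\<^sub>R b)"
        using assms by (simp add: if_distrib[of real_of_int] if_distrib[of "\<lambda>s. s *\<^sub>R _"] cong: if_cong)
      then show "x \<in> range (\<lambda>c. \<Sum>b\<in>B. real_of_int (c b) *\<^sub>R b)"
        using rangeI[of "\<lambda>c. \<Sum>b\<in>B. real_of_int (c b) *\<^sub>R b" "\<lambda>b. if b = x then 1 else 0"]
        by simp
    qed
    show "0 \<in> range (\<lambda>c. \<Sum>b\<in>B. real_of_int (c b) *\<^sub>R b)"
      using rangeI[of "\<lambda>c. \<Sum>b\<in>B. real_of_int (c b) *\<^sub>R b" "\<lambda>_. 0"] by simp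
    fix x y assume "x \<in> range (\<lambda>c. \<Sum>b\<in>B. real_of_int (c b) *\<^sub>R b)" "y \<in> range (\<lambda>c. \<Sum>b\<in>B. real_of_int (c b) *\<^sub>R b)"
    then obtain c d where "x = (\<Sum>b\<in>B. real_of_int (c b) *\<^sub>R b)" "y = (\<Sum>b\<in>B. real_of_int (d b) *\<^sub>R b)"
      by blast
    then have "x - y = (\<Sum>b\<in>B. real_of_int (c b - d b) *\<^sub>R b)"
      by (simp add: sum_subtractf scaleR_diff_left)
    then show "x - y \<in> range (\<lambda>c. \<Sum>b\<in>B. real_of_int (c b) *\<^sub>R b)"
      using rangeI[of "\<lambda>c. \<Sum>b\<in>B. real_of_int (c b) *\<^sub>R b" "\<lambda>b. c b - d b"] by simp
  qed
qed (auto intro: zspan_sum zspan_scale zspan_base)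

section \<open>Determinants of functionals on vectors\<close>

text \<open>With pointwise scaling, functions on lists of functionals form a real vector space, so
  that \<open>linear\<close> and integer spans make sense for them.\<close>

instantiation "fun" :: (type, real_vector) real_vector
begin

definition scaleR_fun :: "real \<Rightarrow> ('a \<Rightarrow> 'b) \<Rightarrow> 'a \<Rightarrow> 'b" where
  "scaleR_fun r f = (\<lambda>x. r *\<^sub>R f x)"

instance
  by standard (auto simp: scaleR_fun_def fun_eq_iff scaleR_add_right scaleR_add_left)

end

lemma scaleR_fun_apply [simp]: "(r *\<^sub>R f) x = r *\<^sub>R f x"
  by (simp add: scaleR_fun_def)

text \<open>The natural pairing of the wedge product of xs with that of fs: rows belong to
  functionals, columns to vectors. The size is taken from xs alone, hence the hypotheses on lengths
  below.\<close>

definition alt :: "'v list \<Rightarrow> ('v \<Rightarrow> real) list \<Rightarrow> real" where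
  "alt xs fs = Determinant.det (Matrix.mat (length xs) (length xs) (\<lambda>(i, j). (fs ! i) (xs ! j)))"

lemma alt_Leibniz:
  "alt xs fs = (\<Sum>\<pi> | \<pi> permutes {0..<length xs}.
     signof \<pi> * (\<Prod>i = 0..<length xs. (fs ! i) (xs ! \<pi> i)))"
proof -
  have "(\<Prod>i = 0..<length xs. Matrix.mat (length xs) (length xs) (\<lambda>(i, j). (fs ! i) (xs ! j)) $$ (i, \<pi> i)) =
      (\<Prod>i = 0..<length xs. (fs ! i) (xs ! \<pi> i))"
    if "\<pi> permutes {0..<length xs}" for \<pi>
    using permutes_in_image[OF that] by (intro prod.cong) auto
  then show ?thesis
    unfolding alt_def by (subst det_def'[where n = "length xs"]) auto
qed

lemma alt_cong:
  assumes "length xs = length ys"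
    and "\<And>i j. i < length xs \<Longrightarrow> j < length xs \<Longrightarrow> (fs ! i) (xs ! j) = (gs ! i) (ys ! j)"
  shows "alt xs fs = alt ys gs"
proof -
  have "Matrix.mat (length xs) (length xs) (\<lambda>(i, j). (fs ! i) (xs ! j)) =
    Matrix.mat (length ys) (length ys) (\<lambda>(i, j). (gs ! i) (ys ! j))"
    using assms by (intro eq_matI) auto
  then show ?thesis by (simp add: alt_def)
qed

text \<open>Evaluation at x is a function on functionals, so vectors and functionals may exchange
  roles; the matrix is transposed. Each rule proved for functionals thereby gives a rule for
  vectors.\<close>

lemma alt_dual:
  assumes "length fs = length xs"
  shows "alt fs (map (\<lambda>x f. f x) xs) = alt xs fs"
proof -
  have "Matrix.mat (length fs) (length fs) (\<lambda>(i, j). (map (\<lambda>x f. f x) xs ! i) (fs ! j)) =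
      transpose_mat (Matrix.mat (length xs) (length xs) (\<lambda>(i, j). (fs ! i) (xs ! j)))"
    using assms by (intro eq_matI) auto
  then show ?thesis
    by (simp add: alt_def Determinant.det_transpose[where n = "length xs"])
qed

lemma alt_add_fun:
  assumes "length xs = Suc (length as + length bs)"
  shows "alt xs (as @ (\<lambda>x. f x + g x) # bs) = alt xs (as @ f # bs) + alt xs (as @ g # bs)"
proof -
  let ?n = "length xs" and ?k = "length as"
  have k: "?k \<in> {0..<?n}" using assms by simp
  have "(\<Prod>i = 0..<?n. ((as @ h # bs) ! i) (xs ! \<pi> i)) =
      h (xs ! \<pi> ?k) * (\<Prod>i \<in> {0..<?n} - {?k}. ((as @ f # bs) ! i) (xs ! \<pi> i))" for h \<pi>
    by (subst prod.remove[OF _ k]) (auto intro!: prod.cong simp: nth_append nth_Cons' split: if_splits)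
  then show ?thesis
    unfolding alt_Leibniz by (simp add: algebra_simps sum.distrib)
qed

lemma alt_scale_fun:
  assumes "length xs = Suc (length as + length bs)"
  shows "alt xs (as @ (\<lambda>x. c * f x) # bs) = c * alt xs (as @ f # bs)"
proof -
  let ?n = "length xs" and ?k = "length as"
  have k: "?k \<in> {0..<?n}" using assms by simp
  have "(\<Prod>i = 0..<?n. ((as @ h # bs) ! i) (xs ! \<pi> i)) =
      h (xs ! \<pi> ?k) * (\<Prod>i \<in> {0..<?n} - {?k}. ((as @ f # bs) ! i) (xs ! \<pi> i))" for h \<pi>
    by (subst prod.remove[OF _ k]) (auto intro!: prod.cong simp: nth_append nth_Cons' split: if_splits)
  then show ?thesis
    unfolding alt_Leibniz by (simp add: algebra_simps sum_distrib_left)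
qed

lemma alt_swap_fun:
  assumes "length xs = Suc (Suc (length as + length bs))"
  shows "alt xs (as @ f # g # bs) = - alt xs (as @ g # f # bs)"
proof -
  let ?n = "length xs" and ?k = "length as"
  let ?A = "Matrix.mat ?n ?n (\<lambda>(i, j). ((as @ g # f # bs) ! i) (xs ! j))"
  have "Matrix.mat ?n ?n (\<lambda>(i, j). ((as @ f # g # bs) ! i) (xs ! j)) = swaprows ?k (Suc ?k) ?A"
    using assms by (intro eq_matI) (auto simp: nth_append nth_Cons' mat_swaprows_def)
  moreover have "Determinant.det (swaprows ?k (Suc ?k) ?A) = - Determinant.det ?A"
    using assms by (intro det_swaprows[where n = ?n]) auto
  ultimately show ?thesis by (simp add: alt_def)
qed

lemma alt_zero_fun:
  assumes "length fs = length xs" "f \<in> set fs" "\<And>x. x \<in> set xs \<Longrightarrow> f x = 0"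
  shows "alt xs fs = 0"
proof -
  obtain as bs where fs: "fs = as @ f # bs" using assms(2) by (metis split_list)
  have "alt xs fs = alt xs (as @ (\<lambda>x. 0 * f x) # bs)"
    using assms by (intro alt_cong) (auto simp: fs nth_append nth_Cons')
  then show ?thesis
    using assms(1) by (subst (asm) alt_scale_fun) (auto simp: fs)
qed

lemma alt_zero_vec:
  assumes "length fs = length xs" "x \<in> set xs" "\<And>f. f \<in> set fs \<Longrightarrow> f x = 0"
  shows "alt xs fs = 0"
proof -
  have "alt fs (map (\<lambda>x f. f x) xs) = 0"
    using assms by (intro alt_zero_fun[of _ _ "\<lambda>f. f x"]) auto
  then show ?thesis using alt_dual[OF assms(1)] by simp
qed

text \<open>The functionals are arbitrary functions at this point, so linearity enters only as a
  hypothesis on their values at the vectors concerned.\<close>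

lemma alt_linear_vec:
  assumes "length fs = Suc (length as + length bs)" "\<And>f. f \<in> set fs \<Longrightarrow> f z = c * f x + d * f y"
  shows "alt (as @ z # bs) fs = c * alt (as @ x # bs) fs + d * alt (as @ y # bs) fs"
proof -
  let ?e = "\<lambda>x f. f x"
  have "alt (as @ z # bs) fs = alt fs (map ?e as @ (\<lambda>f. c * f x + d * f y) # map ?e bs)"
    using assms by (subst alt_dual[symmetric]) (auto intro!: alt_cong simp: nth_append nth_Cons')
  also have "\<dots> = c * alt fs (map ?e as @ ?e x # map ?e bs) + d * alt fs (map ?e as @ ?e y # map ?e bs)"
    using assms(1) by (simp add: alt_add_fun alt_scale_fun)
  also have "alt fs (map ?e as @ ?e x # map ?e bs) = alt (as @ x # bs) fs"
    using alt_dual[of fs "as @ x # bs"] assms(1) by simp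
  also have "alt fs (map ?e as @ ?e y # map ?e bs) = alt (as @ y # bs) fs"
    using alt_dual[of fs "as @ y # bs"] assms(1) by simp
  finally show ?thesis .
qed

lemma alt_swap_vec:
  assumes "length fs = Suc (Suc (length as + length bs))"
  shows "alt (as @ x # y # bs) fs = - alt (as @ y # x # bs) fs"
  using alt_swap_fun[of fs "map (\<lambda>x f. f x) as" "map (\<lambda>x f. f x) bs" "\<lambda>f. f x" "\<lambda>f. f y"]
    alt_dual[of fs "as @ x # y # bs"] alt_dual[of fs "as @ y # x # bs"] assms by simp

lemma alt_repeated_vec:
  assumes "length fs = length xs" "\<not> distinct xs"
  shows "alt xs fs = 0"
proof -
  obtain i j where ij: "i < length xs" "j < length xs" "i \<noteq> j" "xs ! i = xs ! j"
    using assms(2) by (auto simp: distinct_conv_nth)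
  let ?A = "Matrix.mat (length xs) (length xs) (\<lambda>(i, j). (fs ! i) (xs ! j))"
  have "Determinant.det (transpose_mat ?A) = 0"
    using ij by (intro det_identical_rows[where n = "length xs" and i = i and j = j]) auto
  then show ?thesis
    by (simp add: alt_def Determinant.det_transpose[where n = "length xs"])
qed

text \<open>Laplace expansion along the first column, which has only its corner entry. This and the
  row version below compute the effect of prepending a vector, on which the signs of the complex are
  based.\<close>

lemma alt_Cons_vec:
  assumes "length fs = length xs" "\<And>g. g \<in> set fs \<Longrightarrow> g x = 0"
  shows "alt (x # xs) (f # fs) = f x * alt xs fs"
proof -
  let ?n = "length xs"
  let ?A = "Matrix.mat (Suc ?n) (Suc ?n) (\<lambda>(i, j). ((f # fs) ! i) ((x # xs) ! j))"
  have "?A $$ (i, 0) = 0" if "0 < i" "i < Suc ?n" for i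
    using that assms by (auto simp: nth_Cons')
  moreover have "Determinant.det ?A = (\<Sum>i<Suc ?n. ?A $$ (i, 0) * Determinant.cofactor ?A i 0)"
    by (rule Determinant.laplace_expansion_column) auto
  ultimately have "Determinant.det ?A = ?A $$ (0, 0) * Determinant.cofactor ?A 0 0"
    by (subst (asm) sum.remove[of _ 0]) (auto intro!: sum.neutral)
  also have "Determinant.mat_delete ?A 0 0 = Matrix.mat ?n ?n (\<lambda>(i, j). (fs ! i) (xs ! j))"
    by (intro eq_matI) (auto simp: mat_delete_def)
  then have "Determinant.cofactor ?A 0 0 = alt xs fs"
    by (simp add: Determinant.cofactor_def alt_def)
  finally show ?thesis by (simp add: alt_def)
qed

lemma alt_Cons_fun:
  assumes "length fs = length xs" "\<And>y. y \<in> set xs \<Longrightarrow> f y = 0"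
  shows "alt (x # xs) (f # fs) = f x * alt xs fs"
  using alt_Cons_vec[of "map (\<lambda>x f. f x) xs" fs f "\<lambda>f. f x"] assms
    alt_dual[of "f # fs" "x # xs"] alt_dual[of fs xs] by auto

text \<open>The hypothesis factors the matrix of fs on xs through the vectors L and the functionals
  D; the determinant is multiplicative.\<close>

lemma alt_product:
  assumes "length L = length xs" "length D = length xs" "length fs = length xs"
    and "\<And>f x. f \<in> set fs \<Longrightarrow> x \<in> set xs \<Longrightarrow> f x = (\<Sum>k<length xs. f (L ! k) * (D ! k) x)"
  shows "alt xs fs = alt L fs * alt xs D"
proof -
  let ?n = "length xs"
  let ?M = "\<lambda>ys gs. Matrix.mat ?n ?n (\<lambda>(i, j). (gs ! i) (ys ! j))"
  have "?M xs fs = ?M L fs * ?M xs D"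
    using assms by (intro eq_matI) (auto simp: scalar_prod_def atLeast0LessThan)
  then show ?thesis
    using assms by (simp add: alt_def Determinant.det_mult[where n = ?n])
qed

lemma alt_dual_basis:
  assumes "length D = length L"
    and "\<And>i j. i < length L \<Longrightarrow> j < length L \<Longrightarrow> (D ! i) (L ! j) = (if i = j then 1 else 0)"
  shows "alt L D = 1"
proof -
  have "Matrix.mat (length L) (length L) (\<lambda>(i, j). (D ! i) (L ! j)) = 1\<^sub>m (length L)"
    using assms by (intro eq_matI) auto
  then show ?thesis by (simp add: alt_def)
qed

lemma alt_Ints:
  assumes "length fs = length xs" "\<And>f x. f \<in> set fs \<Longrightarrow> x \<in> set xs \<Longrightarrow> f x \<in> \<int>"
  shows "alt xs fs \<in> \<int>"
  unfolding alt_Leibniz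
proof (intro Ints_sum Ints_mult Ints_prod)
  fix \<pi> i
  assume "\<pi> \<in> {\<pi>. \<pi> permutes {0..<length xs}}" and i: "i \<in> {0..<length xs}"
  then have "\<pi> i < length xs" using permutes_in_image[of \<pi> "{0..<length xs}" i] by simp
  with i assms show "(fs ! i) (xs ! \<pi> i) \<in> \<int>" by auto
qed (auto simp: sign_def)

section \<open>Alternating forms on functionals\<close>

text \<open>Adjacent transpositions connect any two orderings of a list: each required entry is
  moved to the front in turn.\<close>

lemma swap_invariant_mset:
  assumes "\<And>as a b bs. P (as @ a # b # bs) \<Longrightarrow> P (as @ b # a # bs)"
    and "mset xs = mset ys" "P xs"
  shows "P ys"
proof -
  have move: "P (as @ a # cs @ bs) \<Longrightarrow> P (as @ cs @ a # bs)" for as a cs bs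
  proof (induction cs arbitrary: as)
    case (Cons c cs)
    have "P ((as @ [c]) @ a # cs @ bs)" using assms(1)[of as a c "cs @ bs"] Cons.prems by simp
    then show ?case using Cons.IH[of "as @ [c]"] by simp
  qed simp
  have "P (as @ xs) \<Longrightarrow> P (as @ ys)" if "mset xs = mset ys" for as xs ys
    using that
  proof (induction xs arbitrary: as ys)
    case (Cons x xs)
    then have "x \<in> set ys" by (metis list.set_intros(1) mset_eq_setD)
    then obtain us vs where ys: "ys = us @ x # vs" by (metis split_list)
    with Cons.prems have m: "mset xs = mset (us @ vs)" by simp
    have "P ((as @ [x]) @ us @ vs)"
      by (rule Cons.IH) (use Cons.prems m in auto)
    then have "P (as @ x # us @ vs)" by simp
    then show ?case unfolding ys by (rule move)
  qed simp
  from this[of xs ys "[]"] assms show ?thesis by simp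
qed

definition functionals :: "'v::real_vector set \<Rightarrow> ('v \<Rightarrow> real) set" where
  "functionals T = {f. linear f \<and> (\<forall>t\<in>T. f t = 0)}"

text \<open>The functionals killing T are the dual of the quotient by the span of T, so this models
  the projection of an exterior power to a stratum at infinity. The default value 0 keeps all strata
  in one function space and turns composition of projections into union of index sets.\<close>

definition restr :: "'v::real_vector set \<Rightarrow> (('v \<Rightarrow> real) list \<Rightarrow> real) \<Rightarrow> ('v \<Rightarrow> real) list \<Rightarrow> real" where
  "restr T \<phi> = (\<lambda>fs. if set fs \<subseteq> functionals T then \<phi> fs else 0)"

text \<open>The image of the wedge product of xs among functions on lists of functionals. Lists of
  the wrong length or with a nonlinear entry get the value 0, so that identities between forms are
  equalities of functions.\<close>

definition form :: "'v::real_vector list \<Rightarrow> ('v \<Rightarrow> real) list \<Rightarrow> real" where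
  "form xs = restr {} (\<lambda>fs. if length fs = length xs then alt xs fs else 0)"

text \<open>The action of an endomorphism on exterior powers, seen on the dual side: for linear h it
  applies h to every vector of a form.\<close>

definition precomp :: "('v::real_vector \<Rightarrow> 'v) \<Rightarrow> (('v \<Rightarrow> real) list \<Rightarrow> real) \<Rightarrow> ('v \<Rightarrow> real) list \<Rightarrow> real" where
  "precomp h \<phi> = restr {} (\<lambda>fs. \<phi> (map (\<lambda>f. f \<circ> h) fs))"

lemma functionals_Un: "functionals (T \<union> T') = functionals T \<inter> functionals T'"
  by (auto simp: functionals_def)

lemma functionals_add: "f \<in> functionals T \<Longrightarrow> g \<in> functionals T \<Longrightarrow> (\<lambda>x. f x + g x) \<in> functionals T"
  by (auto simp: functionals_def intro: linear_compose_add)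

lemma functionals_scale: "f \<in> functionals T \<Longrightarrow> (\<lambda>x. c * f x) \<in> functionals T"
  using linear_compose_scale_right[of f c] by (auto simp: functionals_def)

lemma functionals_zero: "(\<lambda>x. 0) \<in> functionals T"
  by (auto simp: functionals_def linear_zero)

lemma functionals_sum: "(\<And>i. i \<in> I \<Longrightarrow> f i \<in> functionals T) \<Longrightarrow> (\<lambda>x. \<Sum>i\<in>I. f i x) \<in> functionals T"
  by (induction I rule: infinite_finite_induct) (auto intro: functionals_zero functionals_add)

lemma functionals_span: "f \<in> functionals T \<Longrightarrow> x \<in> span T \<Longrightarrow> f x = 0"
  unfolding functionals_def using linear_eq_0_on_span by blast

lemma restr_add: "restr T (\<phi> + \<psi>) = restr T \<phi> + restr T \<psi>"
  by (auto simp: restr_def fun_eq_iff)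

lemma linear_restr: "linear (restr T)"
  by (rule linearI) (auto simp: restr_def fun_eq_iff)

lemma restr_restr: "restr T (restr T' \<phi>) = restr (T \<union> T') \<phi>"
  by (auto simp: restr_def functionals_Un fun_eq_iff)

lemma restr_form: "restr T (form xs) = restr T (\<lambda>fs. if length fs = length xs then alt xs fs else 0)"
  by (simp add: form_def restr_restr)

lemma form_apply: "set fs \<subseteq> functionals {} \<Longrightarrow> length fs = length xs \<Longrightarrow> form xs fs = alt xs fs"
  by (simp add: form_def restr_def)

lemma restr_form_apply:
  "set fs \<subseteq> functionals T \<Longrightarrow> length fs = length xs \<Longrightarrow> restr T (form xs) fs = alt xs fs"
  unfolding restr_form by (simp add: restr_def)

lemma restr_form_eqI:
  assumes "length xs = length ys"
    and "\<And>fs. set fs \<subseteq> functionals T \<Longrightarrow> length fs = length xs \<Longrightarrow> alt xs fs = alt ys fs"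
  shows "restr T (form xs) = restr T (form ys)"
  using assms unfolding restr_form by (auto simp: restr_def fun_eq_iff)

lemma restr_form_zeroI:
  assumes "\<And>fs. set fs \<subseteq> functionals T \<Longrightarrow> length fs = length xs \<Longrightarrow> alt xs fs = 0"
  shows "restr T (form xs) = 0"
  using assms unfolding restr_form by (auto simp: restr_def fun_eq_iff)

lemma restr_form_vanish:
  assumes "x \<in> set xs" "x \<in> span T" shows "restr T (form xs) = 0"
  by (rule restr_form_zeroI, rule alt_zero_vec[OF _ assms(1)])
     (use assms(2) functionals_span in blast)+

lemma form_repeated: "\<not> distinct xs \<Longrightarrow> form xs = 0"
  using alt_repeated_vec by (auto simp: form_def restr_def fun_eq_iff)

lemma form_linear:
  "form (as @ (c *\<^sub>R x + d *\<^sub>R y) # bs) = c *\<^sub>R form (as @ x # bs) + d *\<^sub>R form (as @ y # bs)"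
proof
  fix fs :: "('a \<Rightarrow> real) list"
  have "f (c *\<^sub>R x + d *\<^sub>R y) = c * f x + d * f y" if "f \<in> functionals {}" for f
    using that by (auto simp: functionals_def linear_add linear_scale)
  then show "form (as @ (c *\<^sub>R x + d *\<^sub>R y) # bs) fs = (c *\<^sub>R form (as @ x # bs) + d *\<^sub>R form (as @ y # bs)) fs"
    by (auto simp: form_def restr_def intro: alt_linear_vec)
qed

lemma form_swap: "form (as @ x # y # bs) = - form (as @ y # x # bs)"
proof
  show "form (as @ x # y # bs) fs = (- form (as @ y # x # bs)) fs" for fs
    using alt_swap_vec[of fs as bs x y] by (auto simp: form_def restr_def)
qed

lemma form_add: "form (as @ (x + y) # bs) = form (as @ x # bs) + form (as @ y # bs)"
  using form_linear[of as 1 x 1 y bs] by simp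

lemma form_diff: "form (as @ (x - y) # bs) = form (as @ x # bs) - form (as @ y # bs)"
  using form_linear[of as 1 x "-1" y bs] by simp

lemma form_zero: "form (as @ 0 # bs) = 0"
  using form_linear[of as 0 0 0 0 bs] by simp

lemma form_scale: "form (as @ (c *\<^sub>R x) # bs) = c *\<^sub>R form (as @ x # bs)"
  using form_linear[of as c x 0 0 bs] by simp

lemma form_sum: "form (as @ (\<Sum>i\<in>I. c i *\<^sub>R x i) # bs) = (\<Sum>i\<in>I. c i *\<^sub>R form (as @ x i # bs))"
  by (induction I rule: infinite_finite_induct) (auto simp: form_zero form_add form_scale)

lemma linear_precomp: "linear (precomp h)"
  by (rule linearI) (auto simp: precomp_def restr_def fun_eq_iff)

lemma precomp_form:
  assumes "linear h" shows "precomp h (form xs) = form (map h xs)"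
proof
  fix fs :: "('a \<Rightarrow> real) list"
  have "linear (f \<circ> h)" if "linear f" for f :: "'a \<Rightarrow> real"
    using linear_compose[OF assms that] .
  then show "precomp h (form xs) fs = form (map h xs) fs"
    by (auto simp: precomp_def form_def restr_def functionals_def intro!: alt_cong)
qed

text \<open>Properties shared by all integer combinations of forms of degree p. They no longer
  mention vectors, and the vanishing criterion for core forms uses nothing else.\<close>

definition alternating :: "nat \<Rightarrow> (('v::real_vector \<Rightarrow> real) list \<Rightarrow> real) \<Rightarrow> bool" where
  "alternating p \<phi> \<longleftrightarrow>
     (\<forall>fs. \<not> (length fs = p \<and> set fs \<subseteq> functionals {}) \<longrightarrow> \<phi> fs = 0) \<and>
     (\<forall>as f g bs. \<phi> (as @ f # g # bs) = - \<phi> (as @ g # f # bs)) \<and>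
     (\<forall>as f g bs. f \<in> functionals {} \<longrightarrow> g \<in> functionals {} \<longrightarrow>
        \<phi> (as @ (\<lambda>x. f x + g x) # bs) = \<phi> (as @ f # bs) + \<phi> (as @ g # bs)) \<and>
     (\<forall>as f c bs. f \<in> functionals {} \<longrightarrow> \<phi> (as @ (\<lambda>x. c * f x) # bs) = c * \<phi> (as @ f # bs))"

lemma alternatingI:
  assumes "\<And>fs. \<not> (length fs = p \<and> set fs \<subseteq> functionals {}) \<Longrightarrow> \<phi> fs = 0"
    and "\<And>as f g bs. \<phi> (as @ f # g # bs) = - \<phi> (as @ g # f # bs)"
    and "\<And>as f g bs. f \<in> functionals {} \<Longrightarrow> g \<in> functionals {} \<Longrightarrow>
        \<phi> (as @ (\<lambda>x. f x + g x) # bs) = \<phi> (as @ f # bs) + \<phi> (as @ g # bs)"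
    and "\<And>as f c bs. f \<in> functionals {} \<Longrightarrow> \<phi> (as @ (\<lambda>x. c * f x) # bs) = c * \<phi> (as @ f # bs)"
  shows "alternating p \<phi>"
  using assms unfolding alternating_def by blast

lemma
  assumes "alternating p \<phi>"
  shows alternating_support: "\<not> (length fs = p \<and> set fs \<subseteq> functionals {}) \<Longrightarrow> \<phi> fs = 0"
    and alternating_swap: "\<phi> (as @ f # g # bs) = - \<phi> (as @ g # f # bs)"
    and alternating_add_fun: "f \<in> functionals {} \<Longrightarrow> g \<in> functionals {} \<Longrightarrow>
        \<phi> (as @ (\<lambda>x. f x + g x) # bs) = \<phi> (as @ f # bs) + \<phi> (as @ g # bs)"
    and alternating_scale_fun: "f \<in> functionals {} \<Longrightarrow> \<phi> (as @ (\<lambda>x. c * f x) # bs) = c * \<phi> (as @ f # bs)"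
  using assms unfolding alternating_def by blast+

lemma alternating_form: "alternating (length xs) (form xs)"
proof (rule alternatingI)
  show "form xs (as @ f # g # bs) = - form xs (as @ g # f # bs)" for as f g bs
    using alt_swap_fun[of xs as bs f g] by (auto simp: form_def restr_def)
qed (auto simp: form_def restr_def functionals_add functionals_scale alt_add_fun alt_scale_fun)

lemma alternating_zero: "alternating p 0"
  by (rule alternatingI) auto

lemma alternating_diff:
  assumes "alternating p \<phi>" "alternating p \<psi>" shows "alternating p (\<phi> - \<psi>)"
proof (rule alternatingI)
  show "(\<phi> - \<psi>) (as @ f # g # bs) = - (\<phi> - \<psi>) (as @ g # f # bs)" for as f g bs
    using alternating_swap[OF assms(1), of as f g bs] alternating_swap[OF assms(2), of as f g bs] by simp
qed (use assms in \<open>auto simp: alternating_support alternating_add_fun alternating_scale_fun algebra_simps\<close>)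

lemma alternating_scale:
  assumes "alternating p \<phi>" shows "alternating p (c *\<^sub>R \<phi>)"
proof (rule alternatingI)
  show "(c *\<^sub>R \<phi>) (as @ f # g # bs) = - (c *\<^sub>R \<phi>) (as @ g # f # bs)" for as f g bs
    using alternating_swap[OF assms, of as f g bs] by simp
qed (use assms in \<open>auto simp: alternating_support alternating_add_fun alternating_scale_fun algebra_simps\<close>)

lemma alternating_zspan:
  "(\<And>\<phi>. \<phi> \<in> X \<Longrightarrow> alternating p \<phi>) \<Longrightarrow> \<phi> \<in> zspan X \<Longrightarrow> alternating p \<phi>"
  using zspan_minimal[of X "{\<phi>. alternating p \<phi>}"] alternating_zero alternating_diff by blast

lemma alternating_expand:
  assumes "alternating p \<phi>" "\<And>i. i \<in> I \<Longrightarrow> d i \<in> functionals {}" "g \<in> functionals {}"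
  shows "\<phi> (as @ (\<lambda>x. (\<Sum>i\<in>I. c i * d i x) + g x) # bs) = (\<Sum>i\<in>I. c i * \<phi> (as @ d i # bs)) + \<phi> (as @ g # bs)"
  using assms(2)
proof (induction I rule: infinite_finite_induct)
  case (insert i I)
  have 1: "(\<lambda>x. c i * d i x) \<in> functionals {}" using insert by (intro functionals_scale) auto
  have 2: "(\<lambda>x. (\<Sum>i\<in>I. c i * d i x) + g x) \<in> functionals {}"
    using insert assms(3) by (intro functionals_add functionals_sum functionals_scale) auto
  have "\<phi> (as @ (\<lambda>x. c i * d i x + ((\<Sum>i\<in>I. c i * d i x) + g x)) # bs) =
      \<phi> (as @ (\<lambda>x. c i * d i x) # bs) + \<phi> (as @ (\<lambda>x. (\<Sum>i\<in>I. c i * d i x) + g x) # bs)"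
    using assms(1) 1 2 by (rule alternating_add_fun)
  moreover have "\<phi> (as @ (\<lambda>x. c i * d i x) # bs) = c i * \<phi> (as @ d i # bs)"
    using assms(1) insert.prems by (intro alternating_scale_fun) auto
  ultimately show ?case using insert by (simp add: add.assoc)
qed auto

text \<open>Multilinearity reduces vanishing to argument lists from G. The index type is left free;
  in the application the decomposition is indexed by the generators of a cone.\<close>

lemma alternating_vanish:
  assumes \<phi>: "alternating p \<phi>"
    and G: "G \<subseteq> functionals {}" "\<And>gs. length gs = p \<Longrightarrow> set gs \<subseteq> G \<Longrightarrow> \<phi> gs = 0"
    and decomp: "\<And>f. f \<in> functionals {} \<Longrightarrow> \<exists>I c d g. (\<forall>i\<in>I::'i set. d i \<in> G) \<and> g \<in> G \<and> f = (\<lambda>x. (\<Sum>i\<in>I. c i * d i x) + g x)"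
  shows "\<phi> = 0"
proof -
  \<comment> \<open>The entries in gs have already been replaced by elements of G, those in fs are
    still arbitrary.\<close>
  have "\<phi> (gs @ fs) = 0" if "set gs \<subseteq> G" "length (gs @ fs) = p" "set fs \<subseteq> functionals {}" for gs fs
    using that
  proof (induction fs arbitrary: gs)
    case Nil then show ?case using G by simp
  next
    case (Cons f fs)
    then obtain I :: "'i set" and c d g
      where f: "\<forall>i\<in>I. d i \<in> G" "g \<in> G" "f = (\<lambda>x. (\<Sum>i\<in>I. c i * d i x) + g x)"
      using decomp[of f] by auto
    have "\<phi> (gs @ h # fs) = 0" if "h \<in> G" for h
      using Cons.IH[of "gs @ [h]"] Cons.prems that by auto
    then show ?case
      using f G(1) by (subst f(3), subst alternating_expand[OF \<phi>]) auto
  qed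
  from this[of "[]"] have "\<phi> fs = 0" if "length fs = p \<and> set fs \<subseteq> functionals {}" for fs
    using that by simp
  then show ?thesis using alternating_support[OF \<phi>] by (auto simp: fun_eq_iff)
qed

section \<open>Dual bases\<close>

text \<open>Coordinates are wanted as linear functionals on the whole ambient type, which may be
  larger than the span of B; \<open>construct\<close> supplies such an extension.\<close>

definition coord :: "'v::real_vector set \<Rightarrow> 'v \<Rightarrow> 'v \<Rightarrow> real" where
  "coord B b = construct B (\<lambda>x. if x = b then 1 else 0)"

lemma linear_coord: "independent B \<Longrightarrow> linear (coord B b)"
  unfolding coord_def by (rule linear_construct)

lemma coord_basis: "independent B \<Longrightarrow> x \<in> B \<Longrightarrow> coord B b x = (if x = b then 1 else 0)"
  unfolding coord_def by (simp add: construct_basis)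

lemma inj_on_coord: "independent B \<Longrightarrow> inj_on (coord B) B"
proof (rule inj_onI)
  fix x y assume "independent B" "x \<in> B" "y \<in> B" "coord B x = coord B y"
  then show "x = y" using coord_basis[of B x x] coord_basis[of B x y] by (auto split: if_splits)
qed

lemma coord_functional: "independent B \<Longrightarrow> T \<subseteq> B \<Longrightarrow> b \<notin> T \<Longrightarrow> coord B b \<in> functionals T"
  by (auto simp: functionals_def linear_coord coord_basis)

lemma coord_zspan_Ints:
  assumes "independent B" "x \<in> zspan B" shows "coord B b x \<in> \<int>"
proof -
  have "zspan B \<subseteq> {x. coord B b x \<in> \<int>}"
    by (rule zspan_minimal)
       (use assms(1) in \<open>auto simp: coord_basis linear_0 linear_diff linear_coord\<close>)
  with assms(2) show ?thesis by blast
qed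

lemma coord_expansion:
  assumes "independent B" "finite B" "x \<in> span B"
  shows "x = (\<Sum>b\<in>B. coord B b x *\<^sub>R b)"
proof -
  have lin: "linear (\<lambda>x. \<Sum>b\<in>B. coord B b x *\<^sub>R b)"
    using linear_coord[OF assms(1)]
    by (intro linear_compose_sum ballI linearI) (auto simp: linear_add linear_scale scaleR_add_left)
  have "(\<Sum>b\<in>B. coord B b y *\<^sub>R b) = y" if "y \<in> B" for y
    using assms that by (simp add: coord_basis if_distrib[of "\<lambda>s. s *\<^sub>R _"] cong: if_cong)
  then show ?thesis
    using linear_eq_on_span[OF linear_ident lin, of B x] assms(3) by simp
qed

lemma span_subset_coord:
  assumes "independent B" "finite B" "T \<subseteq> B" "x \<in> span B"
  shows "x \<in> span T \<longleftrightarrow> (\<forall>b\<in>B - T. coord B b x = 0)"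
proof
  assume "x \<in> span T"
  then show "\<forall>b\<in>B - T. coord B b x = 0"
    using functionals_span coord_functional[OF assms(1,3)] by blast
next
  assume 0: "\<forall>b\<in>B - T. coord B b x = 0"
  have "x = (\<Sum>b\<in>B. coord B b x *\<^sub>R b)"
    using assms by (intro coord_expansion) auto
  also have "\<dots> = (\<Sum>b\<in>T. coord B b x *\<^sub>R b)"
    using assms 0 by (intro sum.mono_neutral_right) auto
  finally have "x = (\<Sum>b\<in>T. coord B b x *\<^sub>R b)" .
  moreover have "(\<Sum>b\<in>T. coord B b x *\<^sub>R b) \<in> span T"
    by (intro span_sum span_scale span_base)
  ultimately show "x \<in> span T" by simp
qed

lemma zspan_subset_span: "zspan X \<subseteq> span X"
  by (rule zspan_minimal) (auto intro: span_base span_zero span_diff)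

text \<open>A lattice vector has integral coordinates, and membership in the span of T removes those
  outside T. Part of a basis thus spans a saturated sublattice, which identifies
  \<open>N_sigma\<close> with the integer span of the generators of sigma.\<close>

lemma zspan_Int_span:
  assumes "independent B" "finite B" "T \<subseteq> B"
  shows "zspan B \<inter> span T = zspan T"
proof
  show "zspan T \<subseteq> zspan B \<inter> span T"
    using zspan_mono[OF assms(3)] zspan_subset_span by blast
  show "zspan B \<inter> span T \<subseteq> zspan T"
  proof
    fix x assume x: "x \<in> zspan B \<inter> span T"
    then have xB: "x \<in> span B" using zspan_subset_span by blast
    have "\<forall>b\<in>B - T. coord B b x = 0"
      using span_subset_coord[OF assms xB] x by blast
    then have "x = (\<Sum>b\<in>T. coord B b x *\<^sub>R b)"
      using coord_expansion[OF assms(1,2) xB] assms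
      by (subst (asm) sum.mono_neutral_right[of B T]) auto
    moreover have "coord B b x *\<^sub>R b \<in> zspan T" if "b \<in> T" for b
    proof -
      obtain k where "coord B b x = of_int k"
        using coord_zspan_Ints[OF assms(1), of x b] x by (auto elim: Ints_cases)
      then show ?thesis using zspan_scale[OF zspan_base[OF that], of k] by simp
    qed
    then have "(\<Sum>b\<in>T. coord B b x *\<^sub>R b) \<in> zspan T" by (rule zspan_sum)
    ultimately show "x \<in> zspan T" by (rule ssubst)
  qed
qed

lemma int_basis_zspan: "int_basis N B \<longleftrightarrow> finite B \<and> independent B \<and> N = zspan B"
  unfolding int_basis_def using zspan_finite[of B] by auto

lemma alt_coord:
  assumes "independent B" "set L \<subseteq> B" "distinct L"
  shows "alt L (map (coord B) L) = 1"
proof (rule alt_dual_basis)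
  fix i j assume "i < length L" "j < length L"
  then show "(map (coord B) L ! i) (L ! j) = (if i = j then 1 else 0)"
    using assms nth_eq_iff_index_eq[of L j i] subsetD[OF assms(2), of "L ! j"]
    by (auto simp: coord_basis)
qed simp

lemma form_coord:
  assumes "independent B" "set L \<subseteq> B - T" "T \<subseteq> B" "distinct L"
  shows "restr T (form L) (map (coord B) L) = 1"
  using assms coord_functional[OF assms(1,3)] alt_coord[of B L]
  by (subst restr_form_apply) auto

lemma alt_subset_coord:
  assumes "independent B" "set L \<subseteq> B" "set L' \<subseteq> B" "length L' = length L" "distinct L"
    "\<not> set L \<subseteq> set L'"
  shows "alt L' (map (coord B) L) = 0"
proof -
  obtain b where b: "b \<in> set L" "b \<notin> set L'" using assms by blast
  then have "coord B b x = 0" if "x \<in> set L'" for x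
    using assms(3) that by (subst coord_basis[OF assms(1)]) auto
  then show ?thesis
    using assms(4) b by (intro alt_zero_fun[of _ _ "coord B b"]) auto
qed

text \<open>The coordinates along L describe the quotient of the span of S by the span of T. The
  determinant factors through them, and the factor depending on xs is the coefficient.\<close>

lemma restr_form_top:
  assumes B: "independent B" "finite B" "T \<subseteq> S" "S \<subseteq> B"
    and L: "distinct L" "set L = S - T" "length xs = length L" and xs: "set xs \<subseteq> span S"
  shows "restr T (form xs) = alt xs (map (coord B) L) *\<^sub>R restr T (form L)"
proof
  fix fs
  \<comment> \<open>The coordinates of x outside S vanish and f kills T, so only the generators in L
    contribute.\<close>
  have exp: "f x = (\<Sum>k<length L. f (L ! k) * (map (coord B) L ! k) x)"
    if f: "f \<in> functionals T" and x: "x \<in> span S" for f x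
  proof -
    have xB: "x \<in> span B" using x span_mono[OF B(4)] by blast
    have fT: "f b = 0" if "b \<in> T" for b using f that by (simp add: functionals_def)
    have "x = (\<Sum>b\<in>B. coord B b x *\<^sub>R b)" using B xB by (intro coord_expansion)
    then have "f x = f (\<Sum>b\<in>B. coord B b x *\<^sub>R b)" by simp
    also have "\<dots> = (\<Sum>b\<in>B. coord B b x * f b)"
      using f by (simp add: functionals_def linear_sum linear_scale)
    also have "\<dots> = (\<Sum>b\<in>set L. coord B b x * f b)"
      using B L span_subset_coord[OF B(1,2,4) xB] x fT
      by (intro sum.mono_neutral_right) auto
    also have "\<dots> = (\<Sum>k<length L. coord B (L ! k) x * f (L ! k))"
      using bij_betw_nth[OF L(1)] by (intro sum.reindex_bij_betw[symmetric]) auto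
    finally show ?thesis by (simp add: mult.commute)
  qed
  show "restr T (form xs) fs = (alt xs (map (coord B) L) *\<^sub>R restr T (form L)) fs"
  proof (cases "set fs \<subseteq> functionals T \<and> length fs = length xs")
    case True
    then have "alt xs fs = alt L fs * alt xs (map (coord B) L)"
      using L(3) xs exp by (intro alt_product) (simp_all add: subset_eq)
    then show ?thesis using True L by (simp add: restr_form_apply)
  next
    case False
    then show ?thesis using L(3) unfolding restr_form by (auto simp: restr_def)
  qed
qed

section \<open>The cubical system of a unimodular simplicial complex\<close>

text \<open>The combinatorial content of a unimodular fan: K is the complex of sets of primitive
  generators, and each simplex extends to a basis of N. The assumptions involve no convex
  geometry.\<close>

locale lattice_complex =
  fixes N :: "'v::real_vector set" and K :: "'v set set"
  assumes finite_K: "finite K" and empty_K: "{} \<in> K"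
    and subset_K: "S \<in> K \<Longrightarrow> T \<subseteq> S \<Longrightarrow> T \<in> K"
    and basis_K: "S \<in> K \<Longrightarrow> \<exists>B. int_basis N B \<and> S \<subseteq> B"
begin

text \<open>The completion is chosen for each simplex on its own; the bases of nested simplices need
  not be related.\<close>

definition basis :: "'v set \<Rightarrow> 'v set" where
  "basis S = (SOME B. int_basis N B \<and> S \<subseteq> B)"

lemma
  assumes "S \<in> K"
  shows finite_basis: "finite (basis S)" and independent_basis: "independent (basis S)"
    and zspan_basis: "zspan (basis S) = N" and subset_basis: "S \<subseteq> basis S"
  using someI_ex[OF basis_K[OF assms]] by (auto simp: basis_def int_basis_zspan)

lemma finite_K_simplex: "S \<in> K \<Longrightarrow> finite S"
  using finite_basis subset_basis finite_subset by blast

lemma zspan_K: "S \<in> K \<Longrightarrow> zspan S \<subseteq> N"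
  using zspan_basis zspan_mono[OF subset_basis] by blast

lemma N_subset_span_basis: "S \<in> K \<Longrightarrow> N \<subseteq> span (basis S)"
  using zspan_basis zspan_subset_span by blast

definition proj :: "'v set \<Rightarrow> 'v \<Rightarrow> 'v \<Rightarrow> 'v" where
  "proj S i x = x - coord (basis S) i x *\<^sub>R i"

lemma linear_proj: "S \<in> K \<Longrightarrow> linear (proj S i)"
  unfolding proj_def
  using linear_coord[OF independent_basis]
  by (intro linear_compose_sub linear_ident linearI) (auto simp: linear_add linear_scale scaleR_add_left)

text \<open>The simplex E may have generators outside \<open>basis S\<close>. It is enough that the
  coordinate of i is integral on all of N, so that an integer multiple of the element i of E is
  subtracted. This keeps the section inside \<open>V p S\<close>, whose forms come from various
  cones E.\<close>

lemma proj_zspan: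
  assumes "S \<in> K" "i \<in> E" "E \<in> K" "x \<in> zspan E"
  shows "proj S i x \<in> zspan E"
proof -
  have "coord (basis S) i x \<in> \<int>"
    using coord_zspan_Ints[OF independent_basis[OF assms(1)]] zspan_K[OF assms(3)] zspan_basis[OF assms(1)] assms(4) by blast
  then obtain k where "coord (basis S) i x = of_int k" by (auto elim: Ints_cases)
  then show ?thesis
    using zspan_diff[OF assms(4) zspan_scale[OF zspan_base[OF assms(2)], of k]] by (simp add: proj_def)
qed

lemma proj_simplex:
  assumes "S \<in> K" "t \<in> S" "i \<in> S"
  shows "proj S i t = (if t = i then 0 else t)"
  using assms subset_basis[OF assms(1)] by (auto simp: proj_def coord_basis independent_basis)

text \<open>The coefficient group of a cell with tau = 0; for general tau it is restricted to T. The
  entries of one form lie in a common cone E, whereas different forms may use different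
  cones.\<close>

definition V :: "nat \<Rightarrow> 'v set \<Rightarrow> (('v \<Rightarrow> real) list \<Rightarrow> real) set" where
  "V p S = zspan {form xs | xs. length xs = p \<and> (\<exists>E\<in>K. S \<subseteq> E \<and> set xs \<subseteq> zspan E)}"

lemma form_V: "length xs = p \<Longrightarrow> E \<in> K \<Longrightarrow> S \<subseteq> E \<Longrightarrow> set xs \<subseteq> zspan E \<Longrightarrow> form xs \<in> V p S"
  unfolding V_def by (intro zspan_base) blast

lemma alternating_V: "\<phi> \<in> V p S \<Longrightarrow> alternating p \<phi>"
  unfolding V_def by (erule alternating_zspan[rotated]) (use alternating_form in blast)

lemma precomp_V:
  assumes "S \<in> K" "i \<in> S" "\<phi> \<in> V p S"
  shows "precomp (proj S i) \<phi> \<in> V p S"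
proof -
  let ?X = "{form xs | xs. length xs = p \<and> (\<exists>E\<in>K. S \<subseteq> E \<and> set xs \<subseteq> zspan E)}"
  have "precomp (proj S i) ` ?X \<subseteq> ?X"
  proof (rule image_subsetI)
    fix \<psi> assume "\<psi> \<in> ?X"
    then obtain xs E where xs: "\<psi> = form xs" "length xs = p" "E \<in> K" "S \<subseteq> E" "set xs \<subseteq> zspan E" by blast
    have "set (map (proj S i) xs) \<subseteq> zspan E"
      using proj_zspan[OF assms(1) _ xs(3)] assms(2) xs(4,5) by auto
    then show "precomp (proj S i) \<psi> \<in> ?X"
      using xs precomp_form[OF linear_proj[OF assms(1)], of i xs] by (metis (mono_tags, lifting) length_map mem_Collect_eq)
  qed
  then have "zspan (precomp (proj S i) ` ?X) \<subseteq> zspan ?X" by (rule zspan_mono)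
  moreover have "precomp (proj S i) ` zspan ?X = zspan (precomp (proj S i) ` ?X)"
    by (rule zspan_image) (rule linear_add[OF linear_precomp])
  ultimately have "precomp (proj S i) ` V p S \<subseteq> V p S"
    unfolding V_def by simp
  with assms(3) show ?thesis by blast
qed

text \<open>The forms that generate \<open>V p S\<close> have their vectors in N, where the
  coordinates are integral. This makes the multiplicity found in \<open>core_top\<close> an
  integer.\<close>

lemma V_Ints:
  assumes "S \<in> K" "\<phi> \<in> V p S" "set L \<subseteq> S" "length L = p"
  shows "\<phi> (map (coord (basis S)) L) \<in> \<int>"
proof -
  let ?D = "map (coord (basis S)) L"
  have lin: "set ?D \<subseteq> functionals {}"
    using linear_coord[OF independent_basis[OF assms(1)]] by (auto simp: functionals_def)
  have "V p S \<subseteq> {\<phi>. \<phi> ?D \<in> \<int>}"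
    unfolding V_def
  proof (rule zspan_minimal)
    show "{form xs | xs. length xs = p \<and> (\<exists>E\<in>K. S \<subseteq> E \<and> set xs \<subseteq> zspan E)} \<subseteq> {\<phi>. \<phi> ?D \<in> \<int>}"
    proof
      fix \<psi> assume "\<psi> \<in> {form xs | xs. length xs = p \<and> (\<exists>E\<in>K. S \<subseteq> E \<and> set xs \<subseteq> zspan E)}"
      then obtain xs E where xs: "\<psi> = form xs" "E \<in> K" "S \<subseteq> E" "set xs \<subseteq> zspan E" "p = length xs" by blast
      then have "form xs ?D = alt xs ?D" using lin assms(4) by (intro form_apply) auto
      moreover have "alt xs ?D \<in> \<int>"
      proof (rule alt_Ints)
        fix f x assume "f \<in> set ?D" "x \<in> set xs"
        then show "f x \<in> \<int>"
          using coord_zspan_Ints[OF independent_basis[OF assms(1)], of x] zspan_K[OF xs(2)] xs(4) zspan_basis[OF assms(1)]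
          by auto
      qed (use assms(4) xs in auto)
      ultimately show "\<psi> \<in> {\<phi>. \<phi> ?D \<in> \<int>}" using xs(1) by simp
    qed
  qed auto
  with assms(2) show ?thesis by blast
qed

text \<open>
  A functional splits into coordinates along \<open>S\<close> and a part killing \<open>S\<close>; a form that restricts to
  0 for every vertex of \<open>S\<close> only sees argument lists that involve all the coordinates.
\<close>

lemma core_vanish:
  assumes S: "S \<in> K" and \<phi>: "alternating p \<phi>" "\<And>i. i \<in> S \<Longrightarrow> restr {i} \<phi> = 0"
    and full: "\<And>gs. length gs = p \<Longrightarrow> coord (basis S) ` S \<subseteq> set gs \<Longrightarrow> \<phi> gs = 0"
  shows "\<phi> = 0"
proof (rule alternating_vanish[OF \<phi>(1), where G = "coord (basis S) ` S \<union> functionals S"])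
  note ind = independent_basis[OF S]
  show "coord (basis S) ` S \<union> functionals S \<subseteq> functionals {}"
    using linear_coord[OF ind] by (auto simp: functionals_def)
  fix gs assume gs: "length gs = p" "set gs \<subseteq> coord (basis S) ` S \<union> functionals S"
  show "\<phi> gs = 0"
  proof (cases "coord (basis S) ` S \<subseteq> set gs")
    case False
    then obtain i where i: "i \<in> S" "coord (basis S) i \<notin> set gs" by blast
    have "set gs \<subseteq> functionals {i}"
    proof
      fix g assume g: "g \<in> set gs"
      show "g \<in> functionals {i}"
      proof (cases "g \<in> functionals S")
        case True then show ?thesis using i by (auto simp: functionals_def)
      next
        case False
        then obtain k where k: "k \<in> S" "g = coord (basis S) k" using g gs by blast
        then have "k \<noteq> i" using g i by blast
        then show ?thesis using k i subset_basis[OF S] by (auto intro!: coord_functional[OF ind])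
      qed
    qed
    then have "\<phi> gs = restr {i} \<phi> gs" by (simp add: restr_def)
    then show ?thesis using \<phi>(2)[OF i(1)] by simp
  qed (use full gs in blast)
next
  note ind = independent_basis[OF S]
  fix f :: "'v \<Rightarrow> real" assume f: "f \<in> functionals {}"
  define g where "g = (\<lambda>x. f x - (\<Sum>i\<in>S. f i * coord (basis S) i x))"
  have "(\<lambda>x. f x + (\<Sum>i\<in>S. (- f i) * coord (basis S) i x)) \<in> functionals {}"
    using linear_coord[OF ind] f by (intro functionals_add functionals_sum functionals_scale) (auto simp: functionals_def)
  then have "linear g" by (simp add: g_def functionals_def sum_negf)
  moreover have "g t = 0" if "t \<in> S" for t
    using that subset_basis[OF S] finite_K_simplex[OF S]
    by (subst g_def) (simp add: coord_basis[OF ind] subsetD if_distrib[of "\<lambda>s. _ * s"] cong: if_cong)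
  ultimately have "g \<in> functionals S" by (simp add: functionals_def)
  moreover have "f = (\<lambda>x. (\<Sum>i\<in>S. f i * coord (basis S) i x) + g x)"
    by (simp add: g_def)
  ultimately show "\<exists>(I::'v set) c d g. (\<forall>i\<in>I. d i \<in> coord (basis S) ` S \<union> functionals S) \<and>
      g \<in> coord (basis S) ` S \<union> functionals S \<and> f = (\<lambda>x. (\<Sum>i\<in>I. c i * d i x) + g x)"
    by (intro exI[of _ S] exI[of _ f] exI[of _ "coord (basis S)"] exI[of _ g]) auto
qed

text \<open>A list of length p is too short to contain the coordinates of all elements of S, so the
  last condition of \<open>core_vanish\<close> is void.\<close>

lemma core_large:
  assumes S: "S \<in> K" and \<phi>: "\<phi> \<in> V p S" "\<And>i. i \<in> S \<Longrightarrow> restr {i} \<phi> = 0" and card: "card S > p"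
  shows "\<phi> = 0"
proof (rule core_vanish[OF S alternating_V[OF \<phi>(1)] \<phi>(2)])
  fix gs assume "length gs = p" "coord (basis S) ` S \<subseteq> set gs"
  then have "card (coord (basis S) ` S) \<le> p"
    using card_mono[of "set gs" "coord (basis S) ` S"] card_length[of gs] by simp
  then show "\<phi> gs = 0"
    using card card_image[OF inj_on_subset[OF inj_on_coord[OF independent_basis[OF S]] subset_basis[OF S]]] by simp
qed

text \<open>The multiplicity m is the value on the coordinates of L. After subtraction of m times
  the form, the remaining condition of \<open>core_vanish\<close> concerns lists of length p
  containing all p coordinates. These are permutations of one list with value 0, so antisymmetry
  settles them.\<close>

lemma core_top:
  assumes S: "S \<in> K" and \<phi>: "\<phi> \<in> V p S" "\<And>i. i \<in> S \<Longrightarrow> restr {i} \<phi> = 0"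
    and L: "distinct L" "set L = S" "length L = p"
  obtains m where "\<phi> = real_of_int m *\<^sub>R form L"
proof -
  let ?D = "map (coord (basis S)) L"
  note ind = independent_basis[OF S]
  obtain m where m: "\<phi> ?D = of_int m"
    using V_Ints[OF S \<phi>(1)] L by (auto elim: Ints_cases)
  define \<psi> where "\<psi> = \<phi> - real_of_int m *\<^sub>R form L"
  have alt_\<psi>: "alternating p \<psi>"
    unfolding \<psi>_def using alternating_V[OF \<phi>(1)] alternating_form[of L] L(3)
    by (intro alternating_diff alternating_scale) auto
  have lin: "set ?D \<subseteq> functionals {}"
    using linear_coord[OF ind] by (auto simp: functionals_def)
  have D0: "\<psi> ?D = 0"
    using m form_apply[OF lin] alt_coord[OF ind _ L(1)] subset_basis[OF S] L(2) by (simp add: \<psi>_def)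
  have "\<psi> = 0"
  proof (rule core_vanish[OF S alt_\<psi>])
    fix i assume i: "i \<in> S"
    have "restr {i} (form L) = 0"
      using i L(2) by (intro restr_form_vanish[of i]) (auto intro: span_base)
    then show "restr {i} \<psi> = 0"
      using \<phi>(2)[OF i] by (simp add: \<psi>_def linear_diff[OF linear_restr] linear_scale[OF linear_restr])
  next
    fix gs assume gs: "length gs = p" "coord (basis S) ` S \<subseteq> set gs"
    have dD: "distinct ?D"
      using L inj_on_subset[OF inj_on_coord[OF ind] subset_basis[OF S]] by (simp add: distinct_map)
    have "card (set ?D) = p" using distinct_card[OF dD] L(3) by simp
    moreover have "set ?D \<subseteq> set gs" using gs L by simp
    ultimately have "set gs = set ?D"
      using card_subset_eq[of "set gs" "set ?D"] card_mono[of "set gs" "set ?D"] card_length[of gs] gs(1) by auto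
    moreover from this have "distinct gs"
      using gs(1) \<open>card (set ?D) = p\<close> by (intro card_distinct) simp
    ultimately have "mset ?D = mset gs"
      using dD set_eq_iff_mset_eq_distinct by blast
    moreover have "\<psi> (as @ b # a # bs) = 0" if "\<psi> (as @ a # b # bs) = 0" for as a b bs
      using alternating_swap[OF alt_\<psi>, of as b a bs] that by simp
    ultimately show "\<psi> gs = 0"
      using swap_invariant_mset[of "\<lambda>gs. \<psi> gs = 0" ?D gs] D0 by blast
  qed
  then show ?thesis using that[of m] by (simp add: \<psi>_def)
qed

text \<open>Evaluation at a coordinate outside T followed by the coordinates of T returns exactly
  that coordinate of x, so a vanishing wedge leaves x no component outside T. Balancing is read off
  from the boundary in this way.\<close>

lemma form_Cons_zero_iff:
  assumes T: "T \<in> K" and L: "distinct L" "set L = T" and x: "x \<in> N"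
  shows "form (x # L) = 0 \<longleftrightarrow> x \<in> span T"
proof
  note ind = independent_basis[OF T]
  assume 0: "form (x # L) = 0"
  have "coord (basis T) b x = 0" if b: "b \<in> basis T - T" for b
  proof -
    let ?D = "map (coord (basis T)) (b # L)"
    have "set ?D \<subseteq> functionals {}" using linear_coord[OF ind] by (auto simp: functionals_def)
    then have "form (x # L) ?D = alt (x # L) ?D" by (intro form_apply) auto
    also have "\<dots> = coord (basis T) b x * alt L (map (coord (basis T)) L)"
    proof (simp, rule alt_Cons_fun)
      fix y assume "y \<in> set L"
      then show "coord (basis T) b y = 0"
        using L b subset_basis[OF T] by (subst coord_basis[OF ind]) auto
    qed simp
    also have "alt L (map (coord (basis T)) L) = 1"
      using subset_basis[OF T] L by (intro alt_coord ind) auto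
    finally show ?thesis using 0 by simp
  qed
  then show "x \<in> span T"
    using span_subset_coord[OF ind finite_basis[OF T] subset_basis[OF T]] N_subset_span_basis[OF T] x by blast
next
  assume "x \<in> span T"
  then obtain c where "x = (\<Sum>t\<in>T. c t *\<^sub>R t)"
    using span_finite[OF finite_K_simplex[OF T]] by blast
  then have "form (x # L) = (\<Sum>t\<in>T. c t *\<^sub>R form (t # L))"
    using form_sum[of "[]" c "\<lambda>t. t" T L] by simp
  then show "form (x # L) = 0"
    using L by (simp add: form_repeated)
qed

end

text \<open>
  \<open>nu\<close> is the image of the chosen generators: up to sign, the restricted form of any enumeration
  of \<open>S - T\<close>. The signs of the boundary operator are determined by prepending a vector.
\<close>

locale oriented_lattice_complex = lattice_complex N K
  for N :: "'v::real_vector set" and K +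
  fixes p :: nat
    and nu :: "'v set \<times> 'v set \<Rightarrow> ('v \<Rightarrow> real) list \<Rightarrow> real"
    and eps :: "'v set \<times> 'v set \<Rightarrow> 'v list \<Rightarrow> real"
    and sg :: "'v set \<times> 'v set \<Rightarrow> 'v set \<times> 'v set \<Rightarrow> real"
  assumes eps_sign: "sign_like (eps c L)"
    and sg_sign_like: "sign_like (sg c d)"
    and nu_eps: "S \<in> K \<Longrightarrow> T \<subseteq> S \<Longrightarrow> distinct L \<Longrightarrow> set L = S - T \<Longrightarrow> nu (T, S) = eps (T, S) L *\<^sub>R restr T (form L)"
    and sg_up: "S \<in> K \<Longrightarrow> T \<subseteq> S \<Longrightarrow> distinct (i # L) \<Longrightarrow> set (i # L) = S - T \<Longrightarrow>
           sg (T, S - {i}) (T, S) = eps (T, S - {i}) L * eps (T, S) (i # L)"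
    and sg_down: "S \<in> K \<Longrightarrow> T \<subseteq> S \<Longrightarrow> distinct (i # L) \<Longrightarrow> set (i # L) = S - T \<Longrightarrow>
           sg (insert i T, S) (T, S) = - (eps (insert i T, S) L * eps (T, S) (i # L))"
begin

text \<open>Both enumerations describe the same \<open>nu\<close>, and their forms are opposite. The
  form is nonzero because it takes the value 1 on the dual coordinates, so the signs are opposite as
  well.\<close>

lemma eps_swap:
  assumes S: "S \<in> K" "T \<subseteq> S" and L: "distinct (i # j # L)" "set (i # j # L) = S - T"
  shows "eps (T, S) (j # i # L) = - eps (T, S) (i # j # L)"
proof -
  have "nu (T, S) = eps (T, S) (i # j # L) *\<^sub>R restr T (form (i # j # L))"
    "nu (T, S) = eps (T, S) (j # i # L) *\<^sub>R restr T (form (j # i # L))"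
    using S L by (intro nu_eps; auto)+
  moreover have "restr T (form (j # i # L)) = - restr T (form (i # j # L))"
    using form_swap[of "[]" j i L] linear_neg[OF linear_restr, of T "form (i # j # L)"] by simp
  ultimately have "eps (T, S) (i # j # L) *\<^sub>R restr T (form (i # j # L)) =
      eps (T, S) (j # i # L) *\<^sub>R (- restr T (form (i # j # L)))" by metis
  then have "(eps (T, S) (i # j # L) + eps (T, S) (j # i # L)) *\<^sub>R restr T (form (i # j # L)) = 0"
    by (simp add: scaleR_add_left)
  moreover have "restr T (form (i # j # L)) (map (coord (basis S)) (i # j # L)) = 1"
    using L S subset_basis[OF S(1)] by (intro form_coord independent_basis[OF S(1)]) auto
  then have "restr T (form (i # j # L)) \<noteq> 0" by auto
  ultimately show ?thesis by (simp add: add_eq_0_iff)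
qed

lemma enumerate_diff:
  assumes "S \<in> K" obtains L where "distinct L" "set L = S - A"
  using finite_distinct_list[of "S - A"] finite_K_simplex[OF assms] by auto

sublocale cubical_system K "V p" restr "\<lambda>S i. precomp (proj S i)"  sg
proof (rule cubical_system.intro)
  show "finite K" by (rule finite_K)
  show "finite S" if "S \<in> K" for S using that by (rule finite_K_simplex)
  show "T \<in> K" if "S \<in> K" "T \<subseteq> S" for S T using that by (rule subset_K)
  show "0 \<in> V p S" for S by (simp add: V_def zspan_zero)
  show "a - b \<in> V p S" if "a \<in> V p S" "b \<in> V p S" for a b S using that by (simp add: V_def zspan_diff)
  show "V p S' \<subseteq> V p S" if "S \<subseteq> S'" for S S' unfolding V_def using that by (intro zspan_mono) blast
  show "linear (restr T)" for T :: "'v set" by (rule linear_restr)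
  show "restr T (restr T' a) = restr (T \<union> T') a" for T T' :: "'v set" and a by (rule restr_restr)
  show "restr {} a = a" if "a \<in> V p S" for a S
    using alternating_support[OF alternating_V[OF that]] by (auto simp: restr_def fun_eq_iff)
  show "linear (precomp (proj S i))" if "S \<in> K" "i \<in> S" for S i by (rule linear_precomp)
  show "precomp (proj S i) a \<in> V p S" if "S \<in> K" "i \<in> S" "a \<in> V p S" for S i a
    using that by (rule precomp_V)
  \<comment> \<open>After composition with the projection a functional kills i automatically. The
    projection fixes the other elements of S, so the composite kills T exactly if the original
    functional does.\<close>
  show "precomp (proj S i) (restr (insert i T) a) = restr T (precomp (proj S i) a)"
    if S: "S \<in> K" "insert i T \<subseteq> S" "i \<notin> T" for S i T a
  proof -
    have "f \<circ> proj S i \<in> functionals (insert i T) \<longleftrightarrow> f \<in> functionals T" if "f \<in> functionals {}" for f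
    proof -
      have "linear f" using that by (simp add: functionals_def)
      moreover have "linear (f \<circ> proj S i)"
        using linear_compose[OF linear_proj[OF S(1)] \<open>linear f\<close>] .
      moreover have "f (proj S i i) = 0" using S proj_simplex[of S i i] linear_0[OF \<open>linear f\<close>] by auto
      moreover have "f (proj S i t) = f t" if "t \<in> T" for t
        using S proj_simplex[of S t i] that by auto
      ultimately show ?thesis by (auto simp: functionals_def)
    qed
    then have *: "set (map (\<lambda>f. f \<circ> proj S i) fs) \<subseteq> functionals (insert i T) \<longleftrightarrow> set fs \<subseteq> functionals T"
      if "set fs \<subseteq> functionals {}" for fs
      using that by auto
    have "functionals T \<subseteq> functionals {}" by (auto simp: functionals_def)
    then show ?thesis
      using * by (auto simp: precomp_def restr_def fun_eq_iff simp del: set_map)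
  qed
  show "restr {i} (precomp (proj S i) a) = restr {i} a" if "S \<in> K" "i \<in> S" for S i a
  proof
    fix fs
    show "restr {i} (precomp (proj S i) a) fs = restr {i} a fs"
    proof (cases "set fs \<subseteq> functionals {i}")
      case True
      have "f \<circ> proj S i = f" if "f \<in> set fs" for f
      proof -
        have "linear f" "f i = 0" using that True by (auto simp: functionals_def)
        then show ?thesis by (auto simp: proj_def linear_diff linear_scale)
      qed
      then have "map (\<lambda>f. f \<circ> proj S i) fs = fs" by (simp add: map_idI)
      moreover have "functionals {i} \<subseteq> functionals {}" by (auto simp: functionals_def)
      ultimately show ?thesis using True by (auto simp: precomp_def restr_def)
    qed (simp add: restr_def)
  qed
  show "sign_like (sg c d)" for c d by (rule sg_sign_like)
next
  fix S T i j
  assume S: "S \<in> K" "T \<subseteq> S - {i, j}" "i \<in> S" "j \<in> S" "i \<noteq> j"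
  \<comment> \<open>All four signs are expressed through enumerations built on one list L of the
    remaining generators. On each route the intermediate \<open>eps\<close> occurs twice and squares
    to 1; the routes then differ only by exchanging i and j at the head of the list.\<close>
  obtain L where L: "distinct L" "set L = S - (T \<union> {i, j})" using enumerate_diff[OF S(1)] by blast
  have K: "S - {i} \<in> K" "S - {j} \<in> K" using subset_K S(1) by blast+
  have D: "S - {i} - {j} = S - {i, j}" "S - {j} - {i} = S - {i, j}" by auto
  have "sg (T, S - {i}) (T, S) = eps (T, S - {i}) (j # L) * eps (T, S) (i # j # L)"
    "sg (T, S - {j}) (T, S) = eps (T, S - {j}) (i # L) * eps (T, S) (j # i # L)"
    using S L by (intro sg_up; auto)+
  moreover have "sg (T, S - {i, j}) (T, S - {i}) = eps (T, S - {i, j}) L * eps (T, S - {i}) (j # L)"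
    using sg_up[OF K(1), of T j L] S L unfolding D by auto
  moreover have "sg (T, S - {i, j}) (T, S - {j}) = eps (T, S - {i, j}) L * eps (T, S - {j}) (i # L)"
    using sg_up[OF K(2), of T i L] S L unfolding D by auto
  moreover have "eps (T, S) (j # i # L) = - eps (T, S) (i # j # L)"
    using S L by (intro eps_swap) auto
  ultimately show "sg (T, S - {i, j}) (T, S - {i}) * sg (T, S - {i}) (T, S) =
      - (sg (T, S - {i, j}) (T, S - {j}) * sg (T, S - {j}) (T, S))"
    using sign_like_square[OF eps_sign, of "(T, S - {i})" "j # L"]
      sign_like_square[OF eps_sign, of "(T, S - {j})" "i # L"]
    by (simp add: algebra_simps)
next
  fix S T i j
  assume S: "S \<in> K" "insert i (insert j T) \<subseteq> S" "i \<notin> T" "j \<notin> T" "i \<noteq> j"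
  obtain L where L: "distinct L" "set L = S - (T \<union> {i, j})" using enumerate_diff[OF S(1)] by blast
  have "sg (insert i T, S) (T, S) = - (eps (insert i T, S) (j # L) * eps (T, S) (i # j # L))"
    "sg (insert j T, S) (T, S) = - (eps (insert j T, S) (i # L) * eps (T, S) (j # i # L))"
    using S L by (intro sg_down; auto)+
  moreover have "sg (insert i (insert j T), S) (insert i T, S) =
      - (eps (insert i (insert j T), S) L * eps (insert i T, S) (j # L))"
    using sg_down[OF S(1), of "insert i T" j L] S L by (auto simp: insert_commute)
  moreover have "sg (insert i (insert j T), S) (insert j T, S) =
      - (eps (insert i (insert j T), S) L * eps (insert j T, S) (i # L))"
    using sg_down[OF S(1), of "insert j T" i L] S L by auto
  moreover have "eps (T, S) (j # i # L) = - eps (T, S) (i # j # L)"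
    using S L by (intro eps_swap) auto
  ultimately show "sg (insert i (insert j T), S) (insert i T, S) * sg (insert i T, S) (T, S) =
      - (sg (insert i (insert j T), S) (insert j T, S) * sg (insert j T, S) (T, S))"
    using sign_like_square[OF eps_sign, of "(insert i T, S)" "j # L"]
      sign_like_square[OF eps_sign, of "(insert j T, S)" "i # L"]
    by (simp add: algebra_simps)
next
  fix S T i j
  assume S: "S \<in> K" "insert i T \<subseteq> S - {j}" "j \<in> S" "i \<notin> T"
  \<comment> \<open>Each route contains exactly one sign given by \<open>sg_down\<close>, so its
    extra minus appears on both sides, and the relation again comes from the transposition
    alone.\<close>
  obtain L where L: "distinct L" "set L = S - (T \<union> {i, j})" using enumerate_diff[OF S(1)] by blast
  have K: "S - {j} \<in> K" using subset_K S(1) by blast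
  have "sg (T, S - {j}) (T, S) = eps (T, S - {j}) (i # L) * eps (T, S) (j # i # L)"
    using S L by (intro sg_up) auto
  moreover have "sg (insert i T, S - {j}) (T, S - {j}) = - (eps (insert i T, S - {j}) L * eps (T, S - {j}) (i # L))"
    using S L by (intro sg_down K) auto
  moreover have "sg (insert i T, S) (T, S) = - (eps (insert i T, S) (j # L) * eps (T, S) (i # j # L))"
    using S L by (intro sg_down) auto
  moreover have "sg (insert i T, S - {j}) (insert i T, S) = eps (insert i T, S - {j}) L * eps (insert i T, S) (j # L)"
    using S L by (intro sg_up) auto
  moreover have "eps (T, S) (j # i # L) = - eps (T, S) (i # j # L)"
    using S L by (intro eps_swap) auto
  ultimately show "sg (insert i T, S - {j}) (T, S - {j}) * sg (T, S - {j}) (T, S) =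
      - (sg (insert i T, S - {j}) (insert i T, S) * sg (insert i T, S) (T, S))"
    using sign_like_square[OF eps_sign, of "(insert i T, S)" "j # L"]
      sign_like_square[OF eps_sign, of "(T, S - {j})" "i # L"]
    by (simp add: algebra_simps)
qed

section \<open>Exactness for q > p and for q = 0 < p\<close>

lemma core_chains_large:
  assumes "d \<in> core_chains q" "q > int p" shows "d x = 0"
proof -
  obtain T S where x: "x = (T, S)" by (cases x)
  show ?thesis
  proof (cases "T = {} \<and> cell q T S")
    case True
    then have S: "S \<in> K" and "card S > p" using assms(2) by (auto simp: cell_def)
    have "d ({}, S) \<in> restr {} ` V p S"
      using assms(1) chains_image[OF _ S] by (auto simp: core_chains_def)
    then have "d ({}, S) \<in> V p S" using res_empty[OF S] by auto
    then show ?thesis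
      using core_large[OF S _ _ \<open>card S > p\<close>] assms(1) S True by (auto simp: core_chains_def x)
  next
    case False
    show ?thesis
    proof (cases "T = {}")
      case True
      then show ?thesis using False assms(1) chains_not_cell[of d q T S] by (auto simp: core_chains_def x)
    qed (use assms(1) in \<open>simp add: core_chains_def x\<close>)
  qed
qed

theorem exact_above:
  assumes c: "c \<in> chains q" "\<And>x. boundary c x = 0" and "q > int p"
  obtains b where "b \<in> chains (q + 1)" "boundary b = c"
proof -
  obtain b where b: "b \<in> chains (q + 1)" "(\<lambda>x. c x - boundary b x) \<in> core_chains q"
    using core_reduction[OF c(1)] c(2) by blast
  have "c x - boundary b x = 0" for x
    using core_chains_large[OF b(2) assms(3)] .
  then have "boundary b = c" by (auto simp: fun_eq_iff)
  with b(1) show ?thesis by (rule that)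
qed

text \<open>The chain sits on the cell of the ray e alone. Its face at the cone 0 carries the form,
  the sign being cancelled by the coefficient; its face at infinity is zero because e itself is
  killed there. The other vectors may lie anywhere in a cone E containing e, as membership in
  \<open>V p {e}\<close> allows.\<close>

lemma boundary_form_vertex:
  assumes E: "E \<in> K" "e \<in> E" and xs: "set xs \<subseteq> zspan E" "Suc (length xs) = p"
  defines "b \<equiv> \<lambda>x. if x = ({}, {e}) then sg ({}, {}) ({}, {e}) *\<^sub>R form (e # xs) else 0"
  shows "b \<in> chains 1" "boundary b (T, S) = (if T = {} \<and> S = {} then form (e # xs) else 0)"
proof -
  have K: "{e} \<in> K" using subset_K[OF E(1)] E(2) by blast
  have V: "form (e # xs) \<in> V p {e}"
    using E xs by (intro form_V[OF _ E(1)]) (auto intro: zspan_base)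
  have "restr {} (form (e # xs)) = form (e # xs)" by (rule res_empty[OF K V])
  then have "form (e # xs) \<in> restr {} ` V p {e}" using V by force
  then have im: "sg ({}, {}) ({}, {e}) *\<^sub>R form (e # xs) \<in> restr {} ` V p {e}"
    by (intro image_V_sign K sg_sign)
  show "b \<in> chains 1"
  proof (rule chainsI)
    fix T S assume "cell 1 T S"
    then show "b (T, S) \<in> restr T ` V p S"
      using im zero_image_V by (auto simp: b_def cell_def)
  next
    fix T S assume "\<not> cell 1 T S"
    then show "b (T, S) = 0" using K by (auto simp: b_def cell_def)
  qed
  have up: "(\<Sum>i\<in>link S. sg (T, S) (T, insert i S) *\<^sub>R b (T, insert i S)) = (if T = {} \<and> S = {} then form (e # xs) else 0)"
  proof (cases "T = {} \<and> S = {}")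
    case True
    have "e \<in> link {}" using K by (simp add: link_def)
    then have "(\<Sum>i\<in>link {}. sg ({}, {}) ({}, {i}) *\<^sub>R b ({}, {i})) = sg ({}, {}) ({}, {e}) *\<^sub>R b ({}, {e})"
      using finite_link by (subst sum.remove[of _ e]) (auto simp: b_def intro!: sum.neutral)
    then show ?thesis
      using True sign_like_square[OF sg_sign, of "({}, {})" "({}, {e})"] by (simp add: b_def)
  next
    case False
    then have "b (T, insert i S) = 0" if "i \<in> link S" for i
      using that by (auto simp: b_def link_def)
    then show ?thesis using False by auto
  qed
  have down: "restr T (b (T - {k}, S)) = 0" if "k \<in> T" "T \<subseteq> S" for k
  proof (cases "T - {k} = {} \<and> S = {e}")
    case True
    then have "T = {e}" "k = e" using that by auto
    moreover have "restr {e} (form (e # xs)) = 0"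
      by (rule restr_form_vanish[of e]) (auto intro: span_base)
    ultimately show ?thesis by (simp add: b_def linear_scale[OF linear_res] linear_0[OF linear_res])
  qed (auto simp: b_def linear_0[OF linear_res])
  show "boundary b (T, S) = (if T = {} \<and> S = {} then form (e # xs) else 0)"
    using up down empty_K by (auto simp: boundary_def)
qed

text \<open>For p > 0 a form has a first entry, and additivity in it reduces to the case where this
  entry is a generator of E; then the ray chain of \<open>boundary_form_vertex\<close>
  applies.\<close>

lemma vertex_boundaries:
  assumes p: "p > 0" and \<phi>: "\<phi> \<in> V p {}"
  shows "\<exists>b\<in>chains 1. \<forall>T S. boundary b (T, S) = (if T = {} \<and> S = {} then \<phi> else 0)"
proof -
  define Q where "Q = {\<phi>. \<exists>b\<in>chains 1. \<forall>T S. boundary b (T, S) = (if T = {} \<and> S = {} then \<phi> else 0)}"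
  have Q0: "0 \<in> Q"
    using chains_zero[of 1] boundary_diff[of "\<lambda>_. 0" "\<lambda>_. 0"] unfolding Q_def by force
  have Qd: "a - a' \<in> Q" if aQ: "a \<in> Q" "a' \<in> Q" for a a'
  proof -
    obtain b where b: "b \<in> chains 1" "\<forall>T S. boundary b (T, S) = (if T = {} \<and> S = {} then a else 0)"
      using aQ(1) unfolding Q_def by blast
    obtain b' where b': "b' \<in> chains 1" "\<forall>T S. boundary b' (T, S) = (if T = {} \<and> S = {} then a' else 0)"
      using aQ(2) unfolding Q_def by blast
    show ?thesis
      using chains_diff[OF b(1) b'(1)] b(2) b'(2)
      by (auto simp: Q_def boundary_diff intro!: bexI[of _ "\<lambda>x. b x - b' x"])
  qed
  have "V p {} \<subseteq> Q"
    unfolding V_def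
  proof (rule zspan_minimal)
    show "{form xs | xs. length xs = p \<and> (\<exists>E\<in>K. {} \<subseteq> E \<and> set xs \<subseteq> zspan E)} \<subseteq> Q"
    proof
      fix \<psi> assume "\<psi> \<in> {form xs | xs. length xs = p \<and> (\<exists>E\<in>K. {} \<subseteq> E \<and> set xs \<subseteq> zspan E)}"
      then obtain ys E where ys: "\<psi> = form ys" "length ys = p" "E \<in> K" "set ys \<subseteq> zspan E" by blast
      then obtain x xs where x: "ys = x # xs" using p by (cases ys) auto
      have "zspan E \<subseteq> {x. form (x # xs) \<in> Q}"
      proof (rule zspan_minimal)
        show "E \<subseteq> {x. form (x # xs) \<in> Q}"
        proof
          fix e assume e: "e \<in> E"
          have "set xs \<subseteq> zspan E" "Suc (length xs) = p" using ys x by auto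
          from boundary_form_vertex[OF ys(3) e this] show "e \<in> {x. form (x # xs) \<in> Q}"
            unfolding Q_def mem_Collect_eq by (intro bexI allI)
        qed
        show "0 \<in> {x. form (x # xs) \<in> Q}" using Q0 form_zero[of "[]" xs] by simp
        fix a b assume "a \<in> {x. form (x # xs) \<in> Q}" "b \<in> {x. form (x # xs) \<in> Q}"
        then have "form (a # xs) - form (b # xs) \<in> Q" using Qd by blast
        then show "a - b \<in> {x. form (x # xs) \<in> Q}" using form_diff[of "[]" a b xs] by simp
      qed
      then show "\<psi> \<in> Q" using ys x by auto
    qed
  qed (use Q0 Qd in auto)
  with \<phi> show ?thesis unfolding Q_def by blast
qed

text \<open>A chain of degree 0 is closed, since there are no cells of degree -1. Core reduction
  leaves only a value at ({}, {}), which bounds because p > 0.\<close>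

theorem exact_zero:
  assumes c: "c \<in> chains 0" and p: "p > 0"
  obtains b where "b \<in> chains 1" "boundary b = c"
proof -
  have "boundary c x = 0" for x
  proof -
    have "\<not> cell (-1) T S" for T S
      using finite_K_simplex card_mono[of S T] by (auto simp: cell_def)
    then show ?thesis using chains_not_cell[of "boundary c" "-1"] boundary_chains[OF c] by (cases x) auto
  qed
  then obtain b where b: "b \<in> chains (0 + 1)" "(\<lambda>x. c x - boundary b x) \<in> core_chains 0"
    using core_reduction[OF c] by blast
  let ?d = "\<lambda>x. c x - boundary b x"
  have d: "?d \<in> chains 0" using b(2) by (simp add: core_chains_def)
  have "?d ({}, {}) \<in> V p {}"
    using chains_image[OF d empty_K, of "{}"] res_empty[OF empty_K] by auto
  then obtain b' where b': "b' \<in> chains 1" "\<And>T S. boundary b' (T, S) = (if T = {} \<and> S = {} then ?d ({}, {}) else 0)"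
    using vertex_boundaries[OF p] by metis
  have "?d (T, S) = boundary b' (T, S)" for T S
  proof (cases "T = {} \<and> S = {}")
    case False
    have "?d (T, S) = 0"
    proof (cases "T = {}")
      case True
      then have "\<not> cell 0 T S" using False finite_K_simplex by (auto simp: cell_def)
      then show ?thesis by (rule chains_not_cell[OF d])
    qed (use b(2) in \<open>simp add: core_chains_def\<close>)
    then show ?thesis using False b'(2) by auto
  qed (auto simp: b'(2))
  then have "c x = boundary b x + boundary b' x" for x
    by (cases x) (simp add: algebra_simps)
  then have "boundary (\<lambda>x. b x + b' x) = c" by (auto simp: boundary_add fun_eq_iff)
  moreover have "(\<lambda>x. b x + b' x) \<in> chains 1" using chains_add[of b 1 b'] b b' by simp
  ultimately show ?thesis using that by blast
qed

section \<open>Weight chains and the diagonal q = p\<close>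

definition weight_chain :: "('v set \<Rightarrow> int) \<Rightarrow> 'v set \<times> 'v set \<Rightarrow> ('v \<Rightarrow> real) list \<Rightarrow> real" where
  "weight_chain w = (\<lambda>(T, S). if T = {} \<and> S \<in> K \<and> card S = p then real_of_int (w S) *\<^sub>R nu ({}, S) else 0)"

lemma nu_empty:
  assumes "S \<in> K" "distinct L" "set L = S"
  shows "nu ({}, S) = eps ({}, S) L *\<^sub>R form L" "form L \<in> V (card S) S" "nu ({}, S) \<noteq> 0"
proof -
  show V: "form L \<in> V (card S) S"
    using assms distinct_card[OF assms(2)] by (intro form_V[OF _ assms(1)]) (auto intro: zspan_base)
  have "restr {} (form L) = form L"
    using alternating_support[OF alternating_V[OF V]] by (auto simp: restr_def fun_eq_iff)
  then show eq: "nu ({}, S) = eps ({}, S) L *\<^sub>R form L"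
    using nu_eps[OF assms(1), of "{}" L] assms by simp
  have "restr {} (form L) (map (coord (basis S)) L) = 1"
    using assms subset_basis by (intro form_coord independent_basis) auto
  then have "form L \<noteq> 0" using \<open>restr {} (form L) = form L\<close> by auto
  then show "nu ({}, S) \<noteq> 0"
    using eps_sign[of "({}, S)" L] eq by (auto simp: sign_like_def)
qed

lemma weight_chain_chains: "weight_chain w \<in> chains (int p)"
proof (rule chainsI)
  fix T S assume TS: "cell (int p) T S"
  then have S: "S \<in> K" by (simp add: cell_def)
  show "weight_chain w (T, S) \<in> restr T ` V p S"
  proof (cases "T = {}")
    case True
    then have "card S = p" using TS by (simp add: cell_def)
    obtain L where L: "distinct L" "set L = S" using enumerate_diff[OF S, of "{}"] by auto
    obtain s where s: "eps ({}, S) L = real_of_int s"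
      using eps_sign[of "({}, S)" L] by (metis of_int_1 of_int_minus sign_like_def)
    have "real_of_int (w S * s) *\<^sub>R form L \<in> V p S"
      using nu_empty[OF S L] \<open>card S = p\<close> unfolding V_def by (intro zspan_scale) auto
    then have "weight_chain w (T, S) \<in> V p S"
      using nu_empty(1)[OF S L] S True \<open>card S = p\<close> by (simp add: weight_chain_def s)
    then show ?thesis using True res_empty[OF S] by force
  qed (simp add: weight_chain_def zero_image_V[OF S])
qed (auto simp: weight_chain_def cell_def)

text \<open>A face towards infinity restricts the form of S to functionals that kill one of its own
  vectors. A facet of a p-dimensional cone has p - 1 generators, so no other cell with T = {}
  receives a contribution.\<close>

lemma boundary_weight_chain:
  assumes "T \<noteq> {} \<or> card S + 1 \<noteq> p"
  shows "boundary (weight_chain w) (T, S) = 0"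
proof -
  have up: "weight_chain w (T, insert i S) = 0" if "i \<in> link S" "S \<in> K" for i
    using that assms finite_K_simplex[of S] by (auto simp: weight_chain_def link_def)
  have down: "restr T (weight_chain w (T - {k}, S)) = 0" if "k \<in> T" "T \<subseteq> S" for k
  proof (cases "T - {k} = {} \<and> S \<in> K \<and> card S = p")
    case True
    then have T: "T = {k}" and S: "S \<in> K" and "k \<in> S" using that by auto
    obtain L where L: "distinct L" "set L = S" using enumerate_diff[OF S, of "{}"] by auto
    have "restr {k} (form L) = 0"
      using L \<open>k \<in> S\<close> by (intro restr_form_vanish[of k]) (auto intro: span_base)
    then show ?thesis
      using True nu_empty(1)[OF S L] by (simp add: T weight_chain_def linear_scale[OF linear_res] linear_0[OF linear_res])
  qed (auto simp: weight_chain_def linear_0[OF linear_res])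
  show ?thesis using up down by (simp add: boundary_def)
qed

text \<open>For every i, the vector i is prepended to the same enumeration L of T. The sign of
  \<open>nu\<close> on the larger cone cancels against the same factor in \<open>sg\<close>, leaving
  a common sign, and the sum moves into the first entry of the form.\<close>

lemma boundary_weight_chain_facet:
  assumes T: "T \<in> K" "card T + 1 = p" and L: "distinct L" "set L = T"
  shows "boundary (weight_chain w) ({}, T) = eps ({}, T) L *\<^sub>R form ((\<Sum>i\<in>link T. real_of_int (w (insert i T)) *\<^sub>R i) # L)"
proof -
  have "sg ({}, T) ({}, insert i T) *\<^sub>R weight_chain w ({}, insert i T) =
      eps ({}, T) L *\<^sub>R real_of_int (w (insert i T)) *\<^sub>R form (i # L)" if i: "i \<in> link T" for i
  proof -
    have K: "insert i T \<in> K" and ni: "i \<notin> T" using i by (auto simp: link_def)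
    have "sg ({}, insert i T - {i}) ({}, insert i T) = eps ({}, insert i T - {i}) L * eps ({}, insert i T) (i # L)"
      using K ni L by (intro sg_up) auto
    then have "sg ({}, T) ({}, insert i T) = eps ({}, T) L * eps ({}, insert i T) (i # L)"
      using ni by simp
    moreover have "weight_chain w ({}, insert i T) = real_of_int (w (insert i T)) *\<^sub>R eps ({}, insert i T) (i # L) *\<^sub>R form (i # L)"
      using nu_empty(1)[OF K, of "i # L"] K ni L T finite_K_simplex[OF T(1)] by (simp add: weight_chain_def)
    ultimately show ?thesis
      using sign_like_square[OF eps_sign, of "({}, insert i T)" "i # L"] by (simp add: algebra_simps)
  qed
  then show ?thesis
    using T form_sum[of "[]" "\<lambda>i. real_of_int (w (insert i T))" "\<lambda>i. i" "link T" L]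
    by (simp add: boundary_def scaleR_sum_right)
qed

text \<open>The vector i represents \<open>e^tau_sigma\<close> for the cone over
  \<open>insert i T\<close>, so this is the balancing condition over the reals. Saturation of the
  sublattice makes it equivalent to the integral condition.\<close>

definition balanced :: "('v set \<Rightarrow> int) \<Rightarrow> bool" where
  "balanced w \<longleftrightarrow> (\<forall>T\<in>K. card T + 1 = p \<longrightarrow> (\<Sum>i\<in>link T. real_of_int (w (insert i T)) *\<^sub>R i) \<in> span T)"

theorem weight_chain_cycle_iff:
  "(\<forall>x. boundary (weight_chain w) x = 0) \<longleftrightarrow> balanced w"
proof -
  have "boundary (weight_chain w) ({}, T) = 0 \<longleftrightarrow> (\<Sum>i\<in>link T. real_of_int (w (insert i T)) *\<^sub>R i) \<in> span T"
    if T: "T \<in> K" "card T + 1 = p" for T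
  proof -
    obtain L where L: "distinct L" "set L = T" using enumerate_diff[OF T(1), of "{}"] by auto
    have "i \<in> N" if "i \<in> link T" for i
      using that zspan_K[of "insert i T"] zspan_base[of i "insert i T"] by (auto simp: link_def)
    then have "(\<Sum>i\<in>link T. real_of_int (w (insert i T)) *\<^sub>R i) \<in> zspan (basis T)"
      using zspan_basis[OF T(1)] by (intro zspan_sum zspan_scale) auto
    moreover have "eps ({}, T) L \<noteq> 0"
      using eps_sign[of "({}, T)" L] unfolding sign_like_def by auto
    ultimately show ?thesis
      using form_Cons_zero_iff[OF T(1) L] zspan_basis[OF T(1)] by (simp add: boundary_weight_chain_facet[OF T L])
  qed
  moreover have "(\<forall>x. boundary (weight_chain w) x = 0) \<longleftrightarrow>
      (\<forall>T\<in>K. card T + 1 = p \<longrightarrow> boundary (weight_chain w) ({}, T) = 0)" (is "?l \<longleftrightarrow> ?r")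
  proof
    assume r: ?r
    show ?l
    proof
      fix x :: "'v set \<times> 'v set"
      obtain T S where x: "x = (T, S)" by (cases x)
      show "boundary (weight_chain w) x = 0"
      proof (cases "T = {} \<and> card S + 1 = p")
        case True
        show ?thesis
        proof (cases "S \<in> K")
          case False
          then show ?thesis by (simp add: x boundary_def)
        qed (use r True x in auto)
      qed (use boundary_weight_chain x in auto)
    qed
  qed auto
  ultimately show ?thesis unfolding balanced_def by blast
qed

text \<open>Core reduction leaves values on p-dimensional cones that are killed by the projection to
  every ray of the cone; \<open>core_top\<close> makes each an integer multiple of the
  generator.\<close>

theorem cycle_eq_weight_chain:
  assumes c: "c \<in> chains (int p)" "\<And>x. boundary c x = 0"
  obtains w b where "b \<in> chains (int p + 1)" "\<And>x. c x = weight_chain w x + boundary b x"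
proof -
  obtain b where b: "b \<in> chains (int p + 1)" "(\<lambda>x. c x - boundary b x) \<in> core_chains (int p)"
    using core_reduction[OF c(1)] c(2) by blast
  let ?d = "\<lambda>x. c x - boundary b x"
  have d: "?d \<in> chains (int p)" using b(2) by (simp add: core_chains_def)
  have "\<exists>m. ?d ({}, S) = real_of_int m *\<^sub>R nu ({}, S)" if S: "S \<in> K" "card S = p" for S
  proof -
    obtain L where L: "distinct L" "set L = S" using enumerate_diff[OF S(1), of "{}"] by auto
    have "?d ({}, S) \<in> V p S"
      using chains_image[OF d S(1), of "{}"] res_empty[OF S(1)] by auto
    moreover have "restr {i} (?d ({}, S)) = 0" if "i \<in> S" for i
      using b(2) S that by (simp add: core_chains_def)
    moreover have "length L = p" using S L distinct_card[OF L(1)] by simp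
    ultimately obtain m where m: "?d ({}, S) = real_of_int m *\<^sub>R form L"
      using core_top[OF S(1) _ _ L] by blast
    obtain s where s: "eps ({}, S) L = real_of_int s"
      using eps_sign[of "({}, S)" L] by (metis of_int_1 of_int_minus sign_like_def)
    \<comment> \<open>The sign s relates \<open>form L\<close> to \<open>nu\<close> and squares to
      1, so the weight of S is the product of m and s.\<close>
    have "real_of_int (m * s) *\<^sub>R nu ({}, S) = real_of_int m *\<^sub>R form L"
      using nu_empty(1)[OF S(1) L] sign_like_square[OF eps_sign, of "({}, S)" L] by (simp add: s)
    then show ?thesis using m by metis
  qed
  then obtain w where w: "\<And>S. S \<in> K \<Longrightarrow> card S = p \<Longrightarrow> ?d ({}, S) = real_of_int (w S) *\<^sub>R nu ({}, S)"
    by metis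
  have "?d (T, S) = weight_chain w (T, S)" for T S
  proof (cases "T = {} \<and> S \<in> K \<and> card S = p")
    case False
    have "?d (T, S) = 0"
    proof (cases "T = {}")
      case True
      then have "\<not> cell (int p) T S" using False by (auto simp: cell_def)
      then show ?thesis by (rule chains_not_cell[OF d])
    qed (use b(2) in \<open>simp add: core_chains_def\<close>)
    then show ?thesis using False by (auto simp: weight_chain_def)
  qed (use w in \<open>simp add: weight_chain_def\<close>)
  then have "c x = weight_chain w x + boundary b x" for x
    by (cases x) (simp add: algebra_simps)
  then show ?thesis using that[OF b(1)] by blast
qed

text \<open>A weight chain vanishes for T nonempty, so core reduction applies to b without b being
  closed. In degree p + 1 the core is zero; hence b is itself a boundary and its own boundary is 0.
  As \<open>nu\<close> is nonzero, so is every nonzero multiple of it, and the weight must be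
  0.\<close>

theorem weight_chain_boundary:
  assumes b: "b \<in> chains (int p + 1)" "boundary b = weight_chain w" and S: "S \<in> K" "card S = p"
  shows "w S = 0"
proof -
  have "boundary b (T, S) = 0" if "T \<noteq> {}" for T S
    using that by (simp add: b(2) weight_chain_def)
  then obtain b' where b': "(\<lambda>x. b x - boundary b' x) \<in> core_chains (int p + 1)"
    using core_reduction[OF b(1)] by blast
  then have "b x = boundary b' x" for x
    using core_chains_large[OF b'] by simp
  then have "b = boundary b'" by blast
  then have "weight_chain w ({}, S) = 0"
    using b(2) boundary_boundary[of b' "{}" S] by simp
  moreover obtain L where L: "distinct L" "set L = S" using enumerate_diff[OF S(1), of "{}"] by auto
  ultimately show ?thesis
    using nu_empty(3)[OF S(1) L] S by (simp add: weight_chain_def)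
qed

end

section \<open>Exterior powers of abelian groups\<close>

text \<open>Translates a subgroup generated in the multiplicatively written group into an additive
  integer span, the form in which the relations are handled afterwards.\<close>

lemma generate_free_Abelian_group:
  assumes "X \<subseteq> carrier (free_Abelian_group A)"
  shows "generate (free_Abelian_group A) X = zspan X"
proof
  interpret comm_group "free_Abelian_group A" by (rule abelian_free_Abelian_group)
  have "x \<in> zspan X" if "x \<in> generate (free_Abelian_group A) X" for x
    using that
  proof induction
    case (inv h)
    then have "h \<in> carrier (free_Abelian_group A)" using assms by blast
    then have "inv\<^bsub>free_Abelian_group A\<^esub> h = - h" by (intro inv_free_Abelian_group) simp
    then show ?case using inv by (simp add: zspan_minus zspan_base)
  qed (auto intro: zspan_zero zspan_base zspan_add)
  then show "generate (free_Abelian_group A) X \<subseteq> zspan X" by blast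
  show "zspan X \<subseteq> generate (free_Abelian_group A) X"
  proof (rule zspan_minimal)
    show "X \<subseteq> generate (free_Abelian_group A) X" by (auto intro: generate.incl)
    show "0 \<in> generate (free_Abelian_group A) X" using generate.one[of "free_Abelian_group A" X] by simp
    fix a b assume ab: "a \<in> generate (free_Abelian_group A) X" "b \<in> generate (free_Abelian_group A) X"
    have "b \<in> carrier (free_Abelian_group A)" using generate_in_carrier[OF assms ab(2)] .
    then have "inv\<^bsub>free_Abelian_group A\<^esub> b = - b" by (intro inv_free_Abelian_group) auto
    then show "a - b \<in> generate (free_Abelian_group A) X"
      using generate.eng[OF ab(1) generate_m_inv_closed[OF assms ab(2)]] by simp
  qed
qed

lemma tuples_append [simp]:
  "xs @ [x] @ ys \<in> tuples p G \<longleftrightarrow> set xs \<subseteq> carrier G \<and> x \<in> carrier G \<and> set ys \<subseteq> carrier G \<and> p = Suc (length xs + length ys)"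
  by (auto simp: tuples_def)

lemma ext_relations_carrier:
  assumes "monoid G" shows "ext_relations p G \<subseteq> carrier (free_Abelian_group (tuples p G))"
proof -
  have "Poly_Mapping.keys (frag_of (xs @ [x \<otimes>\<^bsub>G\<^esub> y] @ ys) - frag_of (xs @ [x] @ ys) - frag_of (xs @ [y] @ ys)) \<subseteq> tuples p G"
    if "xs @ [x] @ ys \<in> tuples p G" "xs @ [y] @ ys \<in> tuples p G" for xs x y ys
  proof -
    have "xs @ [x \<otimes>\<^bsub>G\<^esub> y] @ ys \<in> tuples p G"
      using that monoid.m_closed[OF assms] unfolding tuples_append by blast
    with that show ?thesis
      by (intro order.trans[OF Poly_Mapping.keys_diff] Un_least) (simp_all add: keys_frag_of)
  qed
  then show ?thesis by (auto simp: ext_relations_def keys_frag_of)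
qed

lemma ext_kernel_zspan: "monoid G \<Longrightarrow> ext_kernel p G = zspan (ext_relations p G)"
  unfolding ext_kernel_def by (intro generate_free_Abelian_group ext_relations_carrier)

lemma ext_class_eq: "ext_class p G c = {k + c | k. k \<in> ext_kernel p G}"
  by (auto simp: ext_class_def r_coset_def)

lemma ext_class_self: "monoid G \<Longrightarrow> c \<in> ext_class p G c"
  by (auto simp: ext_class_eq ext_kernel_zspan zspan_zero intro!: exI[of _ 0])

lemma ext_class_eqI:
  assumes "monoid G" "c - d \<in> ext_kernel p G" shows "ext_class p G c = ext_class p G d"
proof -
  have "ext_class p G c \<subseteq> ext_class p G d" if "c - d \<in> ext_kernel p G" for c d
  proof
    fix x assume "x \<in> ext_class p G c"
    then obtain k where k: "x = k + c" "k \<in> ext_kernel p G" by (auto simp: ext_class_eq)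
    then have "x = (k + (c - d)) + d" "k + (c - d) \<in> ext_kernel p G"
      using that by (auto simp: ext_kernel_zspan[OF assms(1)] intro: zspan_add)
    then show "x \<in> ext_class p G d" unfolding ext_class_eq by blast
  qed
  moreover have "d - c \<in> ext_kernel p G"
    using assms zspan_minus[of "c - d"] by (simp add: ext_kernel_zspan)
  ultimately show ?thesis using assms(2) by blast
qed

lemma carrier_ext_power:
  "carrier (ext_power p G) = ext_class p G ` {c. Poly_Mapping.keys c \<subseteq> tuples p G}"
  by (auto simp: ext_power_def FactGroup_def RCOSETS_def ext_class_def)

lemma subgroup_ext_kernel:
  assumes "monoid G" shows "subgroup (ext_kernel p G) (free_Abelian_group (tuples p G))"
proof -
  interpret comm_group "free_Abelian_group (tuples p G)" by (rule abelian_free_Abelian_group)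
  show ?thesis unfolding ext_kernel_def by (rule generate_is_subgroup[OF ext_relations_carrier[OF assms]])
qed

lemma mult_ext_power:
  assumes "monoid G" shows "ext_class p G c \<otimes>\<^bsub>ext_power p G\<^esub> ext_class p G d = ext_class p G (c + d)"
proof -
  have *: "\<exists>h\<in>ext_class p G c. \<exists>k\<in>ext_class p G d. x = h + k" if x: "x \<in> ext_class p G (c + d)" for x
  proof -
    obtain k where k: "x = k + (c + d)" "k \<in> ext_kernel p G" using x by (auto simp: ext_class_eq)
    then have "k + c \<in> ext_class p G c" "x = (k + c) + d" by (auto simp: ext_class_eq add.assoc)
    then show ?thesis using ext_class_self[OF assms, of d p] by blast
  qed
  have "ext_class p G c <#>\<^bsub>free_Abelian_group (tuples p G)\<^esub> ext_class p G d = ext_class p G (c + d)"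
  proof
    show "ext_class p G c <#>\<^bsub>free_Abelian_group (tuples p G)\<^esub> ext_class p G d \<subseteq> ext_class p G (c + d)"
    proof
      fix x assume "x \<in> ext_class p G c <#>\<^bsub>free_Abelian_group (tuples p G)\<^esub> ext_class p G d"
      then obtain k l where "x = (k + c) + (l + d)" "k \<in> ext_kernel p G" "l \<in> ext_kernel p G"
        by (auto simp: set_mult_def ext_class_eq)
      then have "x = (k + l) + (c + d)" "k + l \<in> ext_kernel p G"
        using zspan_add by (auto simp: ext_kernel_zspan[OF assms] add.assoc add.left_commute)
      then show "x \<in> ext_class p G (c + d)" unfolding ext_class_eq by blast
    qed
  qed (use * in \<open>auto simp: set_mult_def\<close>)
  then show ?thesis by (simp add: ext_power_def FactGroup_def)
qed

lemma one_ext_power: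
  assumes "monoid G" shows "\<one>\<^bsub>ext_power p G\<^esub> = ext_class p G 0"
  by (simp add: ext_power_def FactGroup_def ext_class_eq)

lemma comm_group_ext_power:
  assumes "monoid G" shows "comm_group (ext_power p G)"
proof -
  interpret comm_group "free_Abelian_group (tuples p G)" by (rule abelian_free_Abelian_group)
  show ?thesis unfolding ext_power_def
    by (rule abelian_FactGroup[OF subgroup_ext_kernel[OF assms]])
qed

lemma inv_ext_power:
  assumes "monoid G" "Poly_Mapping.keys c \<subseteq> tuples p G"
  shows "inv\<^bsub>ext_power p G\<^esub> ext_class p G c = ext_class p G (- c)"
proof -
  interpret comm_group "ext_power p G" by (rule comm_group_ext_power[OF assms(1)])
  show ?thesis
    by (rule inv_equality)
       (use assms in \<open>auto simp: mult_ext_power one_ext_power carrier_ext_power\<close>)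
qed

lemma image_constant_eq: "(\<And>x. x \<in> A \<Longrightarrow> f x = b) \<Longrightarrow> A \<noteq> {} \<Longrightarrow> f ` A = {b}"
  by blast

text \<open>The common pattern behind \<open>ext_map\<close> and \<open>wedge_left\<close>.\<close>

lemma the_elem_ext_class:
  assumes "monoid G" "monoid H"
    and rel: "\<And>r. r \<in> ext_relations p G \<Longrightarrow> frag_extend h r \<in> ext_kernel p' H"
  shows "the_elem ((\<lambda>c. ext_class p' H (frag_extend h c)) ` ext_class p G c) = ext_class p' H (frag_extend h c)"
proof -
  have "ext_kernel p G \<subseteq> {k. frag_extend h k \<in> ext_kernel p' H}"
    unfolding ext_kernel_zspan[OF assms(1)]
  proof (rule zspan_minimal)
    show "ext_relations p G \<subseteq> {k. frag_extend h k \<in> ext_kernel p' H}"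
      using rel by blast
  qed (simp_all add: ext_kernel_zspan[OF assms(2)] frag_extend_diff zspan_zero zspan_diff)
  then have "ext_class p' H (frag_extend h x) = ext_class p' H (frag_extend h c)" if x: "x \<in> ext_class p G c" for x
  proof -
    obtain k where "x = k + c" "frag_extend h k \<in> ext_kernel p' H"
      using x \<open>ext_kernel p G \<subseteq> _\<close> unfolding ext_class_eq by blast
    then show ?thesis by (intro ext_class_eqI[OF assms(2)]) (simp add: frag_extend_add)
  qed
  moreover have "ext_class p G c \<noteq> {}" using ext_class_self[OF assms(1), of c p] by blast
  ultimately have "(\<lambda>c. ext_class p' H (frag_extend h c)) ` ext_class p G c = {ext_class p' H (frag_extend h c)}"
    by (rule image_constant_eq)
  then show ?thesis by simp
qed

lemma ext_relations_cases:
  assumes "r \<in> ext_relations p G"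
  obtains (add) xs x y ys where "set xs \<subseteq> carrier G" "x \<in> carrier G" "y \<in> carrier G" "set ys \<subseteq> carrier G"
      "p = Suc (length xs + length ys)"
      "r = frag_of (xs @ [x \<otimes>\<^bsub>G\<^esub> y] @ ys) - frag_of (xs @ [x] @ ys) - frag_of (xs @ [y] @ ys)"
  | (repeated) xs where "set xs \<subseteq> carrier G" "length xs = p" "\<not> distinct xs" "r = frag_of xs"
  using assms unfolding ext_relations_def by (auto simp: tuples_def)

lemma ext_relations_add:
  assumes "set xs \<subseteq> carrier G" "x \<in> carrier G" "y \<in> carrier G" "set ys \<subseteq> carrier G" "p = Suc (length xs + length ys)"
  shows "frag_of (xs @ [x \<otimes>\<^bsub>G\<^esub> y] @ ys) - frag_of (xs @ [x] @ ys) - frag_of (xs @ [y] @ ys) \<in> ext_relations p G"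
  using assms unfolding ext_relations_def tuples_append by blast

lemma ext_relations_repeated:
  "set xs \<subseteq> carrier G \<Longrightarrow> length xs = p \<Longrightarrow> \<not> distinct xs \<Longrightarrow> frag_of xs \<in> ext_relations p G"
  unfolding ext_relations_def tuples_def by blast

lemma ext_map_class:
  assumes "monoid G" "monoid H"
    and "\<And>x. x \<in> carrier G \<Longrightarrow> f x \<in> carrier H"
    and "\<And>x y. x \<in> carrier G \<Longrightarrow> y \<in> carrier G \<Longrightarrow> f (x \<otimes>\<^bsub>G\<^esub> y) = f x \<otimes>\<^bsub>H\<^esub> f y"
  shows "ext_map p H f (ext_class p G c) = ext_class p H (frag_extend (\<lambda>xs. frag_of (map f xs)) c)"
  unfolding ext_map_def
proof (rule the_elem_ext_class[OF assms(1,2)])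
  fix r assume "r \<in> ext_relations p G"
  then have "frag_extend (\<lambda>xs. frag_of (map f xs)) r \<in> ext_relations p H"
  proof (cases rule: ext_relations_cases)
    case (add xs x y ys)
    have "frag_of (map f xs @ [f x \<otimes>\<^bsub>H\<^esub> f y] @ map f ys) - frag_of (map f xs @ [f x] @ map f ys) - frag_of (map f xs @ [f y] @ map f ys)
        \<in> ext_relations p H"
      using add assms(3) by (intro ext_relations_add) auto
    then show ?thesis using add assms(4) by (simp add: frag_extend_diff)
  next
    case (repeated xs)
    then have "set (map f xs) \<subseteq> carrier H" using assms(3) by (auto simp: subset_eq)
    then have "frag_of (map f xs) \<in> ext_relations p H"
      using repeated by (intro ext_relations_repeated) (auto simp: distinct_map)
    then show ?thesis using repeated by simp
  qed
  then show "frag_extend (\<lambda>xs. frag_of (map f xs)) r \<in> ext_kernel p H"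
    unfolding ext_kernel_zspan[OF assms(2)] by (rule zspan_base)
qed

lemma wedge_left_class:
  assumes "monoid G" "n \<in> carrier G"
  shows "wedge_left p G n (ext_class p G c) = ext_class (Suc p) G (frag_extend (\<lambda>xs. frag_of (n # xs)) c)"
  unfolding wedge_left_def
proof (rule the_elem_ext_class[OF assms(1,1)])
  fix r assume "r \<in> ext_relations p G"
  then have "frag_extend (\<lambda>xs. frag_of (n # xs)) r \<in> ext_relations (Suc p) G"
  proof (cases rule: ext_relations_cases)
    case (add xs x y ys)
    have "frag_of ((n # xs) @ [x \<otimes>\<^bsub>G\<^esub> y] @ ys) - frag_of ((n # xs) @ [x] @ ys) - frag_of ((n # xs) @ [y] @ ys)
        \<in> ext_relations (Suc p) G"
      using add assms(2) by (intro ext_relations_add) auto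
    then show ?thesis using add by (simp add: frag_extend_diff)
  next
    case (repeated xs)
    then show ?thesis using assms(2) by (auto intro!: ext_relations_repeated)
  qed
  then show "frag_extend (\<lambda>xs. frag_of (n # xs)) r \<in> ext_kernel (Suc p) G"
    unfolding ext_kernel_zspan[OF assms(1)] by (rule zspan_base)
qed

text \<open>The inclusion fixes representatives, so its image consists of the classes of
  combinations of tuples from K. They are classes modulo the relations of the whole group G.\<close>

lemma ext_sub_eq:
  assumes "monoid G" "monoid (G\<lparr>carrier := K\<rparr>)" "K \<subseteq> carrier G"
  shows "ext_sub p G K = ext_class p G ` {c. Poly_Mapping.keys c \<subseteq> {xs. length xs = p \<and> set xs \<subseteq> K}}"
proof -
  have "ext_map p G (\<lambda>x. x) (ext_class p (G\<lparr>carrier := K\<rparr>) c) = ext_class p G c" for c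
    using assms by (subst ext_map_class) (auto simp: frag_expansion[symmetric])
  then show ?thesis
    unfolding ext_sub_def carrier_ext_power image_image by (simp add: tuples_def)
qed

section \<open>Evaluation of exterior powers in real vector spaces\<close>

definition frag_lift :: "('a \<Rightarrow> 'b::real_vector) \<Rightarrow> ('a \<Rightarrow>\<^sub>0 int) \<Rightarrow> 'b" where
  "frag_lift g c = (\<Sum>x\<in>Poly_Mapping.keys c. real_of_int (Poly_Mapping.lookup c x) *\<^sub>R g x)"

lemma frag_lift_superset:
  "finite A \<Longrightarrow> Poly_Mapping.keys c \<subseteq> A \<Longrightarrow> frag_lift g c = (\<Sum>x\<in>A. real_of_int (Poly_Mapping.lookup c x) *\<^sub>R g x)"
  unfolding frag_lift_def by (rule sum.mono_neutral_left) (auto simp: in_keys_iff)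

lemma frag_lift_add: "frag_lift g (c + d) = frag_lift g c + frag_lift g d"
  using frag_lift_superset[of "Poly_Mapping.keys c \<union> Poly_Mapping.keys d" c g] frag_lift_superset[of "Poly_Mapping.keys c \<union> Poly_Mapping.keys d" d g]
    frag_lift_superset[of "Poly_Mapping.keys c \<union> Poly_Mapping.keys d" "c + d" g] Poly_Mapping.keys_add[of c d]
  by (simp add: lookup_add scaleR_add_left sum.distrib)

lemma frag_lift_zero [simp]: "frag_lift g 0 = 0"
  by (simp add: frag_lift_def)

lemma frag_lift_of [simp]: "frag_lift g (frag_of x) = g x"
  by (simp add: frag_lift_def keys_frag_of)

lemma frag_lift_minus: "frag_lift g (- c) = - frag_lift g c"
  using frag_lift_add[of g c "- c"] by (simp add: eq_neg_iff_add_eq_0 add.commute)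

lemma frag_lift_diff: "frag_lift g (c - d) = frag_lift g c - frag_lift g d"
  using frag_lift_add[of g c "- d"] by (simp add: frag_lift_minus)

lemma frag_lift_extend:
  assumes "Poly_Mapping.keys c \<subseteq> A"
  shows "frag_lift g (frag_extend h c) = frag_lift (\<lambda>x. frag_lift g (h x)) c"
  using assms by (induction rule: frag_induction) (auto simp: frag_extend_diff frag_lift_diff)

lemma frag_lift_cong:
  "(\<And>x. x \<in> Poly_Mapping.keys c \<Longrightarrow> g x = h x) \<Longrightarrow> frag_lift g c = frag_lift h c"
  by (simp add: frag_lift_def)

lemma linear_frag_lift: "linear f \<Longrightarrow> f (frag_lift g c) = frag_lift (\<lambda>x. f (g x)) c"
  by (simp add: frag_lift_def linear_sum linear_scale)

lemma frag_zspan: "{c. Poly_Mapping.keys c \<subseteq> A} = zspan (frag_of ` A)"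
proof
  show "{c. Poly_Mapping.keys c \<subseteq> A} \<subseteq> zspan (frag_of ` A)"
  proof
    fix c :: "'a \<Rightarrow>\<^sub>0 int"
    assume "c \<in> {c. Poly_Mapping.keys c \<subseteq> A}"
    then have "Poly_Mapping.keys c \<subseteq> A" by simp
    then show "c \<in> zspan (frag_of ` A)"
      by (induction rule: frag_induction) (auto intro: zspan_zero zspan_base zspan_diff)
  qed
  show "zspan (frag_of ` A) \<subseteq> {c. Poly_Mapping.keys c \<subseteq> A}"
  proof (rule zspan_minimal)
    show "frag_of ` A \<subseteq> {c. Poly_Mapping.keys c \<subseteq> A}" by (auto simp: keys_frag_of)
  qed (auto dest: subsetD[OF Poly_Mapping.keys_diff])
qed

lemma frag_lift_image: "frag_lift g ` {c. Poly_Mapping.keys c \<subseteq> A} = zspan (g ` A)"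
  unfolding frag_zspan by (subst zspan_image) (auto simp: frag_lift_add image_image)

text \<open>Evaluates an arbitrary representative; the choice has no influence as soon as the lift
  of g annihilates the defining relations.\<close>

definition ext_eval :: "('a list \<Rightarrow> 'b::real_vector) \<Rightarrow> 'a ext \<Rightarrow> 'b" where
  "ext_eval g X = frag_lift g (SOME c. c \<in> X)"

lemma ext_eval_class:
  assumes "monoid G" "\<And>r. r \<in> ext_relations p G \<Longrightarrow> frag_lift g r = 0"
  shows "ext_eval g (ext_class p G c) = frag_lift g c"
proof -
  have ker: "ext_kernel p G \<subseteq> {k. frag_lift g k = 0}"
    unfolding ext_kernel_zspan[OF assms(1)]
    by (rule zspan_minimal) (auto simp: assms(2) frag_lift_diff)
  have "(SOME d. d \<in> ext_class p G c) \<in> ext_class p G c"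
    by (rule someI) (rule ext_class_self[OF assms(1)])
  then obtain k where "(SOME d. d \<in> ext_class p G c) = k + c" "k \<in> ext_kernel p G"
    by (auto simp: ext_class_eq)
  then show ?thesis using ker by (auto simp: ext_eval_def frag_lift_add)
qed

section \<open>Exterior powers of the quotient lattices\<close>

lemma convex_cone_hull_subset_span: "convex_cone hull T \<subseteq> span T"
proof (rule hull_minimal)
  show "convex_cone (span T)" by (rule subspace_imp_convex_cone) (rule subspace_span)
qed (rule span_superset)

lemma span_convex_cone_hull [simp]: "span (convex_cone hull T) = span T"
  by (rule span_eq[THEN iffD2]) (use convex_cone_hull_subset_span hull_subset[of T convex_cone] span_superset in blast)

context lattice_complex
begin

definition cls :: "'v set \<Rightarrow> 'v \<Rightarrow> 'v set" where
  "cls T n = {h + n | h. h \<in> zspan T}"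

abbreviation Q :: "'v set \<Rightarrow> 'v set monoid" where
  "Q T \<equiv> quot_lattice N (convex_cone hull T)"

abbreviation subl :: "'v set \<Rightarrow> 'v set \<Rightarrow> 'v set set" where
  "subl T S \<equiv> cls T ` zspan S"

lemma sublattice_cone: "T \<in> K \<Longrightarrow> sublattice N (convex_cone hull T) = zspan T"
  using zspan_Int_span[OF independent_basis finite_basis subset_basis, of T]
  by (simp add: sublattice_def zspan_basis)

lemma N_zero: "0 \<in> N" and N_diff: "a \<in> N \<Longrightarrow> b \<in> N \<Longrightarrow> a - b \<in> N"
    and N_add: "a \<in> N \<Longrightarrow> b \<in> N \<Longrightarrow> a + b \<in> N" and N_minus: "a \<in> N \<Longrightarrow> - a \<in> N"
  using zspan_zero[of "basis {}"] zspan_diff[of a "basis {}" b] zspan_add[of a "basis {}" b] zspan_minus[of a "basis {}"]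
  unfolding zspan_basis[OF empty_K] by simp_all

lemma comm_group_lattice: "comm_group (lattice_group N)"
  by (rule comm_groupI)
     (auto simp: lattice_group_def N_zero N_add algebra_simps intro: bexI[of _ "- _"] N_minus)

lemma inv_lattice: "x \<in> N \<Longrightarrow> inv\<^bsub>lattice_group N\<^esub> x = - x"
proof -
  interpret comm_group "lattice_group N" by (rule comm_group_lattice)
  assume "x \<in> N"
  then show ?thesis by (intro inv_equality) (auto simp: lattice_group_def N_minus)
qed

lemma subgroup_zspan:
  assumes "T \<in> K" shows "subgroup (zspan T) (lattice_group N)"
proof (rule subgroup.intro)
  show "zspan T \<subseteq> carrier (lattice_group N)" using zspan_K[OF assms] by (simp add: lattice_group_def)
  show "x \<otimes>\<^bsub>lattice_group N\<^esub> y \<in> zspan T" if "x \<in> zspan T" "y \<in> zspan T" for x y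
    using that by (simp add: lattice_group_def zspan_add)
  show "\<one>\<^bsub>lattice_group N\<^esub> \<in> zspan T" by (simp add: lattice_group_def zspan_zero)
  show "inv\<^bsub>lattice_group N\<^esub> x \<in> zspan T" if "x \<in> zspan T" for x
    using inv_lattice[of x] zspan_K[OF assms] that by (auto simp: zspan_minus)
qed

lemma coset_cls: "T \<in> K \<Longrightarrow> sublattice N (convex_cone hull T) #>\<^bsub>lattice_group N\<^esub> n = cls T n"
  by (auto simp: sublattice_cone r_coset_def cls_def lattice_group_def)

lemma cls_self: "n \<in> cls T n"
  unfolding cls_def using zspan_zero[of T] by force

lemma cls_eq_iff: "cls T a = cls T b \<longleftrightarrow> a - b \<in> zspan T"
proof
  assume "cls T a = cls T b"
  then obtain h where "a = h + b" "h \<in> zspan T" using cls_self[of a T] by (auto simp: cls_def)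
  then show "a - b \<in> zspan T" by simp
next
  have "cls T a \<subseteq> cls T b" if ab: "a - b \<in> zspan T" for a b
  proof
    fix x assume "x \<in> cls T a"
    then obtain h where h: "x = h + a" "h \<in> zspan T" by (auto simp: cls_def)
    then have "x = (h + (a - b)) + b" "h + (a - b) \<in> zspan T" using ab by (auto intro: zspan_add)
    then show "x \<in> cls T b" unfolding cls_def by blast
  qed
  moreover assume "a - b \<in> zspan T"
  moreover from this have "b - a \<in> zspan T" using zspan_minus[of "a - b" T] by simp
  ultimately show "cls T a = cls T b" by blast
qed

lemma carrier_Q: "T \<in> K \<Longrightarrow> carrier (Q T) = cls T ` N"
  by (auto simp: quot_lattice_def FactGroup_def RCOSETS_def coset_cls lattice_group_def[of N, THEN arg_cong[where f = carrier]])

lemma mult_Q: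
  assumes "T \<in> K" shows "cls T a \<otimes>\<^bsub>Q T\<^esub> cls T b = cls T (a + b)"
proof -
  have "(\<Union>h\<in>cls T a. \<Union>k\<in>cls T b. {h + k}) = cls T (a + b)"
  proof
    show "(\<Union>h\<in>cls T a. \<Union>k\<in>cls T b. {h + k}) \<subseteq> cls T (a + b)"
    proof clarify
      fix h k assume "h \<in> cls T a" "k \<in> cls T b"
      then obtain x y where "h = x + a" "k = y + b" "x \<in> zspan T" "y \<in> zspan T" by (auto simp: cls_def)
      then have "h + k = (x + y) + (a + b)" "x + y \<in> zspan T" by (auto intro: zspan_add)
      then show "h + k \<in> cls T (a + b)" unfolding cls_def by blast
    qed
    show "cls T (a + b) \<subseteq> (\<Union>h\<in>cls T a. \<Union>k\<in>cls T b. {h + k})"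
    proof
      fix x assume "x \<in> cls T (a + b)"
      then obtain h where "x = (h + a) + b" "h \<in> zspan T" by (auto simp: cls_def add.assoc)
      then have "h + a \<in> cls T a" "x = (h + a) + b" unfolding cls_def by blast+
      then show "x \<in> (\<Union>h\<in>cls T a. \<Union>k\<in>cls T b. {h + k})" using cls_self[of b T] by blast
    qed
  qed
  then show ?thesis
    by (simp add: quot_lattice_def FactGroup_def set_mult_def lattice_group_def)
qed

lemma one_Q: "T \<in> K \<Longrightarrow> \<one>\<^bsub>Q T\<^esub> = cls T 0"
  by (simp add: quot_lattice_def FactGroup_def sublattice_cone cls_def)

lemma comm_group_Q: "T \<in> K \<Longrightarrow> comm_group (Q T)"
  unfolding quot_lattice_def
  by (rule comm_group.abelian_FactGroup[OF comm_group_lattice]) (simp add: sublattice_cone subgroup_zspan)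

lemma monoid_Q: "T \<in> K \<Longrightarrow> monoid (Q T)"
  using comm_group_Q comm_group.axioms(2) group.is_monoid by blast

lemma rel_lattice_cls: "T \<in> K \<Longrightarrow> S \<in> K \<Longrightarrow> rel_lattice N (convex_cone hull T) (convex_cone hull S) = subl T S"
  by (simp add: rel_lattice_def coset_cls sublattice_cone[of S])

lemma subl_carrier: "T \<in> K \<Longrightarrow> S \<in> K \<Longrightarrow> subl T S \<subseteq> carrier (Q T)"
  using zspan_K by (auto simp: carrier_Q)

text \<open>The exterior power of a subgroup is formed by changing the carrier, so the general
  lemmas on exterior powers require this structure to be a monoid.\<close>

lemma monoid_subl:
  assumes "T \<in> K" "S \<in> K" shows "monoid (Q T\<lparr>carrier := subl T S\<rparr>)"
proof -
  interpret comm_group "Q T" by (rule comm_group_Q[OF assms(1)])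
  show ?thesis
  proof (rule submonoid.submonoid_is_monoid[OF _ monoid_axioms])
    show "submonoid (subl T S) (Q T)"
    proof (rule submonoid.intro)
      show "subl T S \<subseteq> carrier (Q T)" by (rule subl_carrier[OF assms])
      show "x \<otimes>\<^bsub>Q T\<^esub> y \<in> subl T S" if "x \<in> subl T S" "y \<in> subl T S" for x y
        using that by (auto simp: mult_Q[OF assms(1)] intro: zspan_add)
      show "\<one>\<^bsub>Q T\<^esub> \<in> subl T S" using zspan_zero by (auto simp: one_Q[OF assms(1)])
    qed
  qed
qed

lemma quot_proj_cls:
  assumes "T' \<in> K" "T \<subseteq> T'" shows "quot_proj N (convex_cone hull T') (cls T n) = cls T' n"
proof -
  have "(\<Union>h\<in>zspan T'. \<Union>k\<in>cls T n. {h + k}) = cls T' n"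
  proof
    show "(\<Union>h\<in>zspan T'. \<Union>k\<in>cls T n. {h + k}) \<subseteq> cls T' n"
    proof clarify
      fix h k assume h: "h \<in> zspan T'" and "k \<in> cls T n"
      then obtain x where x: "k = x + n" "x \<in> zspan T" by (auto simp: cls_def)
      then have "h + k = (h + x) + n" "h + x \<in> zspan T'"
        using h zspan_mono[OF assms(2)] by (auto simp: add.assoc intro!: zspan_add)
      then show "h + k \<in> cls T' n" unfolding cls_def by blast
    qed
    show "cls T' n \<subseteq> (\<Union>h\<in>zspan T'. \<Union>k\<in>cls T n. {h + k})"
      using cls_self[of n T] by (auto simp: cls_def)
  qed
  then show ?thesis
    by (simp add: quot_proj_def sublattice_cone[OF assms(1)] set_mult_def lattice_group_def)
qed

definition rep :: "'v set \<Rightarrow> 'v" where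
  "rep X = (SOME n. n \<in> X)"

lemma rep_cls: "rep (cls T n) - n \<in> zspan T"
proof -
  have "rep (cls T n) \<in> cls T n" unfolding rep_def by (rule someI) (rule cls_self)
  then show ?thesis by (auto simp: cls_def)
qed

definition qform :: "'v set \<Rightarrow> 'v set list \<Rightarrow> ('v \<Rightarrow> real) list \<Rightarrow> real" where
  "qform T Xs = restr T (form (map rep Xs))"

lemma qform_cls: "qform T (map (cls T) ns) = restr T (form ns)"
  unfolding qform_def
proof (rule restr_form_eqI)
  fix fs assume fs: "set fs \<subseteq> functionals T" "length fs = length (map rep (map (cls T) ns))"
  have "f (rep (cls T n)) = f n" if "f \<in> functionals T" for f n
  proof -
    have "f (rep (cls T n) - n) = 0"
      using functionals_span[OF that] rep_cls zspan_subset_span by blast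
    then show ?thesis using that by (simp add: functionals_def linear_diff)
  qed
  then show "alt (map rep (map (cls T) ns)) fs = alt ns fs"
    using fs by (intro alt_cong) (auto simp: subset_eq)
qed simp

lemma carrier_list:
  assumes "T \<in> K" "set Xs \<subseteq> subl T S"
  obtains ns where "Xs = map (cls T) ns" "set ns \<subseteq> zspan S"
proof -
  have "\<forall>X\<in>set Xs. \<exists>n. X = cls T n \<and> n \<in> zspan S" using assms by auto
  then obtain h where "\<forall>X\<in>set Xs. X = cls T (h X) \<and> h X \<in> zspan S" by metis
  then have "Xs = map (cls T) (map h Xs)" "set (map h Xs) \<subseteq> zspan S" by (auto simp: map_idI)
  then show ?thesis by (rule that)
qed

lemma qform_relations:
  assumes T: "T \<in> K" and r: "r \<in> ext_relations p (Q T)"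
  shows "frag_lift (qform T) r = 0"
  using r
proof (cases rule: ext_relations_cases)
  case (add xs x y ys)
  obtain a b where a: "x = cls T a" and b: "y = cls T b" using add carrier_Q[OF T] by auto
  have cls_rep: "cls T (rep X) = X" if "X \<in> carrier (Q T)" for X
  proof -
    obtain n where "X = cls T n" using \<open>X \<in> carrier (Q T)\<close> carrier_Q[OF T] by auto
    then show ?thesis using cls_eq_iff[THEN iffD2, OF rep_cls] by simp
  qed
  then have xs: "xs = map (cls T) (map rep xs)" "ys = map (cls T) (map rep ys)"
    using add(1,4) by (auto intro!: map_idI[symmetric] simp: subset_eq)
  have *: "qform T (xs @ [cls T z] @ ys) = restr T (form (map rep xs @ z # map rep ys))" for z
    using xs qform_cls[of T "map rep xs @ z # map rep ys"] by simp
  show ?thesis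
    unfolding add(6) a b frag_lift_diff frag_lift_of mult_Q[OF T] *
    by (simp add: form_add restr_add)
next
  case (repeated xs)
  then have "\<not> distinct (map rep xs)" by (auto simp: distinct_map)
  then show ?thesis
    by (simp add: repeated qform_def form_repeated linear_0[OF linear_restr])
qed

text \<open>The embedding of the exterior powers of N/N_tau into real functions. Identities in these
  groups are proved by applying it and comparing functions, which \<open>inj_on_val\<close>
  justifies.\<close>

definition val :: "'v set \<Rightarrow> 'v set ext \<Rightarrow> ('v \<Rightarrow> real) list \<Rightarrow> real" where
  "val T = ext_eval (qform T)"

lemma val_class: "T \<in> K \<Longrightarrow> val T (ext_class p (Q T) c) = frag_lift (qform T) c"
  unfolding val_def by (rule ext_eval_class[OF monoid_Q qform_relations])

lemma val_mult:
  assumes "T \<in> K" "X \<in> carrier (ext_power p (Q T))" "Y \<in> carrier (ext_power p (Q T))"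
  shows "val T (X \<otimes>\<^bsub>ext_power p (Q T)\<^esub> Y) = val T X + val T Y"
  using assms by (auto simp: carrier_ext_power mult_ext_power[OF monoid_Q] val_class frag_lift_add)

lemma val_one: "T \<in> K \<Longrightarrow> val T (\<one>\<^bsub>ext_power p (Q T)\<^esub>) = 0"
  by (simp add: one_ext_power monoid_Q val_class)

lemma val_inv:
  assumes "T \<in> K" "X \<in> carrier (ext_power p (Q T))"
  shows "val T (inv\<^bsub>ext_power p (Q T)\<^esub> X) = - val T X"
  using assms by (auto simp: carrier_ext_power inv_ext_power[OF monoid_Q] val_class frag_lift_minus)

lemma ext_sub_subl:
  assumes "T \<in> K" "S \<in> K"
  shows "ext_sub p (Q T) (subl T S) = ext_class p (Q T) ` {c. Poly_Mapping.keys c \<subseteq> {xs. length xs = p \<and> set xs \<subseteq> subl T S}}"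
  by (rule ext_sub_eq[OF monoid_Q[OF assms(1)] monoid_subl[OF assms] subl_carrier[OF assms]])

lemma ext_sub_carrier:
  assumes "T \<in> K" "S \<in> K" shows "ext_sub p (Q T) (subl T S) \<subseteq> carrier (ext_power p (Q T))"
proof -
  have "{xs. length xs = p \<and> set xs \<subseteq> subl T S} \<subseteq> tuples p (Q T)"
    using subl_carrier[OF assms] by (auto simp: tuples_def)
  then show ?thesis
    unfolding ext_sub_subl[OF assms] carrier_ext_power by (intro image_mono) blast
qed

lemma qform_image:
  assumes "T \<in> K"
  shows "qform T ` {xs. length xs = p \<and> set xs \<subseteq> subl T S} = {restr T (form xs) | xs. length xs = p \<and> set xs \<subseteq> zspan S}"
proof
  show "qform T ` {xs. length xs = p \<and> set xs \<subseteq> subl T S} \<subseteq> {restr T (form xs) | xs. length xs = p \<and> set xs \<subseteq> zspan S}"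
  proof clarify
    fix xs assume "set xs \<subseteq> subl T S" "p = length xs"
    then show "\<exists>ys. qform T xs = restr T (form ys) \<and> length ys = length xs \<and> set ys \<subseteq> zspan S"
      using carrier_list[OF assms, of xs S] qform_cls by (metis length_map)
  qed
  show "{restr T (form xs) | xs. length xs = p \<and> set xs \<subseteq> zspan S} \<subseteq> qform T ` {xs. length xs = p \<and> set xs \<subseteq> subl T S}"
  proof clarify
    fix xs assume xs: "set xs \<subseteq> zspan S" "p = length xs"
    then show "restr T (form xs) \<in> qform T ` {ys. length ys = length xs \<and> set ys \<subseteq> subl T S}"
      by (intro image_eqI[of _ _ "map (cls T) xs"]) (auto simp: qform_cls)
  qed
qed

lemma val_ext_sub:
  assumes "T \<in> K" "S \<in> K"
  shows "val T ` ext_sub p (Q T) (subl T S) = zspan {restr T (form xs) | xs. length xs = p \<and> set xs \<subseteq> zspan S}"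
  unfolding ext_sub_subl[OF assms] image_image val_class[OF assms(1)] frag_lift_image qform_image[OF assms(1)] ..

lemma val_ext_map:
  assumes T: "T \<in> K" "T' \<in> K" "T \<subseteq> T'" and X: "X \<in> carrier (ext_power p (Q T))"
  shows "val T' (ext_map p (Q T') (quot_proj N (convex_cone hull T')) X) = restr T' (val T X)"
    and "ext_map p (Q T') (quot_proj N (convex_cone hull T')) X \<in> carrier (ext_power p (Q T'))"
proof -
  let ?f = "quot_proj N (convex_cone hull T')"
  obtain c where c: "X = ext_class p (Q T) c" "Poly_Mapping.keys c \<subseteq> tuples p (Q T)"
    using X by (auto simp: carrier_ext_power)
  have eq: "ext_map p (Q T') ?f X = ext_class p (Q T') (frag_extend (\<lambda>xs. frag_of (map ?f xs)) c)"
    unfolding c(1)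
    by (rule ext_map_class) (use T in \<open>auto simp: monoid_Q carrier_Q quot_proj_cls mult_Q\<close>)
  have "qform T' (map ?f xs) = restr T' (qform T xs)" if "xs \<in> tuples p (Q T)" for xs
  proof -
    have "set xs \<subseteq> subl T (basis T)"
      using that T zspan_basis[OF T(1)] by (auto simp: tuples_def carrier_Q)
    then obtain ns where ns: "xs = map (cls T) ns" by (rule carrier_list[OF T(1)])
    have "map ?f xs = map (cls T') ns" using T by (simp add: ns quot_proj_cls)
    then have "qform T' (map ?f xs) = restr T' (form ns)" by (simp add: qform_cls)
    also have "\<dots> = restr T' (restr T (form ns))" using T(3) by (simp add: restr_restr Un_absorb2)
    finally show ?thesis by (simp add: ns qform_cls)
  qed
  then have "frag_lift (\<lambda>xs. qform T' (map ?f xs)) c = frag_lift (\<lambda>xs. restr T' (qform T xs)) c"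
    using c(2) by (intro frag_lift_cong) blast
  then show "val T' (ext_map p (Q T') ?f X) = restr T' (val T X)"
    unfolding eq val_class[OF T(2)] frag_lift_extend[OF c(2)]
    by (simp add: c(1) val_class[OF T(1)] linear_frag_lift[OF linear_restr])
  have "map ?f xs \<in> tuples p (Q T')" if "xs \<in> tuples p (Q T)" for xs
    using that T by (force simp: tuples_def carrier_Q quot_proj_cls)
  then have "Poly_Mapping.keys (frag_extend (\<lambda>xs. frag_of (map ?f xs)) c) \<subseteq> tuples p (Q T')"
    using c(2) keys_frag_extend[of "\<lambda>xs. frag_of (map ?f xs)" c] unfolding keys_frag_of by blast
  then show "ext_map p (Q T') ?f X \<in> carrier (ext_power p (Q T'))"
    unfolding eq carrier_ext_power by blast
qed

lemma sum_fun_apply: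
  fixes h :: "'x \<Rightarrow> 'y \<Rightarrow> real" shows "(\<Sum>x\<in>A. h x) y = (\<Sum>x\<in>A. h x y)"
  by (induction A rule: infinite_finite_induct) auto

lemma frag_lift_apply:
  fixes g :: "'x \<Rightarrow> 'y \<Rightarrow> real"
  shows "frag_lift g c y = (\<Sum>x\<in>Poly_Mapping.keys c. real_of_int (Poly_Mapping.lookup c x) * g x y)"
  by (simp add: frag_lift_def sum_fun_apply)

text \<open>Expansion of determinants whose first column or first row has only the corner entry. The
  first alternative serves faces at infinity, where the other functionals kill n; the second serves
  facets, where the first functional kills the facet.\<close>

lemma val_wedge_left:
  assumes T: "T \<in> K" "S \<in> K" and X: "X \<in> ext_sub p (Q T) (subl T S)" and n: "n \<in> N"
    and fs: "set (f # fs) \<subseteq> functionals T" "length fs = p"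
    and vanish: "(\<forall>g\<in>set fs. g n = 0) \<or> (\<forall>y\<in>zspan S. f y = 0)"
  shows "val T (wedge_left p (Q T) (cls T n) X) (f # fs) = f n * val T X fs"
proof -
  obtain c where c: "X = ext_class p (Q T) c" "Poly_Mapping.keys c \<subseteq> {xs. length xs = p \<and> set xs \<subseteq> subl T S}"
    using X by (auto simp: ext_sub_subl[OF T])
  have "qform T (cls T n # xs) (f # fs) = f n * qform T xs fs" if "xs \<in> Poly_Mapping.keys c" for xs
  proof -
    have "set xs \<subseteq> subl T S" and len: "length xs = p" using that c(2) by auto
    then obtain ns where ns: "xs = map (cls T) ns" "set ns \<subseteq> zspan S" by (meson carrier_list T(1))
    have "qform T (cls T n # xs) (f # fs) = restr T (form (n # ns)) (f # fs)"
      using qform_cls[of T "n # ns"] by (simp add: ns)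
    also have "\<dots> = alt (n # ns) (f # fs)"
      using fs len ns by (intro restr_form_apply) auto
    also have "\<dots> = f n * alt ns fs"
      using vanish
    proof
      assume "\<forall>g\<in>set fs. g n = 0"
      then show ?thesis using len fs ns by (intro alt_Cons_vec) auto
    next
      assume "\<forall>y\<in>zspan S. f y = 0"
      then show ?thesis using len fs ns by (intro alt_Cons_fun) auto
    qed
    also have "alt ns fs = qform T xs fs"
      using fs len ns by (subst restr_form_apply[symmetric]) (auto simp: qform_cls)
    finally show ?thesis .
  qed
  moreover have "val T (wedge_left p (Q T) (cls T n) X) = frag_lift (\<lambda>xs. qform T (cls T n # xs)) c"
    unfolding c(1) using T n
    by (simp add: wedge_left_class monoid_Q carrier_Q val_class frag_lift_extend[OF subset_UNIV])
  ultimately show ?thesis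
    unfolding c(1) val_class[OF T(1)] frag_lift_apply
    by (simp add: frag_lift_apply sum_distrib_left algebra_simps)
qed

lemma wedge_left_ext_sub:
  assumes T: "T \<in> K" "S \<in> K" and X: "X \<in> ext_sub p (Q T) (subl T S)" and n: "n \<in> zspan S"
  shows "wedge_left p (Q T) (cls T n) X \<in> ext_sub (Suc p) (Q T) (subl T S)"
proof -
  obtain c where c: "X = ext_class p (Q T) c" "Poly_Mapping.keys c \<subseteq> {xs. length xs = p \<and> set xs \<subseteq> subl T S}"
    using X by (auto simp: ext_sub_subl[OF T])
  have "Poly_Mapping.keys (frag_extend (\<lambda>xs. frag_of (cls T n # xs)) c) \<subseteq> {xs. length xs = Suc p \<and> set xs \<subseteq> subl T S}"
  proof
    fix x assume "x \<in> Poly_Mapping.keys (frag_extend (\<lambda>xs. frag_of (cls T n # xs)) c)"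
    then obtain xs where "xs \<in> Poly_Mapping.keys c" "x = cls T n # xs"
      using keys_frag_extend[of "\<lambda>xs. frag_of (cls T n # xs)" c] by (auto simp: keys_frag_of)
    then show "x \<in> {xs. length xs = Suc p \<and> set xs \<subseteq> subl T S}"
      using c(2) n by auto
  qed
  moreover have "cls T n \<in> carrier (Q T)" using n zspan_K[OF T(2)] by (auto simp: carrier_Q[OF T(1)])
  ultimately show ?thesis
    unfolding c(1) by (subst wedge_left_class[OF monoid_Q[OF T(1)]]) (auto simp: ext_sub_subl[OF T])
qed

end

text \<open>Expand \<open>(x + y) \<and> (x + y) = 0\<close>.\<close>

lemma ext_relations_swap:
  assumes "monoid G" "set xs \<subseteq> carrier G" "x \<in> carrier G" "y \<in> carrier G" "set ys \<subseteq> carrier G" "p = Suc (Suc (length xs + length ys))"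
  shows "frag_of (xs @ x # y # ys) + frag_of (xs @ y # x # ys) \<in> zspan (ext_relations p G)"
proof -
  let ?z = "x \<otimes>\<^bsub>G\<^esub> y" and ?f = "\<lambda>a b. frag_of (xs @ a # b # ys)"
  have z: "?z \<in> carrier G" using assms monoid.m_closed by metis
  have rep: "?f a a \<in> zspan (ext_relations p G)" if "a \<in> carrier G" for a
    using that assms by (intro zspan_base ext_relations_repeated) auto
  have "?f ?z ?z - ?f x ?z - ?f y ?z \<in> zspan (ext_relations p G)"
    using ext_relations_add[of xs G x y "?z # ys" p] assms z by (intro zspan_base) auto
  moreover have "?f a ?z - ?f a x - ?f a y \<in> zspan (ext_relations p G)" if "a \<in> carrier G" for a
    using ext_relations_add[of "xs @ [a]" G x y ys p] assms z that by (intro zspan_base) auto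
  from this[OF assms(3)] this[OF assms(4)]
  have "?f x ?z - ?f x x - ?f x y \<in> zspan (ext_relations p G)" "?f y ?z - ?f y x - ?f y y \<in> zspan (ext_relations p G)" .
  ultimately have "?f ?z ?z - (?f ?z ?z - ?f x ?z - ?f y ?z) - (?f x ?z - ?f x x - ?f x y) - (?f y ?z - ?f y x - ?f y y)
      - ?f x x - ?f y y \<in> zspan (ext_relations p G)"
    using zspan_diff[OF zspan_diff[OF zspan_diff[OF zspan_diff[OF zspan_diff[OF rep[OF z]]]]]]
      rep[OF assms(3)] rep[OF assms(4)] by blast
  then show ?thesis by (simp add: algebra_simps)
qed

section \<open>A basis of the exterior power and injectivity of the evaluation\<close>

context lattice_complex
begin

definition enum :: "'v set \<Rightarrow> 'v list" where
  "enum I = (SOME l. distinct l \<and> set l = I)"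

lemma enum: "finite I \<Longrightarrow> distinct (enum I) \<and> set (enum I) = I"
  unfolding enum_def by (rule someI_ex) (use finite_distinct_list in blast)

text \<open>Entries are expanded from left to right in \<open>basis T\<close>; ys holds those
  already replaced by basis vectors outside T. Once all entries are such vectors, the tuple either
  repeats an entry, and is a relation, or is sorted by transpositions into the chosen enumeration of
  its set.\<close>

lemma frag_of_normal_form:
  fixes p :: nat
  assumes T: "T \<in> K"
  defines "M \<equiv> zspan (ext_relations p (Q T) \<union> frag_of ` (\<lambda>I. map (cls T) (enum I)) ` {I. I \<subseteq> basis T - T \<and> card I = p})"
  shows "set (ys @ zs) \<subseteq> N \<Longrightarrow> set ys \<subseteq> basis T - T \<Longrightarrow> length (ys @ zs) = p \<Longrightarrow> frag_of (map (cls T) (ys @ zs)) \<in> M"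
proof (induction zs arbitrary: ys)
  have rel: "r \<in> M" if "r \<in> zspan (ext_relations p (Q T))" for r
    using that zspan_mono[of "ext_relations p (Q T)"] unfolding M_def by blast
  have car: "cls T n \<in> carrier (Q T)" if "n \<in> N" for n using that by (simp add: carrier_Q[OF T])
  have Madd: "a + b \<in> M" and Mdiff: "a - b \<in> M" if "a \<in> M" "b \<in> M" for a b
    using that unfolding M_def by (auto intro: zspan_add zspan_diff)
  {
    case Nil
    show ?case
    proof (cases "distinct (map (cls T) ys)")
      case False
      then have "frag_of (map (cls T) ys) \<in> ext_relations p (Q T)"
        using Nil car by (intro ext_relations_repeated) auto
      then show ?thesis using rel zspan_base by auto
    next
      case True
      then have d: "distinct ys" by (rule distinct_map[THEN iffD1, THEN conjunct1])
      let ?P = "\<lambda>l. set l \<subseteq> N \<and> length l = p \<longrightarrow> frag_of (map (cls T) l) \<in> M"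
      have "?P ys"
      proof (rule swap_invariant_mset[where P = ?P])
        fix as a b bs
        assume P: "?P (as @ a # b # bs)"
        show "?P (as @ b # a # bs)"
        proof
          assume *: "set (as @ b # a # bs) \<subseteq> N \<and> length (as @ b # a # bs) = p"
          have "frag_of (map (cls T) as @ cls T a # cls T b # map (cls T) bs) +
              frag_of (map (cls T) as @ cls T b # cls T a # map (cls T) bs) \<in> zspan (ext_relations p (Q T))"
            using * car by (intro ext_relations_swap monoid_Q T) auto
          then have "frag_of (map (cls T) (as @ a # b # bs)) + frag_of (map (cls T) (as @ b # a # bs)) \<in> M"
            by (intro rel) simp
          from Mdiff[OF this, of "frag_of (map (cls T) (as @ a # b # bs))"] P *
          show "frag_of (map (cls T) (as @ b # a # bs)) \<in> M" by simp
        qed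
      next
        show "mset (enum (set ys)) = mset ys"
          using enum[of "set ys"] d set_eq_iff_mset_eq_distinct by blast
        have "frag_of (map (cls T) (enum (set ys))) \<in> M"
          unfolding M_def using Nil distinct_card[OF d] by (intro zspan_base) auto
        then show "?P (enum (set ys))" by simp
      qed
      then show ?thesis using Nil by simp
    qed
  next
    case (Cons z zs)
    let ?f = "\<lambda>n. frag_of (map (cls T) ys @ cls T n # map (cls T) zs)"
    have sub: "?f (a + b) - ?f a - ?f b \<in> M" if "a \<in> N" "b \<in> N" for a b
    proof -
      have "frag_of (map (cls T) ys @ [cls T a \<otimes>\<^bsub>Q T\<^esub> cls T b] @ map (cls T) zs) - frag_of (map (cls T) ys @ [cls T a] @ map (cls T) zs)
         - frag_of (map (cls T) ys @ [cls T b] @ map (cls T) zs) \<in> ext_relations p (Q T)"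
        using Cons.prems that car by (intro ext_relations_add) auto
      then show ?thesis by (intro rel zspan_base) (simp add: mult_Q[OF T])
    qed
    have M0: "0 \<in> M" unfolding M_def by (rule zspan_zero)
    \<comment> \<open>Additivity at 0 + 0 puts the negative of the tuple with entry 0 into
      M.\<close>
    have f0: "?f 0 \<in> M"
      using Mdiff[OF M0 sub[OF N_zero N_zero]] by simp
    have "zspan (basis T) \<subseteq> {n \<in> N. ?f n \<in> M}"
    proof (rule zspan_minimal)
      show "basis T \<subseteq> {n \<in> N. ?f n \<in> M}"
      proof
        fix b assume b: "b \<in> basis T"
        then have bN: "b \<in> N" using zspan_basis[OF T] zspan_base by blast
        show "b \<in> {n \<in> N. ?f n \<in> M}"
        proof (cases "b \<in> T")
          case True
          \<comment> \<open>A basis vector in T is zero in the quotient and contributes the tuple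
            with entry 0.\<close>
          then have "cls T b = cls T 0" by (simp add: cls_eq_iff zspan_base)
          then show ?thesis using f0 bN by simp
        next
          case False
          then show ?thesis using Cons.IH[of "ys @ [b]"] Cons.prems b bN by simp
        qed
      qed
      show "0 \<in> {n \<in> N. ?f n \<in> M}" using f0 N_zero by simp
      fix a b assume ab: "a \<in> {n \<in> N. ?f n \<in> M}" "b \<in> {n \<in> N. ?f n \<in> M}"
      then have "?f (a - b + b) - ?f (a - b) - ?f b \<in> M" by (intro sub N_diff) auto
      then have "?f a - ?f b - (?f a - ?f (a - b) - ?f b) \<in> M"
        using ab Mdiff[OF Mdiff, of "?f a" "?f b"] by (simp only: mem_Collect_eq diff_add_cancel)
      then show "a - b \<in> {n \<in> N. ?f n \<in> M}" using ab N_diff by simp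
    qed
    then show ?case using Cons.prems zspan_basis[OF T] by auto
  }
qed

text \<open>A combination of wedges of distinct basis vectors outside T is determined by its values
  on the dual coordinates, so the normal form of a class with value 0 is zero. In effect these
  wedges are a basis of the exterior power.\<close>

theorem val_eq_zero:
  assumes T: "T \<in> K" and X: "X \<in> carrier (ext_power p (Q T))" "val T X = 0"
  shows "X = \<one>\<^bsub>ext_power p (Q T)\<^esub>"
proof -
  note ind = independent_basis[OF T]
  let ?Bs = "(\<lambda>I. map (cls T) (enum I)) ` {I. I \<subseteq> basis T - T \<and> card I = p}"
  obtain c where c: "X = ext_class p (Q T) c" "Poly_Mapping.keys c \<subseteq> tuples p (Q T)"
    using X by (auto simp: carrier_ext_power)
  have "frag_of ` tuples p (Q T) \<subseteq> zspan (ext_relations p (Q T) \<union> frag_of ` ?Bs)"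
  proof clarify
    fix Xs assume Xs: "Xs \<in> tuples p (Q T)"
    then have "set Xs \<subseteq> subl T (basis T)" using zspan_basis[OF T] by (auto simp: tuples_def carrier_Q[OF T])
    then obtain ns where ns: "Xs = map (cls T) ns" "set ns \<subseteq> zspan (basis T)" by (rule carrier_list[OF T])
    then show "frag_of Xs \<in> zspan (ext_relations p (Q T) \<union> frag_of ` ?Bs)"
      using frag_of_normal_form[OF T, of "[]" ns p] Xs zspan_basis[OF T] by (simp add: tuples_def)
  qed
  then have "c \<in> zspan (ext_relations p (Q T) \<union> frag_of ` ?Bs)"
    using c(2) frag_zspan[of "tuples p (Q T)"] zspan_subset_iff by blast
  then obtain r d where rd: "r \<in> zspan (ext_relations p (Q T))" "d \<in> zspan (frag_of ` ?Bs)" "c = r + d"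
    by (rule zspan_Un_split)
  have "zspan (ext_relations p (Q T)) \<subseteq> {r. frag_lift (qform T) r = 0}"
    by (rule zspan_minimal) (auto simp: qform_relations[OF T] frag_lift_diff)
  then have lift_d: "frag_lift (qform T) d = 0"
    using X(2) rd by (auto simp: c(1) val_class[OF T] frag_lift_add)
  have keys_d: "Poly_Mapping.keys d \<subseteq> ?Bs" using rd(2) frag_zspan[of ?Bs] by blast
  have "Poly_Mapping.keys d = {}"
  proof (rule ccontr)
    assume "Poly_Mapping.keys d \<noteq> {}"
    then obtain I where I: "map (cls T) (enum I) \<in> Poly_Mapping.keys d" "I \<subseteq> basis T - T" "card I = p"
      using keys_d by blast
    have fin: "finite J" if "J \<subseteq> basis T - T" for J using that finite_basis[OF T] finite_subset by blast
    let ?D = "map (coord (basis T)) (enum I)"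
    \<comment> \<open>The coordinates of I give 1 on the wedge of I. For another set J of the same
      size, some element of I is missing from J and its coordinate kills all of J.\<close>
    have "qform T xs ?D = (if xs = map (cls T) (enum I) then 1 else 0)" if xs: "xs \<in> Poly_Mapping.keys d" for xs
    proof -
      obtain J where J: "xs = map (cls T) (enum J)" "J \<subseteq> basis T - T" "card J = p"
        using keys_d xs by blast
      show ?thesis
      proof (cases "J = I")
        case True
        then show ?thesis
          using J I enum[OF fin[OF I(2)]] subset_basis[OF T] by (simp add: qform_cls form_coord[OF ind])
      next
        case False
        have nsub: "\<not> I \<subseteq> J" using False J I fin card_subset_eq by metis
        have len: "length (enum J) = p" "length (enum I) = p"
          using enum[OF fin[OF J(2)]] enum[OF fin[OF I(2)]] J I distinct_card by metis+
        have "restr T (form (enum J)) ?D = alt (enum J) ?D"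
          using enum[OF fin[OF I(2)]] I(2) len coord_functional[OF ind subset_basis[OF T]]
          by (intro restr_form_apply) auto
        also have "\<dots> = 0"
          using enum[OF fin[OF J(2)]] enum[OF fin[OF I(2)]] J(2) I(2) len nsub
          by (intro alt_subset_coord[OF ind]) auto
        finally have *: "qform T xs ?D = 0" by (simp add: J qform_cls)
        have "xs \<noteq> map (cls T) (enum I)"
        proof
          assume "xs = map (cls T) (enum I)"
          moreover have "qform T (map (cls T) (enum I)) ?D = 1"
            using I enum[OF fin[OF I(2)]] subset_basis[OF T] by (simp add: qform_cls form_coord[OF ind])
          ultimately show False using * by simp
        qed
        then show ?thesis using * by simp
      qed
    qed
    then have "frag_lift (qform T) d ?D = (\<Sum>xs\<in>Poly_Mapping.keys d. if xs = map (cls T) (enum I) then real_of_int (Poly_Mapping.lookup d xs) else 0)"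
      unfolding frag_lift_apply by (intro sum.cong) auto
    also have "\<dots> = real_of_int (Poly_Mapping.lookup d (map (cls T) (enum I)))"
      using I(1) by simp
    finally show False using lift_d I(1) by (simp add: in_keys_iff)
  qed
  then have "d = 0" by simp
  then have "c - 0 \<in> ext_kernel p (Q T)"
    using rd by (simp add: ext_kernel_zspan[OF monoid_Q[OF T]])
  then show ?thesis
    unfolding c(1) one_ext_power[OF monoid_Q[OF T]] by (rule ext_class_eqI[OF monoid_Q[OF T]])
qed

lemma inj_on_val:
  assumes T: "T \<in> K" shows "inj_on (val T) (carrier (ext_power p (Q T)))"
proof (rule inj_onI)
  interpret comm_group "ext_power p (Q T)" by (rule comm_group_ext_power[OF monoid_Q[OF T]])
  fix X Y assume XY: "X \<in> carrier (ext_power p (Q T))" "Y \<in> carrier (ext_power p (Q T))" "val T X = val T Y"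
  then have "val T (X \<otimes>\<^bsub>ext_power p (Q T)\<^esub> inv\<^bsub>ext_power p (Q T)\<^esub> Y) = 0"
    by (simp add: val_mult[OF T] val_inv[OF T])
  then have "X \<otimes>\<^bsub>ext_power p (Q T)\<^esub> inv\<^bsub>ext_power p (Q T)\<^esub> Y = \<one>\<^bsub>ext_power p (Q T)\<^esub>"
    using XY by (intro val_eq_zero[OF T]) auto
  then show "X = Y" using XY inv_equality inv_inv by (metis inv_closed)
qed

text \<open>By \<open>restr_form_top\<close> a single form spans the top degree, and determinants of
  integral coordinates are integers. The coefficient is stated as a value on the dual coordinates so
  that it can be found by expanding a determinant.\<close>

lemma val_top:
  assumes T: "T \<in> K" "S \<in> K" "T \<subseteq> S" and L: "distinct L" "set L = S - T"
    and X: "X \<in> ext_sub (length L) (Q T) (subl T S)"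
  shows "val T X = val T X (map (coord (basis S)) L) *\<^sub>R restr T (form L)"
    and "val T X (map (coord (basis S)) L) \<in> \<int>"
proof -
  let ?D = "map (coord (basis S)) L"
  let ?Y = "{\<phi>. \<phi> = \<phi> ?D *\<^sub>R restr T (form L) \<and> \<phi> ?D \<in> \<int>}"
  note ind = independent_basis[OF T(2)]
  have TB: "T \<subseteq> basis S" using T(3) subset_basis[OF T(2)] by blast
  have "zspan {restr T (form xs) | xs. length xs = length L \<and> set xs \<subseteq> zspan S} \<subseteq> ?Y"
  proof (rule zspan_minimal)
    show "{restr T (form xs) | xs. length xs = length L \<and> set xs \<subseteq> zspan S} \<subseteq> ?Y"
    proof clarify
      fix xs assume xs: "length xs = length L" "set xs \<subseteq> zspan S"
      have "restr T (form xs) = alt xs ?D *\<^sub>R restr T (form L)"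
        using xs zspan_subset_span by (intro restr_form_top[OF ind finite_basis[OF T(2)] T(3) subset_basis[OF T(2)] L]) blast+
      moreover have "restr T (form L) ?D = 1"
        using L subset_basis[OF T(2)] by (intro form_coord ind TB) auto
      moreover have "alt xs ?D \<in> \<int>"
      proof (rule alt_Ints)
        fix f x assume "f \<in> set ?D" "x \<in> set xs"
        then show "f x \<in> \<int>"
          using xs(2) zspan_mono[OF subset_basis[OF T(2)]] coord_zspan_Ints[OF ind, of x] by auto
      qed (use xs in simp)
      ultimately show "restr T (form xs) = restr T (form xs) ?D *\<^sub>R restr T (form L) \<and> restr T (form xs) ?D \<in> \<int>"
        by simp
    qed
  next
    fix a b assume "a \<in> ?Y" "b \<in> ?Y"
    then show "a - b \<in> ?Y" by (auto simp: scaleR_diff_left)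
  qed auto
  then have "val T X \<in> ?Y" using X val_ext_sub[OF T(1,2)] by blast
  then show "val T X = val T X ?D *\<^sub>R restr T (form L)" "val T X ?D \<in> \<int>" by auto
qed

end

section \<open>Unimodular fans as simplicial complexes\<close>

lemma convex_cone_hull_finite:
  fixes S :: "'v::real_vector set"
  assumes "finite S"
  shows "convex_cone hull S = {x. \<exists>c. (\<forall>s\<in>S. 0 \<le> c s) \<and> x = (\<Sum>s\<in>S. c s *\<^sub>R s)}" (is "_ = ?R")
proof
  show "convex_cone hull S \<subseteq> ?R"
  proof (rule hull_minimal)
    show "S \<subseteq> ?R"
    proof
      fix x assume "x \<in> S"
      then have "x = (\<Sum>s\<in>S. (if s = x then 1 else 0) *\<^sub>R s)"
        using assms by (simp add: if_distrib[of "\<lambda>s. s *\<^sub>R _"] cong: if_cong)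
      then show "x \<in> ?R"
        unfolding mem_Collect_eq by (intro exI[of _ "\<lambda>s. if s = x then 1 else 0"]) auto
    qed
    show "convex_cone ?R"
      unfolding convex_cone_iff
    proof (intro conjI ballI allI impI)
      show "0 \<in> ?R" unfolding mem_Collect_eq by (intro exI[of _ "\<lambda>_. 0"]) auto
    next
      fix x y assume "x \<in> ?R" "y \<in> ?R"
      then obtain c d where "\<forall>s\<in>S. 0 \<le> c s" "x = (\<Sum>s\<in>S. c s *\<^sub>R s)" "\<forall>s\<in>S. 0 \<le> d s" "y = (\<Sum>s\<in>S. d s *\<^sub>R s)"
        by blast
      then show "x + y \<in> ?R" unfolding mem_Collect_eq
        by (intro exI[of _ "\<lambda>s. c s + d s"]) (auto simp: scaleR_add_left sum.distrib)
    next
      fix x and t :: real assume "x \<in> ?R" "0 \<le> t"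
      then obtain c where "\<forall>s\<in>S. 0 \<le> c s" "x = (\<Sum>s\<in>S. c s *\<^sub>R s)" by blast
      then show "t *\<^sub>R x \<in> ?R" unfolding mem_Collect_eq
        using \<open>0 \<le> t\<close> by (intro exI[of _ "\<lambda>s. t * c s"]) (auto simp: scaleR_sum_right)
    qed
  qed
  show "?R \<subseteq> convex_cone hull S"
  proof clarify
    fix c :: "'v \<Rightarrow> real" assume c: "\<forall>s\<in>S. 0 \<le> c s"
    have "(\<Sum>s\<in>A. c s *\<^sub>R s) \<in> convex_cone hull S" if "A \<subseteq> S" for A
      using that
    proof (induction A rule: infinite_finite_induct)
      case (insert s A)
      then show ?case using c by (auto intro!: convex_cone_hull_add convex_cone_hull_mul simp: hull_inc)
    qed (auto simp: convex_cone_hull_contains_0)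
    then show "(\<Sum>s\<in>S. c s *\<^sub>R s) \<in> convex_cone hull S" by simp
  qed
qed

text \<open>For part of a basis the cone is a coordinate orthant, so membership and faces reduce to
  sign conditions on coordinates.\<close>

lemma convex_cone_hull_coord:
  assumes "independent B" "finite B" "S \<subseteq> B"
  shows "x \<in> convex_cone hull S \<longleftrightarrow>
    x \<in> span B \<and> (\<forall>b\<in>B. 0 \<le> coord B b x) \<and> (\<forall>b\<in>B - S. coord B b x = 0)"
proof
  assume "x \<in> convex_cone hull S"
  then obtain c where c: "\<forall>s\<in>S. 0 \<le> c s" "x = (\<Sum>s\<in>S. c s *\<^sub>R s)"
    using convex_cone_hull_finite[OF finite_subset[OF assms(3,2)]] by blast
  have "coord B b x = (if b \<in> S then c b else 0)" if "b \<in> B" for b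
  proof -
    have "coord B b x = (\<Sum>s\<in>S. c s * coord B b s)"
      using linear_coord[OF assms(1)] by (simp add: c(2) linear_sum linear_scale)
    also have "\<dots> = (\<Sum>s\<in>S. if s = b then c s else 0)"
      using assms(3) by (intro sum.cong refl) (subst coord_basis[OF assms(1)], auto)
    finally show ?thesis using finite_subset[OF assms(3,2)] by simp
  qed
  moreover have "x \<in> span B"
    unfolding c(2) using assms(3) by (intro span_sum span_scale span_base) auto
  ultimately show "x \<in> span B \<and> (\<forall>b\<in>B. 0 \<le> coord B b x) \<and> (\<forall>b\<in>B - S. coord B b x = 0)"
    using c(1) by auto
next
  assume x: "x \<in> span B \<and> (\<forall>b\<in>B. 0 \<le> coord B b x) \<and> (\<forall>b\<in>B - S. coord B b x = 0)"
  have "x = (\<Sum>b\<in>B. coord B b x *\<^sub>R b)" using x assms by (intro coord_expansion) auto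
  also have "\<dots> = (\<Sum>b\<in>S. coord B b x *\<^sub>R b)" using x assms by (intro sum.mono_neutral_right) auto
  finally have "x = (\<Sum>b\<in>S. coord B b x *\<^sub>R b)" .
  moreover have "\<forall>s\<in>S. 0 \<le> coord B s x" using x assms(3) by blast
  ultimately show "x \<in> convex_cone hull S"
    unfolding convex_cone_hull_finite[OF finite_subset[OF assms(3,2)]] mem_Collect_eq by (intro exI[of _ "\<lambda>s. coord B s x"]) auto
qed

text \<open>For t outside T the coordinate of t is nonnegative on the larger cone. If it vanishes in
  the interior of a segment of that cone, it vanishes at both ends.\<close>

lemma simplicial_face:
  assumes B: "independent B" "finite B" "S \<subseteq> B" and T: "T \<subseteq> S"
  shows "convex_cone hull T \<preceq>\<^sub>c convex_cone hull S"
proof -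
  have TB: "T \<subseteq> B" using B(3) T by blast
  have "convex_cone hull T face_of convex_cone hull S"
    unfolding face_of_def
  proof (intro conjI ballI impI)
    show "convex_cone hull T \<subseteq> convex_cone hull S" using T by (rule hull_mono)
    show "convex (convex_cone hull T)" by (rule convex_convex_cone_hull)
    have *: "a \<in> convex_cone hull T"
      if a: "a \<in> convex_cone hull S" and b: "b \<in> convex_cone hull S" and x: "(1 - u) *\<^sub>R a + u *\<^sub>R b \<in> convex_cone hull T"
        and u: "0 < u" "u < 1" for a b u
    proof -
      have "coord B t a = 0" if t: "t \<in> B - T" for t
      proof -
        have "coord B t ((1 - u) *\<^sub>R a + u *\<^sub>R b) = 0"
          using x t convex_cone_hull_coord[OF B(1,2) TB] by blast
        then have "(1 - u) * coord B t a + u * coord B t b = 0"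
          using linear_coord[OF B(1)] by (simp add: linear_add linear_scale)
        moreover have "0 \<le> coord B t a" "0 \<le> coord B t b"
          using a b t convex_cone_hull_coord[OF B] by blast+
        then have "0 \<le> (1 - u) * coord B t a" "0 \<le> u * coord B t b"
          using u by auto
        ultimately have "(1 - u) * coord B t a = 0" by linarith
        then show ?thesis using u by simp
      qed
      then show ?thesis using a convex_cone_hull_coord[OF B] convex_cone_hull_coord[OF B(1,2) TB] by blast
    qed
    fix a b x
    assume ab: "a \<in> convex_cone hull S" "b \<in> convex_cone hull S" and x: "x \<in> convex_cone hull T" "x \<in> open_segment a b"
    then obtain u where u: "0 < u" "u < 1" "x = (1 - u) *\<^sub>R a + u *\<^sub>R b"
      by (auto simp: in_segment)
    show "a \<in> convex_cone hull T" using *[OF ab, of u] u x by simp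
    show "b \<in> convex_cone hull T" using *[OF ab(2,1), of "1 - u"] u x by (simp add: add.commute)
  qed
  then show ?thesis by (simp add: cone_face_def convex_cone_hull_nonempty)
qed

lemma dim_convex_cone_hull: "independent T \<Longrightarrow> dim (convex_cone hull T) = card T"
  by (rule dim_eq_card[of T]) simp_all

section \<open>Primitive vectors of rays\<close>

lemma primitive_vector_eqI:
  assumes "v \<noteq> 0" "\<rho> \<inter> N = range (\<lambda>k::nat. real k *\<^sub>R v)"
  shows "primitive_vector N \<rho> = v"
  unfolding primitive_vector_def
proof (rule the_equality)
  fix w assume w: "w \<noteq> 0 \<and> \<rho> \<inter> N = range (\<lambda>k::nat. real k *\<^sub>R w)"
  have "v \<in> range (\<lambda>k::nat. real k *\<^sub>R w)" "w \<in> range (\<lambda>k::nat. real k *\<^sub>R v)"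
    using w assms(2) rangeI[of "\<lambda>k::nat. real k *\<^sub>R v" 1] rangeI[of "\<lambda>k::nat. real k *\<^sub>R w" 1] by auto
  then obtain k l :: nat where kl: "v = real k *\<^sub>R w" "w = real l *\<^sub>R v" by blast
  then have "v = (real k * real l) *\<^sub>R v" by simp
  then have "(real k * real l - 1) *\<^sub>R v = 0" by (simp add: scaleR_diff_left)
  then have "real (k * l) = real 1" using assms(1) by simp
  then have "k * l = 1" by (simp only: of_nat_eq_iff)
  then show "w = v" using kl by simp
qed (use assms in auto)

text \<open>The vector a comes from the finite generating set, hence from the lattice. A cone of
  dimension one lies on a line, and strict convexity excludes negative multiples of its nonzero
  vectors.\<close>

lemma ray_half_line:
  assumes \<rho>: "rational_cone N \<rho>" "dim \<rho> = 1"
  obtains a where "a \<in> N" "a \<noteq> 0" "\<rho> = {t *\<^sub>R a | t. 0 \<le> t}"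
proof -
  obtain A where A: "finite A" "A \<subseteq> N" "\<rho> = convex_cone hull A" and pointed: "\<rho> \<inter> uminus ` \<rho> = {0}"
    using \<rho>(1) by (auto simp: rational_cone_def)
  obtain D where D: "D \<subseteq> \<rho>" "independent D" "\<rho> \<subseteq> span D" "card D = 1"
    using basis_exists[of \<rho>] \<rho>(2) by auto
  then obtain d where d: "D = {d}" using card_1_singletonE by blast
  then have "d \<noteq> 0" "d \<in> \<rho>" using D dependent_single by auto
  have mul: "t *\<^sub>R x \<in> \<rho>" if "x \<in> \<rho>" "0 \<le> t" for x t
    using that unfolding A(3) by (rule convex_cone_hull_mul)
  have line: "\<exists>t\<ge>0. x = t *\<^sub>R d" if x: "x \<in> \<rho>" for x
  proof -
    obtain t where t: "x = t *\<^sub>R d" using D(3) d x span_breakdown_eq[of x d "{}"] by auto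
    have "0 \<le> t"
    proof (rule ccontr)
      assume "\<not> 0 \<le> t"
      then have "- d = (1 / (- t)) *\<^sub>R x" "0 \<le> 1 / (- t)" by (auto simp: t)
      then have "- d \<in> \<rho>" using mul[OF x, of "1 / (- t)"] by (simp only:)
      then have "d \<in> \<rho> \<inter> uminus ` \<rho>" using \<open>d \<in> \<rho>\<close> by force
      then show False using pointed \<open>d \<noteq> 0\<close> by simp
    qed
    then show ?thesis using t by blast
  qed
  have "\<not> A \<subseteq> {0}"
  proof
    assume "A \<subseteq> {0}"
    then have "\<rho> \<subseteq> span {0}" unfolding A(3) by (rule order.trans[OF convex_cone_hull_subset_span span_mono])
    then show False using \<open>d \<in> \<rho>\<close> \<open>d \<noteq> 0\<close> by auto
  qed
  then obtain a where a: "a \<in> A" "a \<noteq> 0" by blast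
  then have "a \<in> \<rho>" unfolding A(3) by (simp add: hull_inc)
  then obtain s where s: "0 \<le> s" "a = s *\<^sub>R d" using line by blast
  then have "s > 0" using a by (cases "s = 0") auto
  have "\<rho> = {t *\<^sub>R a | t. 0 \<le> t}"
  proof
    show "\<rho> \<subseteq> {t *\<^sub>R a | t. 0 \<le> t}"
    proof
      fix x assume "x \<in> \<rho>"
      then obtain t where t: "0 \<le> t" "x = t *\<^sub>R d" using line by blast
      then have "x = (t / s) *\<^sub>R a" "0 \<le> t / s" using s \<open>s > 0\<close> by auto
      then show "x \<in> {t *\<^sub>R a | t. 0 \<le> t}" by blast
    qed
  qed (use mul[OF \<open>a \<in> \<rho>\<close>] in blast)
  then show ?thesis using that a A(2) by blast
qed

text \<open>Discreteness of the lattice: some coordinate of a is a nonzero integer, of absolute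
  value m say, so every lattice point on the ray is j / m times a for some natural number j. The
  least positive j that occurs gives the generator.\<close>

lemma primitive_vector_ray:
  assumes N: "free_lattice N" and \<rho>: "rational_cone N \<rho>" "dim \<rho> = 1"
  defines "v \<equiv> primitive_vector N \<rho>"
  shows "v \<in> N" "v \<noteq> 0" "\<rho> = convex_cone hull {v}"
proof -
  obtain B where B: "finite B" "independent B" "N = zspan B"
    using N by (auto simp: free_lattice_def int_basis_zspan)
  obtain a where a: "a \<in> N" "a \<noteq> 0" "\<rho> = {t *\<^sub>R a | t. 0 \<le> t}" using ray_half_line[OF \<rho>] by blast
  have "a \<in> span B" using a(1) B(3) zspan_subset_span by blast
  have "\<exists>b\<in>B. coord B b a \<noteq> 0"
  proof (rule ccontr)
    assume "\<not> (\<exists>b\<in>B. coord B b a \<noteq> 0)"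
    then have "a = 0" using coord_expansion[OF B(2,1) \<open>a \<in> span B\<close>] by simp
    then show False using a(2) by simp
  qed
  then obtain b where b: "b \<in> B" "coord B b a \<noteq> 0" by blast
  obtain z where z: "coord B b a = of_int z"
    using Ints_cases[OF coord_zspan_Ints[OF B(2)]] a(1) unfolding B(3) by metis
  define m where "m = nat \<bar>z\<bar>"
  have m: "m > 0" "real m = \<bar>coord B b a\<bar>" using b z by (auto simp: m_def)
  define P where "P k \<longleftrightarrow> k > 0 \<and> (real k / real m) *\<^sub>R a \<in> N" for k
  have "P m" using m(1) a(1) by (simp add: P_def)
  define k where "k = (LEAST k. P k)"
  have Pk: "P k" unfolding k_def using \<open>P m\<close> by (rule LeastI)
  have least: "\<not> P j" if "j < k" for j using that not_less_Least unfolding k_def by blast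
  let ?w = "(real k / real m) *\<^sub>R a"
  have w: "?w \<noteq> 0" "?w \<in> N" using Pk m a by (auto simp: P_def)
  have scale: "real j *\<^sub>R ?w \<in> N" for j :: nat
    using zspan_scale[of ?w B "int j"] w(2) B(3) by simp
  have "\<rho> \<inter> N = range (\<lambda>k::nat. real k *\<^sub>R ?w)"
  proof
    show "range (\<lambda>k::nat. real k *\<^sub>R ?w) \<subseteq> \<rho> \<inter> N"
    proof clarify
      fix j :: nat
      have "real j *\<^sub>R ?w = (real j * (real k / real m)) *\<^sub>R a" "0 \<le> real j * (real k / real m)" by auto
      then have "real j *\<^sub>R ?w \<in> \<rho>" unfolding a(3) by blast
      then show "real j *\<^sub>R ?w \<in> \<rho> \<inter> N" using scale by blast
    qed
    show "\<rho> \<inter> N \<subseteq> range (\<lambda>k::nat. real k *\<^sub>R ?w)"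
    proof
      fix x assume x: "x \<in> \<rho> \<inter> N"
      then obtain t where t: "x = t *\<^sub>R a" "0 \<le> t" using a(3) by blast
      obtain y where y: "coord B b x = of_int y"
        using Ints_cases[OF coord_zspan_Ints[OF B(2)]] x unfolding B(3) by (metis IntD2)
      have "coord B b x = t * coord B b a" using linear_coord[OF B(2)] by (simp add: t linear_scale)
      then have "t * real m = \<bar>coord B b x\<bar>" using m(2) t(2) by (simp add: abs_mult)
      then have tm: "t * real m = real (nat \<bar>y\<bar>)" using y by simp
      define j where "j = nat \<bar>y\<bar>"
      \<comment> \<open>Division with remainder by the least k: a nonzero remainder would be a
        smaller positive numerator with a lattice point.\<close>
      have "j = (j div k) * k + j mod k" by simp
      then have "real j = real (j div k) * real k + real (j mod k)" by (metis of_nat_add of_nat_mult)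
      moreover have t': "t = real j / real m" using tm m(1) by (simp add: j_def field_simps)
      ultimately have x': "x = real (j div k) *\<^sub>R ?w + (real (j mod k) / real m) *\<^sub>R a"
        by (simp add: t(1) scaleR_add_left[symmetric] add_divide_distrib)
      then have "(real (j mod k) / real m) *\<^sub>R a = x - real (j div k) *\<^sub>R ?w" by simp
      also have "\<dots> \<in> N" using zspan_diff[of x B] x scale[of "j div k"] unfolding B(3) by blast
      finally have "(real (j mod k) / real m) *\<^sub>R a \<in> N" .
      moreover have "j mod k < k" using Pk by (simp add: P_def)
      ultimately have "j mod k = 0" using least[of "j mod k"] by (auto simp: P_def)
      then have "x = real (j div k) *\<^sub>R ?w" using x' by simp
      then show "x \<in> range (\<lambda>k::nat. real k *\<^sub>R ?w)" by blast
    qed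
  qed
  from primitive_vector_eqI[OF w(1) this] have v: "v = ?w" by (simp add: v_def)
  show "v \<in> N" "v \<noteq> 0" using v w by auto
  show "\<rho> = convex_cone hull {v}"
  proof -
    have pos: "real k / real m > 0" using Pk m by (simp add: P_def)
    have "\<rho> = {t *\<^sub>R v | t. 0 \<le> t}"
    proof
      show "\<rho> \<subseteq> {t *\<^sub>R v | t. 0 \<le> t}"
      proof
        fix x assume "x \<in> \<rho>"
        then obtain t where "x = t *\<^sub>R a" "0 \<le> t" using a(3) by blast
        then have "x = (t / (real k / real m)) *\<^sub>R v" "0 \<le> t / (real k / real m)" using pos v by auto
        then show "x \<in> {t *\<^sub>R v | t. 0 \<le> t}" by blast
      qed
      show "{t *\<^sub>R v | t. 0 \<le> t} \<subseteq> \<rho>"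
      proof clarify
        fix t :: real assume "0 \<le> t"
        then have "t *\<^sub>R v = (t * (real k / real m)) *\<^sub>R a" "0 \<le> t * (real k / real m)" using v by auto
        then show "t *\<^sub>R v \<in> \<rho>" unfolding a(3) by blast
      qed
    qed
    also have "\<dots> = convex_cone hull {v}"
      by (subst convex_cone_hull_finite) (auto intro: exI[of _ "\<lambda>_. _"])
    finally show ?thesis .
  qed
qed

definition generators :: "'v::real_vector set \<Rightarrow> 'v set \<Rightarrow> 'v set" where
  "generators N \<sigma> = primitive_vector N ` rays \<sigma>"

section \<open>From a unimodular fan to its complex of generators\<close>

locale unimodular_fan =
  fixes N :: "'v::real_vector set" and \<Delta> :: "'v set set"
  assumes free: "free_lattice N" and fan: "fan N \<Delta>" and unimodular: "unimodular N \<Delta>"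
begin

lemma face_closed: "\<sigma> \<in> \<Delta> \<Longrightarrow> \<tau> \<preceq>\<^sub>c \<sigma> \<Longrightarrow> \<tau> \<in> \<Delta>"
  using fan by (auto simp: fan_def)

lemma rays_fan:
  assumes "\<sigma> \<in> \<Delta>" "\<rho> \<in> rays \<sigma>" shows "\<rho> \<in> \<Delta>" "rational_cone N \<rho>" "dim \<rho> = 1"
  using assms face_closed fan by (auto simp: rays_def fan_def)

lemma finite_rays: "\<sigma> \<in> \<Delta> \<Longrightarrow> finite (rays \<sigma>)"
  using rays_fan(1) fan unfolding fan_def by (meson finite_subset subsetI)

lemma ray_cone: "\<sigma> \<in> \<Delta> \<Longrightarrow> \<rho> \<in> rays \<sigma> \<Longrightarrow> \<rho> = convex_cone hull {primitive_vector N \<rho>}"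
  using primitive_vector_ray(3)[OF free] rays_fan by blast

lemma generators_basis:
  assumes "\<sigma> \<in> \<Delta>" obtains B where "int_basis N B" "generators N \<sigma> \<subseteq> B"
  using unimodular assms by (auto simp: unimodular_def generators_def)

lemma independent_generators: "\<sigma> \<in> \<Delta> \<Longrightarrow> independent (generators N \<sigma>)"
  using generators_basis independent_mono unfolding int_basis_def by metis

text \<open>The definition of unimodularity generates sigma by the union of its rays as sets; each
  ray is in turn generated by its primitive vector.\<close>

lemma cone_generators:
  assumes "\<sigma> \<in> \<Delta>" shows "convex_cone hull (generators N \<sigma>) = \<sigma>"
proof
  have \<sigma>: "\<sigma> = convex_cone hull (\<Union>(rays \<sigma>))" using unimodular assms by (auto simp: unimodular_def)
  have "generators N \<sigma> \<subseteq> \<sigma>"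
  proof
    fix v assume "v \<in> generators N \<sigma>"
    then obtain \<rho> where \<rho>: "\<rho> \<in> rays \<sigma>" "v = primitive_vector N \<rho>" by (auto simp: generators_def)
    have "v \<in> \<rho>" using ray_cone[OF assms \<rho>(1)] hull_inc[of v "{v}" convex_cone] \<rho>(2) by auto
    moreover have "\<rho> \<subseteq> \<sigma>" using \<rho>(1) face_of_imp_subset by (auto simp: rays_def cone_face_def)
    ultimately show "v \<in> \<sigma>" by blast
  qed
  moreover have "convex_cone \<sigma>" using \<sigma> convex_cone_convex_cone_hull by metis
  ultimately show "convex_cone hull (generators N \<sigma>) \<subseteq> \<sigma>" by (rule hull_minimal)
  have "\<Union>(rays \<sigma>) \<subseteq> convex_cone hull (generators N \<sigma>)"
  proof (rule Union_least)
    fix \<rho> assume \<rho>: "\<rho> \<in> rays \<sigma>"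
    then have "{primitive_vector N \<rho>} \<subseteq> generators N \<sigma>" by (simp add: generators_def)
    then show "\<rho> \<subseteq> convex_cone hull (generators N \<sigma>)" using ray_cone[OF assms \<rho>] hull_mono by metis
  qed
  then have "convex_cone hull (\<Union>(rays \<sigma>)) \<subseteq> convex_cone hull (generators N \<sigma>)"
    using convex_cone_convex_cone_hull by (rule hull_minimal)
  then show "\<sigma> \<subseteq> convex_cone hull (generators N \<sigma>)" using \<sigma> by simp
qed

lemma card_generators:
  assumes "\<sigma> \<in> \<Delta>" shows "card (generators N \<sigma>) = dim \<sigma>"
  using dim_convex_cone_hull[OF independent_generators[OF assms]] cone_generators[OF assms] by simp

text \<open>Every t in T spans a ray of sigma, which is also a ray of the cone over T. No further
  rays occur, because a cone of the fan has as many generators as its dimension, which is here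
  \<open>card T\<close>.\<close>

lemma generators_subset:
  assumes "\<sigma> \<in> \<Delta>" "T \<subseteq> generators N \<sigma>"
  shows "convex_cone hull T \<in> \<Delta>" "convex_cone hull T \<preceq>\<^sub>c \<sigma>" "generators N (convex_cone hull T) = T"
proof -
  obtain B where B: "int_basis N B" "generators N \<sigma> \<subseteq> B" using generators_basis[OF assms(1)] .
  then have B': "independent B" "finite B" by (auto simp: int_basis_def)
  have TB: "T \<subseteq> B" using B(2) assms(2) by blast
  show face: "convex_cone hull T \<preceq>\<^sub>c \<sigma>"
    using simplicial_face[OF B' B(2) assms(2)] cone_generators[OF assms(1)] by simp
  then show \<tau>: "convex_cone hull T \<in> \<Delta>" by (rule face_closed[OF assms(1)])
  have "T \<subseteq> generators N (convex_cone hull T)"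
  proof
    fix t assume t: "t \<in> T"
    obtain \<rho> where \<rho>: "\<rho> \<in> rays \<sigma>" "t = primitive_vector N \<rho>" using t assms(2) by (auto simp: generators_def)
    then have "\<rho> = convex_cone hull {t}" using ray_cone[OF assms(1)] by blast
    moreover have "convex_cone hull {t} \<preceq>\<^sub>c convex_cone hull T"
      using t by (intro simplicial_face[OF B' TB]) auto
    ultimately have "\<rho> \<in> rays (convex_cone hull T)" using \<rho>(1) by (simp add: rays_def)
    then show "t \<in> generators N (convex_cone hull T)" using \<rho>(2) by (simp add: generators_def)
  qed
  moreover have "finite (generators N (convex_cone hull T))"
    using finite_rays[OF \<tau>] by (simp add: generators_def)
  moreover have "card (generators N (convex_cone hull T)) = card T"
    using card_generators[OF \<tau>] dim_convex_cone_hull[OF independent_mono[OF B'(1) TB]] by simp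
  ultimately show "generators N (convex_cone hull T) = T" using card_subset_eq by metis
qed

definition complex :: "'v set set" where
  "complex = generators N ` \<Delta>"

lemma complexE:
  assumes "S \<in> complex" obtains "convex_cone hull S \<in> \<Delta>" "generators N (convex_cone hull S) = S"
  using assms that generators_subset[OF _ subset_refl] by (auto simp: complex_def)

lemma fan_eq: "\<Delta> = (\<lambda>S. convex_cone hull S) ` complex"
  using cone_generators by (auto simp: complex_def image_image)

lemma complex_face_iff:
  assumes "T \<in> complex" "S \<in> complex"
  shows "convex_cone hull T \<preceq>\<^sub>c convex_cone hull S \<longleftrightarrow> T \<subseteq> S"
proof
  assume face: "convex_cone hull T \<preceq>\<^sub>c convex_cone hull S"
  have "rays (convex_cone hull T) \<subseteq> rays (convex_cone hull S)"
    using face face_of_trans by (auto simp: rays_def cone_face_def)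
  then have "generators N (convex_cone hull T) \<subseteq> generators N (convex_cone hull S)"
    by (auto simp: generators_def)
  then show "T \<subseteq> S" using assms by (auto elim!: complexE)
next
  assume "T \<subseteq> S"
  then show "convex_cone hull T \<preceq>\<^sub>c convex_cone hull S"
    using generators_subset(2)[of "convex_cone hull S" T] assms(2) by (auto elim!: complexE)
qed

lemma inj_on_complex: "inj_on (\<lambda>S. convex_cone hull S) complex"
  by (rule inj_onI) (metis complexE)

lemma lattice_complex: "lattice_complex N complex"
proof
  show "finite complex" using fan by (simp add: complex_def fan_def)
  show "T \<in> complex" if S: "S \<in> complex" and "T \<subseteq> S" for S T
  proof -
    obtain \<sigma> where "\<sigma> \<in> \<Delta>" "S = generators N \<sigma>" using S by (auto simp: complex_def)
    then show ?thesis using generators_subset(1,3)[of \<sigma> T] \<open>T \<subseteq> S\<close> unfolding complex_def by (metis imageI)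
  qed
  moreover obtain \<sigma> where "\<sigma> \<in> \<Delta>" using fan by (auto simp: fan_def)
  then have "generators N \<sigma> \<in> complex" by (simp add: complex_def)
  ultimately show "{} \<in> complex" by blast
  show "\<exists>B. int_basis N B \<and> S \<subseteq> B" if "S \<in> complex" for S
    using that generators_basis unfolding complex_def by (metis imageE)
qed

end

section \<open>Orientations and signs\<close>

lemma (in group) additive_int_pow:
  fixes h :: "'a \<Rightarrow> 'c::real_vector"
  assumes h: "\<And>x y. x \<in> carrier G \<Longrightarrow> y \<in> carrier G \<Longrightarrow> h (x \<otimes> y) = h x + h y" and x: "x \<in> carrier G"
  shows "h (x [^] (k::int)) = real_of_int k *\<^sub>R h x"
proof -
  have one: "h \<one> = 0" using h[of \<one> \<one>] by simp
  have inv: "h (inv y) = - h y" if "y \<in> carrier G" for y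
    using h[of y "inv y"] that one by (simp add: eq_neg_iff_add_eq_0 add.commute)
  have nat: "h (x [^] (n::nat)) = real n *\<^sub>R h x" for n
    by (induction n) (use x in \<open>auto simp: one h scaleR_add_left\<close>)
  show ?thesis
  proof (cases k)
    case (nonneg n)
    then show ?thesis using nat[of n] by (simp add: int_pow_int)
  next
    case (neg n)
    then show ?thesis using nat[of "Suc n"] inv[of "x [^] Suc n"] x
      by (simp only: int_pow_neg_int nat_pow_closed) (simp flip: scaleR_minus_left)
  qed
qed

text \<open>Coefficient groups are generated subgroups; an additive map to a vector space carries
  them to integer spans.\<close>

lemma (in group) additive_generate:
  fixes h :: "'a \<Rightarrow> 'c::real_vector"
  assumes h: "\<And>x y. x \<in> carrier G \<Longrightarrow> y \<in> carrier G \<Longrightarrow> h (x \<otimes> y) = h x + h y" and A: "A \<subseteq> carrier G"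
  shows "h ` generate G A = zspan (h ` A)"
proof
  have one: "h \<one> = 0" using h[of \<one> \<one>] by simp
  have inv: "h (inv y) = - h y" if "y \<in> carrier G" for y
    using h[of y "inv y"] that one by (simp add: eq_neg_iff_add_eq_0 add.commute)
  have "h x \<in> zspan (h ` A)" if "x \<in> generate G A" for x
    using that
  proof induction
    case (inv a)
    then have "h (inv a) = - h a" using A \<open>\<And>y. y \<in> carrier G \<Longrightarrow> h (inv y) = - h y\<close> by blast
    then show ?case using inv by (simp add: zspan_minus zspan_base)
  next
    case (eng a b)
    then show ?case using h generate_in_carrier[OF A] by (simp add: zspan_add)
  qed (auto simp: one intro: zspan_zero zspan_base)
  then show "h ` generate G A \<subseteq> zspan (h ` A)" by blast
  show "zspan (h ` A) \<subseteq> h ` generate G A"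
  proof (rule zspan_minimal)
    show "h ` A \<subseteq> h ` generate G A" by (auto intro: generate.incl)
    show "0 \<in> h ` generate G A" using generate.one[of G A] one by force
    fix a b assume "a \<in> h ` generate G A" "b \<in> h ` generate G A"
    then obtain x y where xy: "a = h x" "b = h y" "x \<in> generate G A" "y \<in> generate G A" by blast
    have "x \<in> carrier G" "y \<in> carrier G" using xy generate_in_carrier[OF A] by auto
    then have "a - b = h (x \<otimes> inv y)" using xy by (simp add: h inv)
    moreover have "x \<otimes> inv y \<in> generate G A"
      using xy generate.eng generate_m_inv_closed[OF A] by metis
    ultimately show "a - b \<in> h ` generate G A" by blast
  qed
qed

lemma (in comm_group) additive_finprod:
  fixes h :: "'a \<Rightarrow> 'c::real_vector"
  assumes h: "\<And>x y. x \<in> carrier G \<Longrightarrow> y \<in> carrier G \<Longrightarrow> h (x \<otimes> y) = h x + h y" and f: "f \<in> A \<rightarrow> carrier G"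
  shows "h (finprod G f A) = (\<Sum>a\<in>A. h (f a))"
proof -
  have one: "h \<one> = 0" using h[of \<one> \<one>] by simp
  show ?thesis
    using f
  proof (induction A rule: infinite_finite_induct)
    case (insert a A)
    then show ?case by (subst finprod_insert) (auto simp: h finprod_closed)
  qed (auto simp: one)
qed

context lattice_complex
begin

abbreviation cn :: "'v set \<Rightarrow> 'v set" where
  "cn S \<equiv> convex_cone hull S"

lemma val_int_pow:
  assumes "T \<in> K" "X \<in> carrier (ext_power p (Q T))"
  shows "val T (X [^]\<^bsub>ext_power p (Q T)\<^esub> (k::int)) = real_of_int k *\<^sub>R val T X"
proof -
  interpret comm_group "ext_power p (Q T)" by (rule comm_group_ext_power[OF monoid_Q[OF assms(1)]])
  show ?thesis by (rule additive_int_pow[OF val_mult[OF assms(1)] assms(2)])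
qed

lemma cls_int_pow:
  assumes T: "T \<in> K" and n: "n \<in> N"
  shows "cls T n [^]\<^bsub>Q T\<^esub> (k::int) = cls T (real_of_int k *\<^sub>R n)"
proof -
  interpret comm_group "Q T" by (rule comm_group_Q[OF T])
  have car: "cls T n \<in> carrier (Q T)" using n by (simp add: carrier_Q[OF T])
  have nat: "cls T n [^]\<^bsub>Q T\<^esub> (j::nat) = cls T (real j *\<^sub>R n)" for j
    by (induction j) (auto simp: one_Q[OF T] mult_Q[OF T] scaleR_add_left add.commute)
  show ?thesis
  proof (cases k)
    case (nonneg j)
    then show ?thesis using nat[of j] by (simp add: int_pow_int)
  next
    case (neg j)
    have jN: "real (Suc j) *\<^sub>R n \<in> N"
      using n zspan_scale[of n "basis T" "int (Suc j)"] zspan_basis[OF T] by simp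
    have "inv\<^bsub>Q T\<^esub> (cls T (real (Suc j) *\<^sub>R n)) = cls T (- (real (Suc j) *\<^sub>R n))"
      using jN N_minus[OF jN] by (intro inv_equality) (auto simp: mult_Q[OF T] one_Q[OF T] carrier_Q[OF T])
    then show ?thesis
      unfolding neg int_pow_neg_int[OF car] nat by (simp flip: scaleR_minus_left)
  qed
qed

lemma generate_cls:
  assumes T: "T \<in> K" and n: "n \<in> N"
  shows "generate (Q T) {cls T n} = range (\<lambda>k::int. cls T (real_of_int k *\<^sub>R n))"
proof -
  interpret comm_group "Q T" by (rule comm_group_Q[OF T])
  show ?thesis
    using n by (subst generate_pow) (auto simp: carrier_Q[OF T] cls_int_pow[OF T])
qed

lemma coord_simplex: "S \<in> K \<Longrightarrow> i \<in> S \<Longrightarrow> j \<in> S \<Longrightarrow> coord (basis S) i j = (if j = i then 1 else 0)"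
  using subset_basis by (subst coord_basis[OF independent_basis]) auto

lemma coord_functional_simplex: "S \<in> K \<Longrightarrow> T \<subseteq> S \<Longrightarrow> i \<notin> T \<Longrightarrow> coord (basis S) i \<in> functionals T"
  using subset_basis by (intro coord_functional independent_basis) auto

text \<open>The quotient is infinite cyclic, generated by the class of i. The only other generator
  is the class of -i, which is excluded because the coordinate of i is nonnegative on the cone and
  vanishes on the span of T.\<close>

lemma normal_gen_cls:
  assumes S: "insert i T \<in> K" and i: "i \<notin> T"
  shows "normal_gen N (cn T) (cn (insert i T)) = cls T i"
proof -
  let ?S = "insert i T"
  have T: "T \<in> K" using subset_K[OF S] by blast
  have iN: "i \<in> N" using zspan_K[OF S] zspan_base[of i ?S] by blast
  have subl: "subl T ?S = range (\<lambda>k::int. cls T (real_of_int k *\<^sub>R i))"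
  proof
    show "subl T ?S \<subseteq> range (\<lambda>k::int. cls T (real_of_int k *\<^sub>R i))"
    proof clarify
      fix x assume "x \<in> zspan ?S"
      then obtain a b where ab: "a \<in> zspan {i}" "b \<in> zspan T" "x = a + b"
        using zspan_Un_split[of x "{i}" T] by auto
      obtain k where "a = real_of_int k *\<^sub>R i" using ab(1) zspan_finite[of "{i}"] by auto
      then have "cls T x = cls T (real_of_int k *\<^sub>R i)" using ab by (simp add: cls_eq_iff)
      then show "cls T x \<in> range (\<lambda>k::int. cls T (real_of_int k *\<^sub>R i))" by blast
    qed
    show "range (\<lambda>k::int. cls T (real_of_int k *\<^sub>R i)) \<subseteq> subl T ?S"
      using zspan_scale[OF zspan_base[of i ?S]] by blast
  qed
  show ?thesis
    unfolding normal_gen_def rel_lattice_cls[OF T S] span_convex_cone_hull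
  proof (rule the_equality)
    show "cls T i \<in> subl T ?S \<and> generate (Q T) {cls T i} = subl T ?S \<and> (\<exists>n\<in>cls T i. \<exists>s\<in>cn ?S. n - s \<in> span T)"
    proof (intro conjI)
      show "cls T i \<in> subl T ?S" by (auto intro: zspan_base)
      show "generate (Q T) {cls T i} = subl T ?S" by (simp add: generate_cls[OF T iN] subl)
      have "i \<in> cn ?S" by (simp add: hull_inc)
      moreover have "i - i \<in> span T" by (simp add: span_zero)
      ultimately show "\<exists>n\<in>cls T i. \<exists>s\<in>cn ?S. n - s \<in> span T"
        using cls_self[of i T] by blast
    qed
  next
    fix x assume x: "x \<in> subl T ?S \<and> generate (Q T) {x} = subl T ?S \<and> (\<exists>n\<in>x. \<exists>s\<in>cn ?S. n - s \<in> span T)"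
    let ?c = "coord (basis ?S) i"
    have cT: "?c y = 0" if "y \<in> span T" for y
      using functionals_span[OF coord_functional_simplex[OF S _ i] that] by blast
    have lin: "linear ?c" by (rule linear_coord[OF independent_basis[OF S]])
    have "x \<in> range (\<lambda>k::int. cls T (real_of_int k *\<^sub>R i))" using x subl by simp
    then obtain k :: int where k: "x = cls T (real_of_int k *\<^sub>R i)" by (rule rangeE)
    have kN: "real_of_int k *\<^sub>R i \<in> N" using zspan_scale[of i "basis T" k] iN zspan_basis[OF T] by simp
    have "cls T i \<in> generate (Q T) {x}" using x zspan_base[of i ?S] by blast
    then obtain l where "cls T i = cls T (real_of_int l *\<^sub>R real_of_int k *\<^sub>R i)"
      using generate_cls[OF T kN] k by auto
    then have "i - real_of_int l *\<^sub>R real_of_int k *\<^sub>R i \<in> span T"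
      using zspan_subset_span by (auto simp: cls_eq_iff)
    then have "?c (i - real_of_int l *\<^sub>R real_of_int k *\<^sub>R i) = 0" by (rule cT)
    then have "1 - real_of_int l * real_of_int k = 0"
      using lin coord_simplex[OF S, of i i] by (simp add: linear_diff linear_scale)
    then have "real_of_int (l * k) = real_of_int 1" by simp
    then have lk: "l * k = 1" by (simp only: of_int_eq_iff)
    obtain n s where n: "n \<in> x" "s \<in> cn ?S" "n - s \<in> span T" using x by blast
    have "?c n = ?c s" using cT[OF n(3)] lin by (simp add: linear_diff)
    moreover have "0 \<le> ?c s"
      using n(2) convex_cone_hull_coord[OF independent_basis[OF S] finite_basis[OF S] subset_basis[OF S]] subset_basis[OF S] by blast
    moreover have "?c n = real_of_int k"
    proof -
      obtain h where "n = h + real_of_int k *\<^sub>R i" "h \<in> zspan T" using n(1) k by (auto simp: cls_def)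
      moreover from this have "?c h = 0" using cT zspan_subset_span by blast
      ultimately show ?thesis using lin coord_simplex[OF S, of i i] by (simp add: linear_add linear_scale)
    qed
    ultimately have "0 \<le> k" by simp
    then have "k = 1" using lk by (auto simp: zmult_eq_1_iff)
    then show "x = cls T i" using k by simp
  qed
qed

lemma ext_sub_mono:
  assumes "T \<in> K" "S' \<in> K" "S \<subseteq> S'"
  shows "ext_sub p (Q T) (subl T S) \<subseteq> ext_sub p (Q T) (subl T S')"
  unfolding ext_sub_subl[OF assms(1) subset_K[OF assms(2,3)]] ext_sub_subl[OF assms(1,2)]
  using image_mono[OF zspan_mono[OF assms(3)], of "cls T"]
  by (intro image_mono Collect_mono impI) (erule order.trans, blast)

end

locale fan_complex = lattice_complex N K
  for N :: "'v::real_vector set" and K +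
  fixes \<Delta> :: "'v set set"
  assumes fan_eq: "\<Delta> = (\<lambda>S. convex_cone hull S) ` K"
    and inj_cn: "inj_on (\<lambda>S. convex_cone hull S) K"
    and cn_face_iff: "T \<in> K \<Longrightarrow> S \<in> K \<Longrightarrow> convex_cone hull T \<preceq>\<^sub>c convex_cone hull S \<longleftrightarrow> T \<subseteq> S"
begin

lemma dim_cn: "S \<in> K \<Longrightarrow> dim (cn S) = card S"
  by (rule dim_convex_cone_hull[OF independent_mono[OF independent_basis subset_basis]])

lemma face_dim_cn: "S \<in> K \<Longrightarrow> T \<subseteq> S \<Longrightarrow> face_dim (cn T, cn S) = card (S - T)"
  using finite_K_simplex[of S] finite_subset[of T S] subset_K[of S T]
  by (simp add: face_dim_def dim_cn card_Diff_subset)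

lemma cn_eq_iff: "S \<in> K \<Longrightarrow> T \<in> K \<Longrightarrow> cn S = cn T \<longleftrightarrow> S = T"
  using inj_cn by (auto dest: inj_onD)

end

locale oriented_fan = fan_complex N K \<Delta>
  for N :: "'v::real_vector set" and K \<Delta> +
  fixes \<nu> :: "'v face \<Rightarrow> 'v set ext"
  assumes orientation: "orientation N \<Delta> \<nu>"
begin

lemma
  assumes "S \<in> K" "T \<subseteq> S"
  shows nu_ext_sub: "\<nu> (cn T, cn S) \<in> ext_sub (card (S - T)) (Q T) (subl T S)"
    and generate_nu: "generate (ext_power (card (S - T)) (Q T)) {\<nu> (cn T, cn S)} = ext_sub (card (S - T)) (Q T) (subl T S)"
proof -
  have T: "T \<in> K" using assms by (rule subset_K)
  have "cn T \<in> \<Delta>" "cn S \<in> \<Delta>" "cn T \<preceq>\<^sub>c cn S" using assms T by (auto simp: fan_eq cn_face_iff)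
  then show "\<nu> (cn T, cn S) \<in> ext_sub (card (S - T)) (Q T) (subl T S)"
    "generate (ext_power (card (S - T)) (Q T)) {\<nu> (cn T, cn S)} = ext_sub (card (S - T)) (Q T) (subl T S)"
    using orientation
    unfolding orientation_def Let_def face_dim_cn[OF assms, symmetric] rel_lattice_cls[OF T assms(1), symmetric]
    by blast+
qed

definition nu :: "'v set \<times> 'v set \<Rightarrow> ('v \<Rightarrow> real) list \<Rightarrow> real" where
  "nu = (\<lambda>(T, S). val T (\<nu> (cn T, cn S)))"

text \<open>By \<open>nu_eps\<close> the only other possibility is the negative, so comparison with
  one form decides the sign.\<close>

definition eps :: "'v set \<times> 'v set \<Rightarrow> 'v list \<Rightarrow> real" where
  "eps c L = (if nu c = restr (fst c) (form L) then 1 else - 1)"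

text \<open>A sign is required for every pair of cells. For faces of codimension one it equals
  \<open>face_sign\<close>; for other pairs, where the definite description need not determine
  anything, the case distinction still yields 1 or -1.\<close>

definition sg :: "'v set \<times> 'v set \<Rightarrow> 'v set \<times> 'v set \<Rightarrow> real" where
  "sg c d = (if face_sign N \<nu> (cn (fst c), cn (snd c)) (cn (fst d), cn (snd d)) = 1 then 1 else - 1)"

lemma eps_sign: "sign_like (eps c L)"
  by (simp add: eps_def sign_like_def)

lemma nu_carrier: "S \<in> K \<Longrightarrow> T \<subseteq> S \<Longrightarrow> \<nu> (cn T, cn S) \<in> carrier (ext_power (card (S - T)) (Q T))"
  using nu_ext_sub ext_sub_carrier subset_K by blast

lemma form_coord_simplex:
  "S \<in> K \<Longrightarrow> T \<subseteq> S \<Longrightarrow> distinct L \<Longrightarrow> set L \<subseteq> S - T \<Longrightarrow> restr T (form L) (map (coord (basis S)) L) = 1"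
  using subset_basis by (intro form_coord independent_basis) auto

text \<open>The generator \<open>nu\<close> and the restricted form of L are integer multiples of
  each other in a torsion-free group, so the two factors have product 1.\<close>

lemma nu_eps:
  assumes S: "S \<in> K" "T \<subseteq> S" and L: "distinct L" "set L = S - T"
  shows "nu (T, S) = eps (T, S) L *\<^sub>R restr T (form L)"
proof -
  have T: "T \<in> K" using S by (rule subset_K)
  let ?E = "ext_power (card (S - T)) (Q T)"
  interpret comm_group ?E by (rule comm_group_ext_power[OF monoid_Q[OF T]])
  have len: "length L = card (S - T)" using distinct_card[OF L(1)] L(2) by simp
  note car = nu_carrier[OF S] and sub = nu_ext_sub[OF S]
  obtain m where m: "nu (T, S) = real_of_int m *\<^sub>R restr T (form L)"
  proof -
    have "val T (\<nu> (cn T, cn S)) (map (coord (basis S)) L) \<in> \<int>"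
      and eq: "val T (\<nu> (cn T, cn S)) = val T (\<nu> (cn T, cn S)) (map (coord (basis S)) L) *\<^sub>R restr T (form L)"
      using val_top[OF T S L] sub len by auto
    then obtain m where "val T (\<nu> (cn T, cn S)) (map (coord (basis S)) L) = of_int m" by (auto elim: Ints_cases)
    then show ?thesis using that[of m] eq by (simp add: nu_def)
  qed
  have "restr T (form L) \<in> val T ` ext_sub (card (S - T)) (Q T) (subl T S)"
    unfolding val_ext_sub[OF T S(1)] using L len by (intro zspan_base) (auto intro: zspan_base)
  then have "restr T (form L) \<in> val T ` generate ?E {\<nu> (cn T, cn S)}" using generate_nu[OF S] by simp
  then obtain k :: int where "restr T (form L) = val T (\<nu> (cn T, cn S) [^]\<^bsub>?E\<^esub> k)"
    using generate_pow[OF car] by auto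
  then have "restr T (form L) = real_of_int k *\<^sub>R nu (T, S)"
    using val_int_pow[OF T car, of k] by (simp add: nu_def)
  also have "\<dots> = (real_of_int k * real_of_int m) *\<^sub>R restr T (form L)"
    by (simp only: m scaleR_scaleR)
  finally have eq: "restr T (form L) = (real_of_int k * real_of_int m) *\<^sub>R restr T (form L)" .
  from fun_cong[OF eq, of "map (coord (basis S)) L"] have "real_of_int (k * m) = real_of_int 1"
    using form_coord_simplex[OF S L(1)] L(2) by simp
  then have "k * m = 1" by (simp only: of_int_eq_iff)
  then have "m = 1 \<or> m = - 1" by (auto simp: zmult_eq_1_iff)
  then have "nu (T, S) = restr T (form L) \<or> nu (T, S) = - restr T (form L)" using m by auto
  then show ?thesis by (cases "nu (T, S) = restr T (form L)") (simp_all add: eps_def)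
qed

lemma nu_nonzero: 
  assumes S: "S \<in> K" "T \<subseteq> S" shows "nu (T, S) \<noteq> 0"
proof -
  obtain L where L: "distinct L" "set L = S - T"
    using finite_distinct_list[of "S - T"] finite_K_simplex[OF S(1)] by auto
  have "restr T (form L) \<noteq> 0" using form_coord_simplex[OF S L(1)] L(2) by auto
  then show ?thesis using nu_eps[OF S L] eps_sign[of "(T, S)" L] by (auto simp: sign_like_def)
qed

lemma nu_pow_cancel:
  assumes S: "S \<in> K" "T \<subseteq> S"
    and "\<nu> (cn T, cn S) [^]\<^bsub>ext_power (card (S - T)) (Q T)\<^esub> (s::int) = \<nu> (cn T, cn S) [^]\<^bsub>ext_power (card (S - T)) (Q T)\<^esub> (t::int)"
  shows "s = t"
proof -
  have "real_of_int s *\<^sub>R nu (T, S) = real_of_int t *\<^sub>R nu (T, S)"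
    using arg_cong[OF assms(3), of "val T"] val_int_pow[OF subset_K[OF S] nu_carrier[OF S]] by (simp add: nu_def)
  then show ?thesis using nu_nonzero[OF S] by simp
qed

text \<open>In top degree an element is determined by its value on the dual coordinates, so one
  evaluation identifies a wedge product with a power of the chosen generator.\<close>

lemma wedge_left_nu:
  assumes S: "S \<in> K" "T \<subseteq> S" and L: "distinct (i # L)" "set (i # L) = S - T"
    and X: "X \<in> ext_sub (length L) (Q T) (subl T S)" and n: "n \<in> zspan S"
    and eval: "val T (wedge_left (length L) (Q T) (cls T n) X) (map (coord (basis S)) (i # L)) = s"
    and t: "real_of_int t = s * eps (T, S) (i # L)"
  shows "wedge_left (length L) (Q T) (cls T n) X = \<nu> (cn T, cn S) [^]\<^bsub>ext_power (card (S - T)) (Q T)\<^esub> (t::int)"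
proof -
  have T: "T \<in> K" using S by (rule subset_K)
  have len: "Suc (length L) = card (S - T)" using distinct_card[OF L(1)] L(2) by simp
  interpret comm_group "ext_power (card (S - T)) (Q T)" by (rule comm_group_ext_power[OF monoid_Q[OF T]])
  have sub: "wedge_left (length L) (Q T) (cls T n) X \<in> ext_sub (length (i # L)) (Q T) (subl T S)"
    using wedge_left_ext_sub[OF T S(1) X n] by simp
  have "val T (wedge_left (length L) (Q T) (cls T n) X) = s *\<^sub>R restr T (form (i # L))"
    using val_top(1)[OF T S L sub] eval by simp
  also have "\<dots> = (s * eps (T, S) (i # L)) *\<^sub>R nu (T, S)"
    using nu_eps[OF S L] sign_like_square[OF eps_sign, of "(T, S)" "i # L"] by simp
  also have "\<dots> = val T (\<nu> (cn T, cn S) [^]\<^bsub>ext_power (card (S - T)) (Q T)\<^esub> t)"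
    using val_int_pow[OF T nu_carrier[OF S]] t by (simp add: nu_def)
  finally have eq: "val T (wedge_left (length L) (Q T) (cls T n) X) = val T (\<nu> (cn T, cn S) [^]\<^bsub>ext_power (card (S - T)) (Q T)\<^esub> t)" .
  have "wedge_left (length L) (Q T) (cls T n) X \<in> carrier (ext_power (card (S - T)) (Q T))"
    using sub ext_sub_carrier[OF T S(1), of "card (S - T)"] len by auto
  with inj_on_val[OF T] eq show ?thesis
    by (rule inj_onD) (rule int_pow_closed[OF nu_carrier[OF S]])
qed

text \<open>The coordinate of i kills the facet and takes the value 1 on any lift of the normal
  generator, so expanding the determinant leaves the sign \<open>eps\<close> of the facet;
  comparison with the enumeration i # L supplies the other factor.\<close>

lemma face_sign_up:
  assumes S: "S \<in> K" "T \<subseteq> S" and L: "distinct (i # L)" "set (i # L) = S - T"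
  shows "real_of_int (face_sign N \<nu> (cn T, cn (S - {i})) (cn T, cn S)) = eps (T, S - {i}) L * eps (T, S) (i # L)"
proof -
  let ?S = "S - {i}"
  have T: "T \<in> K" using S by (rule subset_K)
  have S': "?S \<in> K" "T \<subseteq> ?S" using subset_K[OF S(1)] S L by auto
  have L': "distinct L" "set L = ?S - T" and i: "i \<in> S" "i \<notin> T" "i \<notin> ?S" "i \<notin> set L" and iS: "insert i ?S = S"
    using L by auto
  have len: "length L = card (?S - T)" "Suc (card (?S - T)) = card (S - T)"
    using distinct_card[OF L'(1)] L'(2) distinct_card[OF L(1)] L(2) by auto
  obtain s where s: "s = 1 \<or> s = - 1" "real_of_int s = eps (T, ?S) L * eps (T, S) (i # L)"
    using sign_int[OF eps_sign eps_sign] by blast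
  have ng: "normal_gen N (cn ?S) (cn S) = cls ?S i"
    using normal_gen_cls[of i ?S] S(1) iS i by simp
  let ?D = "coord (basis S)"
  have main: "wedge_left (card (?S - T)) (Q T) (cls T n) (\<nu> (cn T, cn ?S)) =
      \<nu> (cn T, cn S) [^]\<^bsub>ext_power (card (S - T)) (Q T)\<^esub> s"
    if n: "n \<in> zspan S" "cls ?S n = cls ?S i" for n
  proof -
    have "val T (wedge_left (length L) (Q T) (cls T n) (\<nu> (cn T, cn ?S))) (map ?D (i # L)) = ?D i n * nu (T, ?S) (map ?D L)"
    proof -
      have "set (?D i # map ?D L) \<subseteq> functionals T"
        using S L' i by (auto intro!: coord_functional_simplex)
      moreover have "?D i y = 0" if "y \<in> zspan ?S" for y
        using functionals_span[OF coord_functional_simplex[OF S(1) _ i(3)]] zspan_subset_span that by blast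
      moreover have "n \<in> N" using n zspan_K[OF S(1)] by blast
      ultimately show ?thesis
        using val_wedge_left[OF T S'(1), of "\<nu> (cn T, cn ?S)" "length L" n "?D i" "map ?D L"] nu_ext_sub[OF S'] len
        by (simp add: nu_def)
    qed
    also have "?D i n = 1"
    proof -
      have "n - i \<in> span ?S" using n(2) zspan_subset_span by (auto simp: cls_eq_iff)
      then have "?D i (n - i) = 0"
        using functionals_span[OF coord_functional_simplex[OF S(1) _ i(3)]] by blast
      then show ?thesis
        using coord_simplex[OF S(1) i(1) i(1)] linear_coord[OF independent_basis[OF S(1)]] by (simp add: linear_diff)
    qed
    also have "nu (T, ?S) (map ?D L) = eps (T, ?S) L"
    proof -
      have "set L \<subseteq> S - T" using L'(2) by blast
      then show ?thesis using nu_eps[OF S' L'] form_coord_simplex[OF S L'(1)] by simp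
    qed
    finally show ?thesis
      using wedge_left_nu[OF S L _ n(1), of "\<nu> (cn T, cn ?S)" "eps (T, ?S) L" s] s(2)
        nu_ext_sub[OF S'] ext_sub_mono[OF T S(1), of ?S] len by auto
  qed
  have "face_sign N \<nu> (cn T, cn ?S) (cn T, cn S) = s"
    unfolding face_sign_def Let_def fst_conv snd_conv face_dim_cn[OF S'] rel_lattice_cls[OF T S(1)] ng len(2)
  proof (rule the_equality)
    show "s \<in> {1, - 1} \<and> (if cn T = cn T
         then \<forall>n\<in>subl T S. quot_proj N (cn ?S) n = cls ?S i \<longrightarrow>
                wedge_left (card (?S - T)) (Q T) n (\<nu> (cn T, cn ?S)) = \<nu> (cn T, cn S) [^]\<^bsub>ext_power (card (S - T)) (Q T)\<^esub> s
         else \<forall>\<nu>'\<in>ext_sub (card (?S - T)) (Q T) (subl T S).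
                ext_map (card (?S - T)) (Q T) (quot_proj N (cn T)) \<nu>' = \<nu> (cn T, cn ?S) \<longrightarrow>
                wedge_left (card (?S - T)) (Q T) (normal_gen N (cn T) (cn T)) \<nu>' = \<nu> (cn T, cn S) [^]\<^bsub>ext_power (card (S - T)) (Q T)\<^esub> - s)"
      using s(1) main by (auto simp: quot_proj_cls[OF S'])
  next
    fix t :: int
    assume "t \<in> {1, - 1} \<and> (if cn T = cn T
         then \<forall>n\<in>subl T S. quot_proj N (cn ?S) n = cls ?S i \<longrightarrow>
                wedge_left (card (?S - T)) (Q T) n (\<nu> (cn T, cn ?S)) = \<nu> (cn T, cn S) [^]\<^bsub>ext_power (card (S - T)) (Q T)\<^esub> t
         else \<forall>\<nu>'\<in>ext_sub (card (?S - T)) (Q T) (subl T S).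
                ext_map (card (?S - T)) (Q T) (quot_proj N (cn T)) \<nu>' = \<nu> (cn T, cn ?S) \<longrightarrow>
                wedge_left (card (?S - T)) (Q T) (normal_gen N (cn T) (cn T)) \<nu>' = \<nu> (cn T, cn S) [^]\<^bsub>ext_power (card (S - T)) (Q T)\<^esub> - t)"
    \<comment> \<open>The class of i is an admissible lift, so the condition is not void and
      determines the sign.\<close>
    then have "wedge_left (card (?S - T)) (Q T) (cls T i) (\<nu> (cn T, cn ?S)) = \<nu> (cn T, cn S) [^]\<^bsub>ext_power (card (S - T)) (Q T)\<^esub> t"
      using quot_proj_cls[OF S', of i] zspan_base[of i S] i(1) by simp
    then show "t = s"
      using main[of i] zspan_base[of i S] i(1) nu_pow_cancel[OF S] by metis
  qed
  then show ?thesis using s(2) by simp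
qed

text \<open>The coordinates along L kill i as well as T, so the value of the wedge product depends
  on the lift only through its projection, which is the generator of the face at infinity. The minus
  sign is the one in the definition of \<open>face_sign\<close>.\<close>

lemma face_sign_down:
  assumes S: "S \<in> K" "T \<subseteq> S" and L: "distinct (i # L)" "set (i # L) = S - T"
  shows "real_of_int (face_sign N \<nu> (cn (insert i T), cn S) (cn T, cn S)) = - (eps (insert i T, S) L * eps (T, S) (i # L))"
proof -
  let ?T = "insert i T"
  have T: "T \<in> K" using S by (rule subset_K)
  have S': "?T \<subseteq> S" using S L by auto
  have T': "?T \<in> K" by (rule subset_K[OF S(1) S'])
  have L': "distinct L" "set L = S - ?T" and i: "i \<in> S" "i \<notin> T" "i \<notin> set L" using L by auto
  have len: "length L = card (S - ?T)" "Suc (card (S - ?T)) = card (S - T)"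
    using distinct_card[OF L'(1)] L'(2) distinct_card[OF L(1)] L(2) by auto
  obtain s where s: "s = 1 \<or> s = - 1" "real_of_int s = eps (?T, S) L * eps (T, S) (i # L)"
    using sign_int[OF eps_sign eps_sign] by blast
  have ng: "normal_gen N (cn T) (cn ?T) = cls T i" using normal_gen_cls[OF T' i(2)] .
  let ?D = "coord (basis S)"
  let ?E = "ext_sub (card (S - ?T)) (Q T) (subl T S)"
  have iN: "i \<in> N" using zspan_base[of i S] zspan_K[OF S(1)] i(1) by blast
  have main: "wedge_left (card (S - ?T)) (Q T) (cls T i) \<nu>' = \<nu> (cn T, cn S) [^]\<^bsub>ext_power (card (S - T)) (Q T)\<^esub> s"
    if X: "\<nu>' \<in> ?E" and eq: "ext_map (card (S - ?T)) (Q ?T) (quot_proj N (cn ?T)) \<nu>' = \<nu> (cn ?T, cn S)" for \<nu>'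
  proof -
    have "set (?D i # map ?D L) \<subseteq> functionals T"
      using S L' i by (auto intro!: coord_functional_simplex)
    moreover have "\<forall>g\<in>set (map ?D L). g i = 0"
      using L' S i by (auto simp: coord_simplex)
    ultimately have "val T (wedge_left (length L) (Q T) (cls T i) \<nu>') (map ?D (i # L)) = ?D i i * val T \<nu>' (map ?D L)"
      using val_wedge_left[OF T S(1), of \<nu>' "length L" i "?D i" "map ?D L"] X iN len by simp
    also have "?D i i = 1" using coord_simplex[OF S(1) i(1) i(1)] by simp
    also have "val T \<nu>' (map ?D L) = restr ?T (val T \<nu>') (map ?D L)"
      using S' S L' by (auto simp: restr_def intro!: coord_functional_simplex)
    also have "restr ?T (val T \<nu>') = nu (?T, S)"
      using val_ext_map(1)[OF T T' subset_insertI subsetD[OF ext_sub_carrier[OF T S(1)] X]] eq by (simp add: nu_def)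
    also have "nu (?T, S) (map ?D L) = eps (?T, S) L"
      using nu_eps[OF S(1) S' L'] form_coord_simplex[OF S(1) S' L'(1)] L' by simp
    finally show ?thesis
      using wedge_left_nu[OF S L, of \<nu>' i "eps (?T, S) L" s] s(2) X zspan_base[of i S] i(1) len by simp
  qed
  \<comment> \<open>A lift has to be exhibited: without one, both signs would satisfy the condition
    and the description would not be unique.\<close>
  obtain \<nu>0 where \<nu>0: "\<nu>0 \<in> ?E" "ext_map (card (S - ?T)) (Q ?T) (quot_proj N (cn ?T)) \<nu>0 = \<nu> (cn ?T, cn S)"
  proof -
    have "restr T (form L) \<in> zspan {restr T (form xs) | xs. length xs = card (S - ?T) \<and> set xs \<subseteq> zspan S}"
      using L' len by (intro zspan_base) (auto intro: zspan_base)
    then have "eps (?T, S) L *\<^sub>R restr T (form L) \<in> zspan {restr T (form xs) | xs. length xs = card (S - ?T) \<and> set xs \<subseteq> zspan S}"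
      using eps_sign[of "(?T, S)" L] zspan_minus by (auto simp: sign_like_def)
    then obtain X where X: "X \<in> ?E" "val T X = eps (?T, S) L *\<^sub>R restr T (form L)"
      unfolding val_ext_sub[OF T S(1), symmetric] by (metis imageE)
    note XE = subsetD[OF ext_sub_carrier[OF T S(1)] X(1)]
    have "val ?T (ext_map (card (S - ?T)) (Q ?T) (quot_proj N (cn ?T)) X) = val ?T (\<nu> (cn ?T, cn S))"
      using val_ext_map(1)[OF T T' subset_insertI XE] nu_eps[OF S(1) S' L'] X(2)
      by (auto simp: nu_def linear_scale[OF linear_restr] restr_restr Un_commute)
    then have "ext_map (card (S - ?T)) (Q ?T) (quot_proj N (cn ?T)) X = \<nu> (cn ?T, cn S)"
      using inj_onD[OF inj_on_val[OF T']] val_ext_map(2)[OF T T' subset_insertI XE] nu_carrier[OF S(1) S'] by blast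
    then show ?thesis using that X(1) by blast
  qed
  have ne: "cn ?T \<noteq> cn T" using cn_eq_iff[OF T' T] i(2) by auto
  have "face_sign N \<nu> (cn ?T, cn S) (cn T, cn S) = - s"
    unfolding face_sign_def Let_def fst_conv snd_conv face_dim_cn[OF S(1) S'] rel_lattice_cls[OF T S(1)] ng len(2) if_not_P[OF ne]
  proof (rule the_equality)
    show "- s \<in> {1, - 1} \<and> (\<forall>\<nu>'\<in>?E. ext_map (card (S - ?T)) (Q ?T) (quot_proj N (cn ?T)) \<nu>' = \<nu> (cn ?T, cn S) \<longrightarrow>
        wedge_left (card (S - ?T)) (Q T) (cls T i) \<nu>' = \<nu> (cn T, cn S) [^]\<^bsub>ext_power (card (S - T)) (Q T)\<^esub> - (- s))"
      using s(1) main by auto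
  next
    fix t :: int
    assume "t \<in> {1, - 1} \<and> (\<forall>\<nu>'\<in>?E. ext_map (card (S - ?T)) (Q ?T) (quot_proj N (cn ?T)) \<nu>' = \<nu> (cn ?T, cn S) \<longrightarrow>
        wedge_left (card (S - ?T)) (Q T) (cls T i) \<nu>' = \<nu> (cn T, cn S) [^]\<^bsub>ext_power (card (S - T)) (Q T)\<^esub> - t)"
    then have "\<nu> (cn T, cn S) [^]\<^bsub>ext_power (card (S - T)) (Q T)\<^esub> - t = \<nu> (cn T, cn S) [^]\<^bsub>ext_power (card (S - T)) (Q T)\<^esub> s"
      using \<nu>0 main by metis
    from nu_pow_cancel[OF S this] show "t = - s" by simp
  qed
  then show ?thesis using s(2) by simp
qed

lemma sg_face_sign:
  assumes "real_of_int (face_sign N \<nu> (cn T', cn S') (cn T, cn S)) = a * b" "sign_like a" "sign_like b"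
  shows "sg (T', S') (T, S) = a * b" "real_of_int (face_sign N \<nu> (cn T', cn S') (cn T, cn S)) = sg (T', S') (T, S)"
  using assms by (auto simp: sg_def sign_like_def)

lemma oriented_lattice_complex: "oriented_lattice_complex N K nu eps sg"
proof unfold_locales
  show "sign_like (eps c L)" for c L by (rule eps_sign)
  show "sign_like (sg c d)" for c d by (simp add: sg_def sign_like_def)
  show "nu (T, S) = eps (T, S) L *\<^sub>R restr T (form L)"
    if "S \<in> K" "T \<subseteq> S" "distinct L" "set L = S - T" for S T L
    using that by (rule nu_eps)
  show "sg (T, S - {i}) (T, S) = eps (T, S - {i}) L * eps (T, S) (i # L)"
    if "S \<in> K" "T \<subseteq> S" "distinct (i # L)" "set (i # L) = S - T" for S T i L
    using sg_face_sign(1)[OF face_sign_up[OF that] eps_sign eps_sign] .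
  show "sg (insert i T, S) (T, S) = - (eps (insert i T, S) L * eps (T, S) (i # L))"
    if "S \<in> K" "T \<subseteq> S" "distinct (i # L)" "set (i # L) = S - T" for S T i L
    using sg_face_sign(1)[of "insert i T" S T S "- eps (insert i T, S) L"] face_sign_down[OF that] eps_sign[of _ L] eps_sign
    by (auto simp: sign_like_def)
qed

lemma face_sign_sg:
  assumes S: "S \<in> K" "T \<subseteq> S" and i: "i \<in> S - T"
  shows "real_of_int (face_sign N \<nu> (cn T, cn (S - {i})) (cn T, cn S)) = sg (T, S - {i}) (T, S)"
    and "real_of_int (face_sign N \<nu> (cn (insert i T), cn S) (cn T, cn S)) = sg (insert i T, S) (T, S)"
proof -
  obtain L where "distinct L" "set L = S - T - {i}"
    using finite_distinct_list[of "S - T - {i}"] finite_K_simplex[OF S(1)] by auto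
  then have L: "distinct (i # L)" "set (i # L) = S - T" using i by auto
  show "real_of_int (face_sign N \<nu> (cn T, cn (S - {i})) (cn T, cn S)) = sg (T, S - {i}) (T, S)"
    by (rule sg_face_sign(2)[OF face_sign_up[OF S L] eps_sign eps_sign])
  show "real_of_int (face_sign N \<nu> (cn (insert i T), cn S) (cn T, cn S)) = sg (insert i T, S) (T, S)"
    using sg_face_sign(2)[of "insert i T" S T S "- eps (insert i T, S) L" "eps (T, S) (i # L)"] face_sign_down[OF S L] eps_sign[of _ L] eps_sign
    by (auto simp: sign_like_def)
qed

end

section \<open>Tropical chains as chains of forms\<close>

locale tropical_fan = oriented_fan N K \<Delta> \<nu>
  for N :: "'v::real_vector set" and K \<Delta> \<nu> +
  fixes p :: nat

sublocale tropical_fan \<subseteq> oriented_lattice_complex N K p nu eps sg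
  by (rule oriented_lattice_complex)

context tropical_fan
begin

lemma cellD: "cell q T S \<Longrightarrow> S \<in> K" "cell q T S \<Longrightarrow> T \<subseteq> S" "cell q T S \<Longrightarrow> T \<in> K"
  using subset_K by (auto simp: cell_def)

lemma faces_eq: "faces \<Delta> q = {(cn T, cn S) | T S. cell q T S}"
proof -
  have dim: "int (face_dim (cn T, cn S)) = q \<longleftrightarrow> cell q T S" if "S \<in> K" "T \<subseteq> S" for T S
  proof -
    have "card S = card (S - T) + card T"
      using that finite_K_simplex[OF that(1)] card_Diff_subset[of T S] card_mono[of S T] finite_subset[of T S] by simp
    then show ?thesis using that by (auto simp: face_dim_cn cell_def)
  qed
  show ?thesis
  proof (intro equalityI subsetI)
    fix x assume "x \<in> faces \<Delta> q"
    then obtain T S where "x = (cn T, cn S)" "T \<in> K" "S \<in> K" "T \<subseteq> S" "int (face_dim (cn T, cn S)) = q"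
      by (auto simp: faces_def fan_eq cn_face_iff)
    then show "x \<in> {(cn T, cn S) | T S. cell q T S}" using dim by blast
  next
    fix x assume "x \<in> {(cn T, cn S) | T S. cell q T S}"
    then obtain T S where x: "x = (cn T, cn S)" "cell q T S" by blast
    have "int (face_dim (cn T, cn S)) = q" using dim cellD[OF x(2)] x(2) by blast
    then show "x \<in> faces \<Delta> q" using x(1) cellD[OF x(2)] by (simp add: faces_def fan_eq cn_face_iff)
  qed
qed

lemma cell_face: "cell q T S \<Longrightarrow> (cn T, cn S) \<in> faces \<Delta> q"
  unfolding faces_eq by blast

lemma finite_faces: "finite (faces \<Delta> q)"
proof (rule finite_subset)
  show "faces \<Delta> q \<subseteq> \<Delta> \<times> \<Delta>" by (auto simp: faces_def)
  show "finite (\<Delta> \<times> \<Delta>)" using finite_K by (simp add: fan_eq)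
qed

abbreviation coeff :: "'v set \<Rightarrow> 'v set \<Rightarrow> 'v set ext monoid" where
  "coeff T S \<equiv> trop_coeff N \<Delta> p (cn T, cn S)"

context
  fixes T S :: "'v set"
  assumes S: "S \<in> K" "T \<subseteq> S"
begin

lemma T_K: "T \<in> K"
  using S by (rule subset_K)

lemma coeff_eq:
  "coeff T S = subgroup_generated (ext_power p (Q T)) (\<Union>E\<in>{E \<in> K. S \<subseteq> E}. ext_sub p (Q T) (subl T E))"
proof -
  have "{\<eta> \<in> \<Delta>. cn S \<preceq>\<^sub>c \<eta>} = cn ` {E \<in> K. S \<subseteq> E}"
    using S(1) by (auto simp: fan_eq cn_face_iff)
  then have "(\<Union>\<eta>\<in>{\<eta> \<in> \<Delta>. cn S \<preceq>\<^sub>c \<eta>}. ext_sub p (Q T) (rel_lattice N (cn T) \<eta>)) =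
      (\<Union>E\<in>{E \<in> K. S \<subseteq> E}. ext_sub p (Q T) (subl T E))"
    by (simp add: rel_lattice_cls[OF T_K])
  then show ?thesis by (simp add: trop_coeff_def)
qed

lemma coeff_generators_carrier:
  "(\<Union>E\<in>{E \<in> K. S \<subseteq> E}. ext_sub p (Q T) (subl T E)) \<subseteq> carrier (ext_power p (Q T))"
  using ext_sub_carrier[OF T_K] by blast

lemma comm_group_coeff: "comm_group (coeff T S)"
  unfolding coeff_eq
  using comm_group_ext_power[OF monoid_Q[OF T_K]] by (simp add: group.abelian_subgroup_generated comm_group.axioms(2))

lemma carrier_coeff_subset: "carrier (coeff T S) \<subseteq> carrier (ext_power p (Q T))"
  unfolding coeff_eq
  using comm_group_ext_power[OF monoid_Q[OF T_K]] by (simp add: group.carrier_subgroup_generated_subset comm_group.axioms(2))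

lemma mult_coeff: "mult (coeff T S) = mult (ext_power p (Q T))"
  by (simp add: coeff_eq)

lemma val_mult_coeff:
  "X \<in> carrier (coeff T S) \<Longrightarrow> Y \<in> carrier (coeff T S) \<Longrightarrow> val T (X \<otimes>\<^bsub>coeff T S\<^esub> Y) = val T X + val T Y"
  unfolding mult_coeff using carrier_coeff_subset val_mult[OF T_K] by blast

text \<open>The subgroup generated by the images for all cones E above S becomes the integer span of
  their forms, and restriction, being additive, commutes with taking that span.\<close>

lemma val_coeff: "val T ` carrier (coeff T S) = restr T ` V p S"
proof -
  let ?U = "\<Union>E\<in>{E \<in> K. S \<subseteq> E}. ext_sub p (Q T) (subl T E)"
  interpret comm_group "ext_power p (Q T)" by (rule comm_group_ext_power[OF monoid_Q[OF T_K]])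
  have "carrier (coeff T S) = generate (ext_power p (Q T)) ?U"
    unfolding coeff_eq carrier_subgroup_generated using coeff_generators_carrier by (simp add: Int_absorb1)
  then have "val T ` carrier (coeff T S) = zspan (val T ` ?U)"
    using additive_generate[OF val_mult[OF T_K] coeff_generators_carrier] by simp
  also have "val T ` ?U = (\<Union>E\<in>{E \<in> K. S \<subseteq> E}. zspan {restr T (form xs) | xs. length xs = p \<and> set xs \<subseteq> zspan E})"
    by (simp add: image_UN val_ext_sub[OF T_K])
  also have "zspan \<dots> = zspan (\<Union>E\<in>{E \<in> K. S \<subseteq> E}. {restr T (form xs) | xs. length xs = p \<and> set xs \<subseteq> zspan E})"
    by (rule zspan_Union)
  also have "(\<Union>E\<in>{E \<in> K. S \<subseteq> E}. {restr T (form xs) | xs. length xs = p \<and> set xs \<subseteq> zspan E}) =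
      restr T ` {form xs | xs. length xs = p \<and> (\<exists>E\<in>K. S \<subseteq> E \<and> set xs \<subseteq> zspan E)}"
    by blast
  also have "zspan \<dots> = restr T ` V p S"
    unfolding V_def by (rule zspan_image[symmetric]) (rule restr_add)
  finally show ?thesis .
qed

lemma inj_on_val_coeff: "inj_on (val T) (carrier (coeff T S))"
  using inj_on_subset[OF inj_on_val[OF T_K] carrier_coeff_subset] .

text \<open>As \<open>val\<close> is injective on the whole exterior power, an element with the same
  value as an element of the subgroup coincides with it.\<close>

lemma coeff_memI:
  assumes "X \<in> carrier (ext_power p (Q T))" "val T X \<in> restr T ` V p S"
  shows "X \<in> carrier (coeff T S)"
proof -
  obtain Y where Y: "Y \<in> carrier (coeff T S)" "val T X = val T Y"
    using assms(2) unfolding val_coeff[symmetric] by blast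
  have "Y \<in> carrier (ext_power p (Q T))" using carrier_coeff_subset Y(1) by (rule subsetD)
  with inj_on_val[OF T_K] Y(2) assms(1) have "X = Y" by (rule inj_onD)
  then show ?thesis using Y by simp
qed

lemma val_one_coeff: "val T \<one>\<^bsub>coeff T S\<^esub> = 0"
  by (simp add: coeff_eq val_one[OF T_K])

lemma val_int_pow_coeff:
  assumes "X \<in> carrier (coeff T S)"
  shows "val T (X [^]\<^bsub>coeff T S\<^esub> (k::int)) = real_of_int k *\<^sub>R val T X"
proof -
  interpret comm_group "coeff T S" by (rule comm_group_coeff)
  show ?thesis by (rule additive_int_pow[OF val_mult_coeff assms])
qed

end

section \<open>Transport of tropical chains and their boundary to forms\<close>

lemma facesE:
  assumes "\<delta> \<in> faces \<Delta> q" obtains T S where "\<delta> = (cn T, cn S)" "cell q T S"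
  using assms unfolding faces_eq by blast

lemma trop_coeff_group: "\<delta> \<in> faces \<Delta> q \<Longrightarrow> comm_group (trop_coeff N \<Delta> p \<delta>)"
  by (erule facesE) (simp add: comm_group_coeff cellD)

definition real_chain :: "int \<Rightarrow> ('v face \<Rightarrow> 'v set ext) \<Rightarrow> 'v set \<times> 'v set \<Rightarrow> ('v \<Rightarrow> real) list \<Rightarrow> real" where
  "real_chain q c = (\<lambda>(T, S). if cell q T S then val T (c (cn T, cn S)) else 0)"

abbreviation C :: "int \<Rightarrow> ('v face \<Rightarrow> 'v set ext) monoid" where
  "C q \<equiv> trop_chains N \<Delta> p q"

lemma carrier_C: "carrier (C q) = (\<Pi>\<^sub>E \<delta>\<in>faces \<Delta> q. carrier (trop_coeff N \<Delta> p \<delta>))"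
  unfolding trop_chains_def
  using trop_coeff_group[THEN comm_group.axioms(2)] finite_faces[of q] by (subst carrier_sum_group) auto

lemma group_C: "group (C q)"
  unfolding trop_chains_def using trop_coeff_group[THEN comm_group.axioms(2)] by (intro sum_group)

lemma C_coeff: "c \<in> carrier (C q) \<Longrightarrow> cell q T S \<Longrightarrow> c (cn T, cn S) \<in> carrier (coeff T S)"
  unfolding carrier_C by (erule PiE_mem) (rule cell_face)

lemma real_chain_chains: "c \<in> carrier (C q) \<Longrightarrow> real_chain q c \<in> chains q"
proof (rule chainsI)
  fix T S assume c: "c \<in> carrier (C q)" and TS: "cell q T S"
  show "real_chain q c (T, S) \<in> restr T ` V p S"
    using C_coeff[OF c TS] val_coeff[OF cellD(1,2)[OF TS]] TS by (auto simp: real_chain_def)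
qed (auto simp: real_chain_def)

lemma real_chain_mult:
  assumes "c \<in> carrier (C q)" "d \<in> carrier (C q)"
  shows "real_chain q (c \<otimes>\<^bsub>C q\<^esub> d) x = real_chain q c x + real_chain q d x"
proof -
  obtain T S where x: "x = (T, S)" by (cases x)
  show ?thesis
    using val_mult_coeff[OF cellD(1,2) C_coeff[OF assms(1)] C_coeff[OF assms(2)]] cell_face
    by (auto simp: x real_chain_def trop_chains_def)
qed

lemma real_chain_inj:
  assumes "c \<in> carrier (C q)" "d \<in> carrier (C q)" "\<And>x. real_chain q c x = real_chain q d x"
  shows "c = d"
proof (rule PiE_ext[OF assms(1,2)[unfolded carrier_C]])
  fix \<delta> assume "\<delta> \<in> faces \<Delta> q"
  then obtain T S where TS: "\<delta> = (cn T, cn S)" "cell q T S" unfolding faces_eq by blast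
  have "val T (c \<delta>) = val T (d \<delta>)" using assms(3)[of "(T, S)"] TS by (simp add: real_chain_def)
  then show "c \<delta> = d \<delta>"
    using inj_onD[OF inj_on_val_coeff[OF cellD(1,2)[OF TS(2)]]] C_coeff[OF assms(1) TS(2)] C_coeff[OF assms(2) TS(2)] TS(1) by blast
qed

text \<open>Preimages are chosen face by face; this is consistent because a face determines T and S,
  cones being determined by their generators and conversely.\<close>

lemma real_chain_surj:
  assumes "b \<in> chains q"
  obtains c where "c \<in> carrier (C q)" "real_chain q c = b"
proof -
  have "\<exists>X. X \<in> carrier (trop_coeff N \<Delta> p \<delta>) \<and> (\<forall>T S. cell q T S \<longrightarrow> \<delta> = (cn T, cn S) \<longrightarrow> val T X = b (T, S))"
    if \<delta>: "\<delta> \<in> faces \<Delta> q" for \<delta>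
  proof -
    obtain T S where TS: "\<delta> = (cn T, cn S)" "cell q T S" using \<delta>[unfolded faces_eq] by blast
    have "b (T, S) \<in> val T ` carrier (coeff T S)"
      using chains_cell[OF assms TS(2)] val_coeff[OF cellD(1,2)[OF TS(2)]] by simp
    then obtain X where X: "X \<in> carrier (coeff T S)" "val T X = b (T, S)" by (metis imageE)
    have "T' = T \<and> S' = S" if "cell q T' S'" "\<delta> = (cn T', cn S')" for T' S'
      using that TS cellD cn_eq_iff by (metis prod.inject)
    then show ?thesis using X TS(1) by blast
  qed
  then obtain h where h: "\<And>\<delta>. \<delta> \<in> faces \<Delta> q \<Longrightarrow> h \<delta> \<in> carrier (trop_coeff N \<Delta> p \<delta>)"
    "\<And>\<delta> T S. \<delta> \<in> faces \<Delta> q \<Longrightarrow> cell q T S \<Longrightarrow> \<delta> = (cn T, cn S) \<Longrightarrow> val T (h \<delta>) = b (T, S)"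
    by metis
  have "restrict h (faces \<Delta> q) \<in> carrier (C q)" using h(1) by (simp add: carrier_C)
  moreover have "real_chain q (restrict h (faces \<Delta> q)) = b"
  proof
    fix x :: "'v set \<times> 'v set" obtain T S where x: "x = (T, S)" by (cases x)
    show "real_chain q (restrict h (faces \<Delta> q)) x = b x"
      using h(2)[OF cell_face] cell_face chains_not_cell[OF assms] by (auto simp: x real_chain_def)
  qed
  ultimately show ?thesis using that by blast
qed

text \<open>Commutativity is read off after transport to functions, where the operation is
  addition.\<close>

lemma comm_group_C: "comm_group (C q)"
proof -
  interpret group "C q" by (rule group_C)
  show ?thesis
  proof (rule group_comm_groupI)
    fix x y assume "x \<in> carrier (C q)" "y \<in> carrier (C q)"
    then show "x \<otimes>\<^bsub>C q\<^esub> y = y \<otimes>\<^bsub>C q\<^esub> x"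
      by (intro real_chain_inj[of _ q]) (auto simp: real_chain_mult add.commute)
  qed
qed

lemma real_chain_one: "real_chain q \<one>\<^bsub>C q\<^esub> x = 0"
proof -
  obtain T S where x: "x = (T, S)" by (cases x)
  show ?thesis using cell_face val_one_coeff[OF cellD(1,2)] by (auto simp: x real_chain_def trop_chains_def)
qed

abbreviation D :: "int \<Rightarrow> ('v face \<Rightarrow> 'v set ext) \<Rightarrow> 'v face \<Rightarrow> 'v set ext" where
  "D q \<equiv> trop_boundary N \<Delta> \<nu> p q"

lemma cell_up: "cell (q - 1) T S \<Longrightarrow> i \<in> link S \<Longrightarrow> cell q T (insert i S)"
  using finite_K_simplex[of S] by (auto simp: cell_def link_def)

lemma cell_down:
  assumes "cell (q - 1) T S" "i \<in> T" shows "cell q (T - {i}) S"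
proof -
  have "card T = Suc (card (T - {i}))"
    using finite_K_simplex[OF cellD(3)[OF assms(1)]] assms(2) by (rule card.remove)
  moreover have "T - {i} \<subseteq> S" using cellD(2)[OF assms(1)] by blast
  ultimately show ?thesis using assms(1) by (simp only: cell_def) simp
qed

text \<open>A coface raises the dimension by one, so exactly one of the inclusions of T' in T and of
  S in S' is proper, and by one element.\<close>

lemma cofaces:
  assumes TS: "cell (q - 1) T S"
  shows "{\<delta> \<in> faces \<Delta> q. subface (cn T, cn S) \<delta>} =
    (\<lambda>i. (cn T, cn (insert i S))) ` link S \<union> (\<lambda>i. (cn (T - {i}), cn S)) ` T"
proof (intro equalityI subsetI)
  note S = cellD[OF TS]
  fix \<delta> assume "\<delta> \<in> {\<delta> \<in> faces \<Delta> q. subface (cn T, cn S) \<delta>}"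
  then obtain T' S' where \<delta>: "\<delta> = (cn T', cn S')" "cell q T' S'" "subface (cn T, cn S) (cn T', cn S')"
    unfolding faces_eq by blast
  note S' = cellD[OF \<delta>(2)]
  have sub: "T' \<subseteq> T" "S \<subseteq> S'" using \<delta>(3) S S' by (auto simp: subface_def cn_face_iff)
  have fin: "finite S'" "finite T" using finite_K_simplex S' S by auto
  have "int (card S) + int (card T') + 1 = int (card S') + int (card T)"
    using TS \<delta>(2) by (auto simp: cell_def)
  moreover have "card T' \<le> card T" "card S \<le> card S'" using sub fin by (auto intro: card_mono)
  ultimately consider "card S' = card S" "card T = Suc (card T')" | "card S' = Suc (card S)" "card T = card T'"
    by linarith
  then show "\<delta> \<in> (\<lambda>i. (cn T, cn (insert i S))) ` link S \<union> (\<lambda>i. (cn (T - {i}), cn S)) ` T"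
  proof cases
    case 1
    then have "S = S'" using sub fin card_subset_eq by metis
    have "finite T'" using sub(1) fin(2) by (rule finite_subset)
    then have "card (T - T') = 1" using 1 sub by (simp add: card_Diff_subset)
    then obtain i where "T - T' = {i}" using card_1_singletonE by blast
    then have "i \<in> T" "T' = T - {i}" using sub by auto
    then show ?thesis using \<open>S = S'\<close> \<delta>(1) by blast
  next
    case 2
    then have "T' = T" using sub fin card_subset_eq by metis
    have "finite S" using sub(2) fin(1) by (rule finite_subset)
    then have "card (S' - S) = 1" using 2 sub by (simp add: card_Diff_subset)
    then obtain i where i: "S' - S = {i}" using card_1_singletonE by blast
    then have "insert i S = S'" "i \<notin> S" using sub by auto
    then have "i \<in> link S" using S' by (simp add: link_def)
    then show ?thesis using \<open>T' = T\<close> \<open>insert i S = S'\<close> \<delta>(1) by blast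
  qed
next
  note S = cellD[OF TS]
  have fin: "finite S" "finite T" using finite_K_simplex S by auto
  fix \<delta> assume "\<delta> \<in> (\<lambda>i. (cn T, cn (insert i S))) ` link S \<union> (\<lambda>i. (cn (T - {i}), cn S)) ` T"
  then show "\<delta> \<in> {\<delta> \<in> faces \<Delta> q. subface (cn T, cn S) \<delta>}"
  proof
    assume "\<delta> \<in> (\<lambda>i. (cn T, cn (insert i S))) ` link S"
    then obtain i where i: "i \<in> link S" "\<delta> = (cn T, cn (insert i S))" by blast
    then have "insert i S \<in> K" "i \<notin> S" by (auto simp: link_def)
    then have "cell q T (insert i S)" using cell_up[OF TS i(1)] by simp
    then show ?thesis using i(2) S \<open>insert i S \<in> K\<close> by (auto simp: cell_face subface_def cn_face_iff)
  next
    assume "\<delta> \<in> (\<lambda>i. (cn (T - {i}), cn S)) ` T"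
    then obtain i where i: "i \<in> T" "\<delta> = (cn (T - {i}), cn S)" by blast
    have "T - {i} \<in> K" using subset_K[OF S(3)] by blast
    moreover have "cell q (T - {i}) S" using TS i(1) by (rule cell_down)
    ultimately show ?thesis using i(2) S by (auto simp: cell_face subface_def cn_face_iff)
  qed
qed

text \<open>The projected value lies in the coefficient group of the target because the cones above
  S' are among those above S. The integer exponent k becomes the real scalar s.\<close>

lemma boundary_term:
  assumes c: "c \<in> carrier (C q)" and TS: "S \<in> K" "T \<subseteq> S" and T'S': "cell q T' S'" "T' \<subseteq> T" "S \<subseteq> S'"
    and sign: "real_of_int k = s" "sign_like s"
  defines "X \<equiv> ext_map p (Q T) (quot_proj N (cn T)) (c (cn T', cn S')) [^]\<^bsub>coeff T S\<^esub> (k::int)"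
  shows "X \<in> carrier (coeff T S)" "val T X = s *\<^sub>R restr T (real_chain q c (T', S'))"
proof -
  interpret comm_group "coeff T S" by (rule comm_group_coeff[OF TS])
  have T: "T \<in> K" using TS by (rule subset_K)
  let ?Y = "ext_map p (Q T) (quot_proj N (cn T)) (c (cn T', cn S'))"
  note T' = cellD[OF T'S'(1)]
  have cc: "c (cn T', cn S') \<in> carrier (coeff T' S')" by (rule C_coeff[OF c T'S'(1)])
  then have ce: "c (cn T', cn S') \<in> carrier (ext_power p (Q T'))" using carrier_coeff_subset[OF T'(1,2)] by blast
  have val: "val T ?Y = restr T (val T' (c (cn T', cn S')))"
    by (rule val_ext_map(1)[OF T'(3) T T'S'(2) ce])
  have "?Y \<in> carrier (coeff T S)"
  proof (rule coeff_memI[OF TS])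
    show "?Y \<in> carrier (ext_power p (Q T))" by (rule val_ext_map(2)[OF T'(3) T T'S'(2) ce])
    obtain a where a: "a \<in> V p S'" "val T' (c (cn T', cn S')) = restr T' a"
      using cc val_coeff[OF T'(1,2)] by blast
    then have "val T ?Y = restr T a" using val T'S'(2) by (simp add: restr_restr Un_absorb2)
    then show "val T ?Y \<in> restr T ` V p S" using a(1) V_antimono[OF T'(1) T'S'(3)] by blast
  qed
  then show "X \<in> carrier (coeff T S)" "val T X = s *\<^sub>R restr T (real_chain q c (T', S'))"
    using val_int_pow_coeff[OF TS, of ?Y k] val T'S'(1) sign(1) by (auto simp: X_def real_chain_def)
qed

lemma val_boundary:
  assumes c: "c \<in> carrier (C q)" and TS: "cell (q - 1) T S"
  shows "D q c (cn T, cn S) \<in> carrier (coeff T S)"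
    and "val T (D q c (cn T, cn S)) = boundary (real_chain q c) (T, S)"
proof -
  note S = cellD[OF TS]
  interpret comm_group "coeff T S" by (rule comm_group_coeff[OF S(1,2)])
  let ?f = "\<lambda>\<delta>. ext_map p (Q T) (quot_proj N (cn T)) (c \<delta>) [^]\<^bsub>coeff T S\<^esub> face_sign N \<nu> (cn T, cn S) \<delta>"
  let ?A = "(\<lambda>i. (cn T, cn (insert i S))) ` link S" and ?B = "(\<lambda>i. (cn (T - {i}), cn S)) ` T"
  have fin: "finite S" "finite T" using finite_K_simplex S by auto
  have D: "D q c (cn T, cn S) = finprod (coeff T S) ?f (?A \<union> ?B)"
    using cell_face[OF TS] by (simp add: trop_boundary_def cofaces[OF TS])
  have up: "?f (cn T, cn (insert i S)) \<in> carrier (coeff T S)"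
    "val T (?f (cn T, cn (insert i S))) = sg (T, S) (T, insert i S) *\<^sub>R real_chain q c (T, insert i S)"
    if i: "i \<in> link S" for i
  proof -
    have iS: "insert i S \<in> K" "i \<notin> S" using i by (auto simp: link_def)
    have sign: "real_of_int (face_sign N \<nu> (cn T, cn S) (cn T, cn (insert i S))) = sg (T, S) (T, insert i S)"
      using face_sign_sg(1)[OF iS(1), of T i] iS(2) S by auto
    note t = boundary_term[OF c S(1,2) cell_up[OF TS i] subset_refl subset_insertI sign sg_sign]
    show "?f (cn T, cn (insert i S)) \<in> carrier (coeff T S)" by (rule t(1))
    \<comment> \<open>With tau unchanged the projection is the identity on these values, which is
      why \<open>boundary\<close> has no restriction in its first sum.\<close>
    have "restr T (real_chain q c (T, insert i S)) = real_chain q c (T, insert i S)"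
      using res_image_V chains_image[OF real_chain_chains[OF c] iS(1)] by blast
    then show "val T (?f (cn T, cn (insert i S))) = sg (T, S) (T, insert i S) *\<^sub>R real_chain q c (T, insert i S)"
      using t(2) by simp
  qed
  have down: "?f (cn (T - {i}), cn S) \<in> carrier (coeff T S)"
    "val T (?f (cn (T - {i}), cn S)) = sg (T, S) (T - {i}, S) *\<^sub>R restr T (real_chain q c (T - {i}, S))"
    if i: "i \<in> T" for i
  proof -
    have "insert i (T - {i}) = T" using i by blast
    then have sign: "real_of_int (face_sign N \<nu> (cn T, cn S) (cn (T - {i}), cn S)) = sg (T, S) (T - {i}, S)"
      using face_sign_sg(2)[OF S(1), of "T - {i}" i] S(2) i by auto
    note t = boundary_term[OF c S(1,2) cell_down[OF TS i] Diff_subset subset_refl sign sg_sign]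
    show "?f (cn (T - {i}), cn S) \<in> carrier (coeff T S)"
      "val T (?f (cn (T - {i}), cn S)) = sg (T, S) (T - {i}, S) *\<^sub>R restr T (real_chain q c (T - {i}, S))"
      by (rule t)+
  qed
  have closed: "?f \<in> ?A \<union> ?B \<rightarrow> carrier (coeff T S)" using up(1) down(1) by auto
  show "D q c (cn T, cn S) \<in> carrier (coeff T S)"
    unfolding D using closed by (rule finprod_closed)
  have K: "insert i S \<in> K" "i \<notin> S" if "i \<in> link S" for i using that by (auto simp: link_def)
  have KT: "T - {i} \<in> K" for i using subset_K[OF S(3)] by blast
  have "val T (D q c (cn T, cn S)) = (\<Sum>\<delta>\<in>?A \<union> ?B. val T (?f \<delta>))"
    unfolding D by (rule additive_finprod[OF val_mult_coeff[OF S(1,2)] closed])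
  also have "\<dots> = (\<Sum>\<delta>\<in>?A. val T (?f \<delta>)) + (\<Sum>\<delta>\<in>?B. val T (?f \<delta>))"
  proof (rule sum.union_disjoint)
    show "?A \<inter> ?B = {}"
    proof (rule ccontr)
      assume "?A \<inter> ?B \<noteq> {}"
      then obtain i j where "i \<in> link S" "cn (insert i S) = cn S" by blast
      then show False using cn_eq_iff[OF K(1) S(1)] K(2) by blast
    qed
  qed (use finite_link fin in auto)
  finally have eq: "val T (D q c (cn T, cn S)) = (\<Sum>\<delta>\<in>?A. val T (?f \<delta>)) + (\<Sum>\<delta>\<in>?B. val T (?f \<delta>))" .
  have sum_A: "(\<Sum>\<delta>\<in>?A. val T (?f \<delta>)) = (\<Sum>i\<in>link S. sg (T, S) (T, insert i S) *\<^sub>R real_chain q c (T, insert i S))"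
  proof (subst sum.reindex)
    show "inj_on (\<lambda>i. (cn T, cn (insert i S))) (link S)"
    proof (rule inj_onI)
      fix i j assume ij: "i \<in> link S" "j \<in> link S" "(cn T, cn (insert i S)) = (cn T, cn (insert j S))"
      then have "insert i S = insert j S" using cn_eq_iff[OF K(1) K(1)] by blast
      then show "i = j" using K(2) ij by blast
    qed
  qed (simp add: up(2))
  have sum_B: "(\<Sum>\<delta>\<in>?B. val T (?f \<delta>)) = (\<Sum>i\<in>T. sg (T, S) (T - {i}, S) *\<^sub>R restr T (real_chain q c (T - {i}, S)))"
  proof (subst sum.reindex)
    show "inj_on (\<lambda>i. (cn (T - {i}), cn S)) T"
    proof (rule inj_onI)
      fix i j assume ij: "i \<in> T" "j \<in> T" "(cn (T - {i}), cn S) = (cn (T - {j}), cn S)"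
      then have "T - {i} = T - {j}" using cn_eq_iff[OF KT KT] by blast
      then show "i = j" using ij by blast
    qed
  qed (simp add: down(2))
  show "val T (D q c (cn T, cn S)) = boundary (real_chain q c) (T, S)"
    unfolding eq sum_A sum_B using S(1,2) by (simp add: boundary_def)
qed

lemma D_closed: "c \<in> carrier (C q) \<Longrightarrow> D q c \<in> carrier (C (q - 1))"
  unfolding carrier_C[of "q - 1"]
proof (rule PiE_I)
  fix \<gamma> assume c: "c \<in> carrier (C q)" and \<gamma>: "\<gamma> \<in> faces \<Delta> (q - 1)"
  from \<gamma> obtain T S where "\<gamma> = (cn T, cn S)" "cell (q - 1) T S" by (rule facesE)
  then show "D q c \<gamma> \<in> carrier (trop_coeff N \<Delta> p \<gamma>)"
    using val_boundary(1)[OF c] by simp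
qed (simp add: trop_boundary_def)

lemma real_chain_D:
  assumes "c \<in> carrier (C q)"
  shows "real_chain (q - 1) (D q c) = boundary (real_chain q c)"
proof
  fix x :: "'v set \<times> 'v set" obtain T S where x: "x = (T, S)" by (cases x)
  show "real_chain (q - 1) (D q c) x = boundary (real_chain q c) x"
    using val_boundary(2)[OF assms] chains_not_cell[OF boundary_chains[OF real_chain_chains[OF assms]]]
    by (auto simp: x real_chain_def[of "q - 1"])
qed

lemma D_hom: "group_hom (C q) (C (q - 1)) (D q)"
proof (intro group_hom.intro group_hom_axioms.intro homI group_C)
  show "D q c \<in> carrier (C (q - 1))" if "c \<in> carrier (C q)" for c using that by (rule D_closed)
  fix c d assume cd: "c \<in> carrier (C q)" "d \<in> carrier (C q)"
  interpret group "C q" by (rule group_C)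
  interpret G: group "C (q - 1)" by (rule group_C)
  have eq: "real_chain q (c \<otimes>\<^bsub>C q\<^esub> d) = (\<lambda>x. real_chain q c x + real_chain q d x)"
    using real_chain_mult[OF cd] by (rule ext)
  show "D q (c \<otimes>\<^bsub>C q\<^esub> d) = D q c \<otimes>\<^bsub>C (q - 1)\<^esub> D q d"
    by (rule real_chain_inj[of _ "q - 1"])
       (use cd D_closed in \<open>auto simp: real_chain_D real_chain_mult eq boundary_add\<close>)
qed

section \<open>Homology\<close>

abbreviation Z :: "int \<Rightarrow> ('v face \<Rightarrow> 'v set ext) monoid" where
  "Z q \<equiv> trop_cycles N \<Delta> \<nu> p q"

abbreviation B :: "int \<Rightarrow> ('v face \<Rightarrow> 'v set ext) set" where
  "B q \<equiv> trop_boundaries N \<Delta> \<nu> p q"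

lemma carrier_Z: "carrier (Z q) = {c \<in> carrier (C q). \<forall>x. boundary (real_chain q c) x = 0}"
proof -
  have "D q c = \<one>\<^bsub>C (q - 1)\<^esub> \<longleftrightarrow> (\<forall>x. boundary (real_chain q c) x = 0)" if c: "c \<in> carrier (C q)" for c
  proof
    assume "D q c = \<one>\<^bsub>C (q - 1)\<^esub>"
    then show "\<forall>x. boundary (real_chain q c) x = 0"
      using real_chain_D[OF c] real_chain_one[of "q - 1"] by metis
  next
    interpret group "C (q - 1)" by (rule group_C)
    assume "\<forall>x. boundary (real_chain q c) x = 0"
    then show "D q c = \<one>\<^bsub>C (q - 1)\<^esub>"
      using D_closed[OF c] by (intro real_chain_inj[of _ "q - 1"]) (auto simp: real_chain_D[OF c] real_chain_one)
  qed
  then show ?thesis by (auto simp: trop_cycles_def kernel_def)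
qed

text \<open>Every chain of forms comes from a tropical chain and \<open>real_chain\<close> is
  injective, so boundaries can be recognised among functions.\<close>

lemma B_eq: "B q = {c \<in> carrier (C q). \<exists>b\<in>chains (q + 1). boundary b = real_chain q c}"
proof (intro equalityI subsetI)
  fix c assume "c \<in> B q"
  then obtain b where b: "b \<in> carrier (C (q + 1))" "c = D (q + 1) b" by (auto simp: trop_boundaries_def)
  then show "c \<in> {c \<in> carrier (C q). \<exists>b\<in>chains (q + 1). boundary b = real_chain q c}"
    using D_closed[OF b(1)] real_chain_D[OF b(1)] real_chain_chains[OF b(1)] by auto
next
  fix c assume "c \<in> {c \<in> carrier (C q). \<exists>b\<in>chains (q + 1). boundary b = real_chain q c}"
  then obtain b where c: "c \<in> carrier (C q)" and b: "b \<in> chains (q + 1)" "boundary b = real_chain q c" by blast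
  obtain b' where b': "b' \<in> carrier (C (q + 1))" "real_chain (q + 1) b' = b" by (rule real_chain_surj[OF b(1)])
  have "c = D (q + 1) b'"
    using D_closed[OF b'(1)] real_chain_D[OF b'(1)] b(2) b'(2) c by (intro real_chain_inj[of _ q]) auto
  then show "c \<in> B q" using b'(1) by (auto simp: trop_boundaries_def)
qed

lemma subgroup_Z: "subgroup (carrier (Z q)) (C q)"
  using group_hom.subgroup_kernel[OF D_hom] by (simp add: trop_cycles_def)

lemma mult_Z: "mult (Z q) = mult (C q)"
  by (simp add: trop_cycles_def)

lemma comm_group_Z: "comm_group (Z q)"
proof -
  have "Z q = (C q)\<lparr>carrier := carrier (Z q)\<rparr>" by (simp add: trop_cycles_def)
  then have "group (Z q)" using group.subgroup_imp_group[OF group_C subgroup_Z] by metis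
  then show ?thesis
  proof (rule group.group_comm_groupI)
    fix x y assume "x \<in> carrier (Z q)" "y \<in> carrier (Z q)"
    then show "x \<otimes>\<^bsub>Z q\<^esub> y = y \<otimes>\<^bsub>Z q\<^esub> x"
      using comm_monoid.m_comm[OF comm_group.axioms(1)[OF comm_group_C]] subgroup.subset[OF subgroup_Z, of q]
      unfolding mult_Z by blast
  qed
qed

lemma B_subset_Z: "B q \<subseteq> carrier (Z q)"
proof
  fix c assume "c \<in> B q"
  then obtain b where "c \<in> carrier (C q)" "boundary b = real_chain q c" by (auto simp: B_eq)
  moreover from this have "boundary (real_chain q c) x = 0" for x
    using boundary_boundary[of b] by (cases x) simp
  ultimately show "c \<in> carrier (Z q)" by (simp add: carrier_Z)
qed

lemma subgroup_B: "subgroup (B q) (Z q)"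
proof -
  interpret h: group_hom "C (q + 1)" "C q" "D (q + 1)" using D_hom[of "q + 1"] by simp
  have "subgroup (B q) (C q)"
    unfolding trop_boundaries_def by (rule h.img_is_subgroup)
  then have "subgroup (B q) ((C q)\<lparr>carrier := carrier (Z q)\<rparr>)"
    using group.subgroup_incl[OF group_C _ subgroup_Z B_subset_Z] by blast
  then show ?thesis by (simp add: trop_cycles_def)
qed

lemma normal_B: "B q \<lhd> Z q"
  using comm_group.subgroup_imp_normal[OF comm_group_Z subgroup_B] .

lemma trivial_homology:
  assumes "\<And>c. c \<in> chains q \<Longrightarrow> (\<And>x. boundary c x = 0) \<Longrightarrow> \<exists>b\<in>chains (q + 1). boundary b = c"
  shows "trivial_group (trop_homology N \<Delta> \<nu> p q)"
proof -
  interpret normal "B q" "Z q" by (rule normal_B)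
  have "carrier (Z q) \<subseteq> B q"
    using assms real_chain_chains by (fastforce simp: carrier_Z B_eq)
  then have eq: "B q = carrier (Z q)" using B_subset_Z by blast
  have "carrier (Z q Mod B q) = {B q}"
  proof -
    have "B q #>\<^bsub>Z q\<^esub> x = B q" if "x \<in> carrier (Z q)" for x
      using that unfolding eq by (intro coset_join2) (auto intro: subgroup_self)
    moreover have "\<one>\<^bsub>Z q\<^esub> \<in> carrier (Z q)" by simp
    ultimately show ?thesis by (auto simp: FactGroup_def RCOSETS_def)
  qed
  then show ?thesis
    using factorgroup_is_group by (simp add: trivial_group_def trop_homology_def FactGroup_def)
qed

section \<open>Minkowski weights and the cycle class map\<close>

abbreviation W :: "('v set \<Rightarrow> int) monoid" where
  "W \<equiv> minkowski_weights N \<Delta> p"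

lemma cones_eq: "cones \<Delta> p = cn ` {S \<in> K. card S = p}"
  by (auto simp: cones_def fan_eq dim_cn)

lemma finprod_cls:
  assumes T: "T \<in> K" and A: "\<And>i. i \<in> A \<Longrightarrow> x i \<in> N"
  shows "finprod (Q T) (\<lambda>i. cls T (x i)) A = cls T (\<Sum>i\<in>A. x i)"
proof -
  interpret comm_group "Q T" by (rule comm_group_Q[OF T])
  have car: "cls T n \<in> carrier (Q T)" if "n \<in> N" for n using that by (simp add: carrier_Q[OF T])
  show ?thesis
    using A by (induction A rule: infinite_finite_induct) (auto simp: one_Q[OF T] mult_Q[OF T] car)
qed

text \<open>The condition in the quotient lattice places the sum in the integer span of T, the other
  one only in the real span. The sum is a lattice vector and the sublattice is saturated, so they
  agree.\<close>

lemma balancing_iff: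
  assumes T: "T \<in> K" "card T + 1 = p"
  shows "(\<Otimes>\<^bsub>Q T\<^esub>\<sigma>\<in>{\<sigma> \<in> cones \<Delta> p. cn T \<preceq>\<^sub>c \<sigma>}. normal_gen N (cn T) \<sigma> [^]\<^bsub>Q T\<^esub> w \<sigma>) = \<one>\<^bsub>Q T\<^esub> \<longleftrightarrow>
    (\<Sum>i\<in>link T. real_of_int (w (cn (insert i T))) *\<^sub>R i) \<in> span T"
proof -
  interpret comm_group "Q T" by (rule comm_group_Q[OF T(1)])
  have finT: "finite T" by (rule finite_K_simplex[OF T(1)])
  have L: "insert i T \<in> K" "i \<notin> T" "i \<in> N" if "i \<in> link T" for i
    using that zspan_K[of "insert i T"] zspan_base[of i "insert i T"] by (auto simp: link_def)
  have xN: "real_of_int k *\<^sub>R i \<in> N" if "i \<in> link T" for i k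
    using zspan_scale[of i "basis T" k] L(3)[OF that] zspan_basis[OF T(1)] by simp
  have set_eq: "{\<sigma> \<in> cones \<Delta> p. cn T \<preceq>\<^sub>c \<sigma>} = (\<lambda>i. cn (insert i T)) ` link T"
  proof (intro equalityI subsetI)
    fix \<sigma> assume "\<sigma> \<in> {\<sigma> \<in> cones \<Delta> p. cn T \<preceq>\<^sub>c \<sigma>}"
    then obtain S where S: "\<sigma> = cn S" "S \<in> K" "card S = p" "T \<subseteq> S"
      using T(1) by (auto simp: cones_eq cn_face_iff)
    have "card (S - T) = 1" using S T(2) finT by (simp add: card_Diff_subset)
    then obtain i where "S - T = {i}" using card_1_singletonE by blast
    then have "S = insert i T" "i \<notin> T" using S by auto
    then have "S = insert i T" "i \<in> link T" using S(2) by (simp_all add: link_def)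
    then show "\<sigma> \<in> (\<lambda>i. cn (insert i T)) ` link T" using S(1) by blast
  next
    fix \<sigma> assume "\<sigma> \<in> (\<lambda>i. cn (insert i T)) ` link T"
    then obtain i where i: "i \<in> link T" "\<sigma> = cn (insert i T)" by blast
    have "card (insert i T) = p" using L(2)[OF i(1)] T(2) finT by simp
    then have "\<sigma> \<in> cones \<Delta> p" using i L(1)[OF i(1)] unfolding cones_eq by blast
    moreover have "cn T \<preceq>\<^sub>c \<sigma>" using i(2) cn_face_iff[OF T(1) L(1)[OF i(1)]] by auto
    ultimately show "\<sigma> \<in> {\<sigma> \<in> cones \<Delta> p. cn T \<preceq>\<^sub>c \<sigma>}" by simp
  qed
  have inj: "inj_on (\<lambda>i. cn (insert i T)) (link T)"
  proof (rule inj_onI)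
    fix i j assume ij: "i \<in> link T" "j \<in> link T" "cn (insert i T) = cn (insert j T)"
    then have "insert i T = insert j T" using cn_eq_iff[OF L(1) L(1)] by blast
    then show "i = j" using L(2) ij by blast
  qed
  have summand: "normal_gen N (cn T) (cn (insert i T)) [^]\<^bsub>Q T\<^esub> w (cn (insert i T)) = cls T (real_of_int (w (cn (insert i T))) *\<^sub>R i)"
    if "i \<in> link T" for i
    using normal_gen_cls[OF L(1,2)] cls_int_pow[OF T(1) L(3)] that by simp
  have car: "cls T (real_of_int (w (cn (insert i T))) *\<^sub>R i) \<in> carrier (Q T)" if "i \<in> link T" for i
    using xN[OF that] by (simp add: carrier_Q[OF T(1)])
  have "(\<Otimes>\<^bsub>Q T\<^esub>\<sigma>\<in>{\<sigma> \<in> cones \<Delta> p. cn T \<preceq>\<^sub>c \<sigma>}. normal_gen N (cn T) \<sigma> [^]\<^bsub>Q T\<^esub> w \<sigma>) =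
      (\<Otimes>\<^bsub>Q T\<^esub>i\<in>link T. normal_gen N (cn T) (cn (insert i T)) [^]\<^bsub>Q T\<^esub> w (cn (insert i T)))"
    unfolding set_eq using car by (intro finprod_reindex inj) (auto simp: summand)
  also have "\<dots> = (\<Otimes>\<^bsub>Q T\<^esub>i\<in>link T. cls T (real_of_int (w (cn (insert i T))) *\<^sub>R i))"
    using car by (intro finprod_cong') (auto simp: summand)
  also have "\<dots> = cls T (\<Sum>i\<in>link T. real_of_int (w (cn (insert i T))) *\<^sub>R i)"
    using xN by (rule finprod_cls[OF T(1)])
  finally have "(\<Otimes>\<^bsub>Q T\<^esub>\<sigma>\<in>{\<sigma> \<in> cones \<Delta> p. cn T \<preceq>\<^sub>c \<sigma>}. normal_gen N (cn T) \<sigma> [^]\<^bsub>Q T\<^esub> w \<sigma>) = \<one>\<^bsub>Q T\<^esub> \<longleftrightarrow>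
      (\<Sum>i\<in>link T. real_of_int (w (cn (insert i T))) *\<^sub>R i) \<in> zspan T"
    by (simp add: one_Q[OF T(1)] cls_eq_iff)
  moreover have "(\<Sum>i\<in>link T. real_of_int (w (cn (insert i T))) *\<^sub>R i) \<in> zspan (basis T)"
    using xN zspan_basis[OF T(1)] by (intro zspan_sum) auto
  ultimately show ?thesis
    using zspan_Int_span[OF independent_basis[OF T(1)] finite_basis[OF T(1)] subset_basis[OF T(1)]] by blast
qed

lemma carrier_W: "carrier W = {w \<in> cones \<Delta> p \<rightarrow>\<^sub>E UNIV. balanced (\<lambda>S. w (cn S))}"
proof -
  have "(\<forall>\<tau>\<in>\<Delta>. dim \<tau> + 1 = p \<longrightarrow>
      (\<Otimes>\<^bsub>quot_lattice N \<tau>\<^esub>\<sigma>\<in>{\<sigma> \<in> cones \<Delta> p. \<tau> \<preceq>\<^sub>c \<sigma>}. normal_gen N \<tau> \<sigma> [^]\<^bsub>quot_lattice N \<tau>\<^esub> w \<sigma>) = \<one>\<^bsub>quot_lattice N \<tau>\<^esub>) \<longleftrightarrow>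
      balanced (\<lambda>S. w (cn S))" for w
  proof -
    have "(\<forall>\<tau>\<in>\<Delta>. dim \<tau> + 1 = p \<longrightarrow> P \<tau>) \<longleftrightarrow> (\<forall>T\<in>K. card T + 1 = p \<longrightarrow> P (cn T))" for P
      by (auto simp: fan_eq dim_cn)
    then show ?thesis unfolding balanced_def using balancing_iff by simp
  qed
  then show ?thesis by (simp add: minkowski_weights_def)
qed

lemma cn_zero_iff: "T \<in> K \<Longrightarrow> cn T = {0} \<longleftrightarrow> T = {}"
  using cn_eq_iff[OF _ empty_K, of T] by simp

lemma nu_coeff:
  assumes "S \<in> K" "card S = p" shows "\<nu> (cn {}, cn S) \<in> carrier (coeff {} S)"
proof (rule coeff_memI[OF assms(1) empty_subsetI])
  show "\<nu> (cn {}, cn S) \<in> carrier (ext_power p (Q {}))"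
    using nu_carrier[OF assms(1), of "{}"] assms(2) by simp
  \<comment> \<open>Membership comes from the weight 1, whose weight chain has the value
    \<open>nu\<close> at this cell.\<close>
  have "weight_chain (\<lambda>_. 1) ({}, S) \<in> restr {} ` V p S"
    using assms by (intro chains_image[OF weight_chain_chains])
  then have "nu ({}, S) \<in> restr {} ` V p S" using assms by (simp add: weight_chain_def)
  then show "val {} (\<nu> (cn {}, cn S)) \<in> restr {} ` V p S" by (simp add: nu_def)
qed

abbreviation wc :: "('v set \<Rightarrow> int) \<Rightarrow> 'v face \<Rightarrow> 'v set ext" where
  "wc \<equiv> weight_cycle N \<Delta> \<nu> p"

lemma weight_cycle_C: "wc w \<in> carrier (C (int p))"
  unfolding carrier_C
proof (rule PiE_I)
  fix \<delta> assume \<delta>: "\<delta> \<in> faces \<Delta> (int p)"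
  then obtain T S where TS: "\<delta> = (cn T, cn S)" "cell (int p) T S" unfolding faces_eq by blast
  interpret comm_group "coeff T S" by (rule comm_group_coeff[OF cellD(1,2)[OF TS(2)]])
  show "wc w \<delta> \<in> carrier (trop_coeff N \<Delta> p \<delta>)"
  proof (cases "T = {}")
    case True
    then have "card S = p" using TS(2) by (simp add: cell_def)
    then have "\<nu> (cn T, cn S) \<in> carrier (coeff T S)" using nu_coeff[OF cellD(1)[OF TS(2)]] True by simp
    then have "\<nu> \<delta> [^]\<^bsub>trop_coeff N \<Delta> p \<delta>\<^esub> w (snd \<delta>) \<in> carrier (trop_coeff N \<Delta> p \<delta>)"
      unfolding TS(1) snd_conv by (rule int_pow_closed)
    moreover have "fst \<delta> = {0}" using True by (simp add: TS(1))
    ultimately show ?thesis using \<delta> by (simp add: weight_cycle_def)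
  next
    case False
    then show ?thesis using \<delta> cn_zero_iff[OF cellD(3)[OF TS(2)]] by (simp add: weight_cycle_def TS(1))
  qed
qed (simp add: weight_cycle_def)

lemma real_chain_weight_cycle: "real_chain (int p) (wc w) = weight_chain (\<lambda>S. w (cn S))"
proof
  fix x :: "'v set \<times> 'v set" obtain T S where x: "x = (T, S)" by (cases x)
  show "real_chain (int p) (wc w) x = weight_chain (\<lambda>S. w (cn S)) x"
  proof (cases "cell (int p) T S")
    case True
    note S = cellD[OF True]
    show ?thesis
    proof (cases "T = {}")
      case T: True
      then have card: "card S = p" using True by (simp add: cell_def)
      have "val {} (\<nu> (cn {}, cn S) [^]\<^bsub>coeff {} S\<^esub> w (cn S)) = real_of_int (w (cn S)) *\<^sub>R nu ({}, S)"
        using val_int_pow_coeff[OF S(1) empty_subsetI nu_coeff[OF S(1) card]] by (simp add: nu_def)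
      then show ?thesis
        using True card S T cell_face[OF True] by (simp add: x real_chain_def weight_chain_def weight_cycle_def)
    next
      case False
      then show ?thesis
        using True S cell_face[OF True] cn_zero_iff[OF S(3)] val_one_coeff[OF S(1,2)]
        by (simp add: x real_chain_def weight_chain_def weight_cycle_def)
    qed
  next
    case False
    then show ?thesis by (auto simp: x real_chain_def weight_chain_def cell_def)
  qed
qed

lemma weight_cycle_Z: "w \<in> carrier W \<Longrightarrow> wc w \<in> carrier (Z (int p))"
  using weight_chain_cycle_iff[of "\<lambda>S. w (cn S)"]
  by (simp add: carrier_Z carrier_W weight_cycle_C real_chain_weight_cycle)

lemma weight_cycle_mult:
  assumes "w \<in> carrier W" "w' \<in> carrier W"
  shows "wc (w \<otimes>\<^bsub>W\<^esub> w') = wc w \<otimes>\<^bsub>Z (int p)\<^esub> wc w'"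
proof -
  interpret group "C (int p)" by (rule group_C)
  have "(w \<otimes>\<^bsub>W\<^esub> w') (cn S) = w (cn S) + w' (cn S)" if "S \<in> K" "card S = p" for S
    using that by (simp add: minkowski_weights_def product_group_def cones_eq)
  then have "weight_chain (\<lambda>S. (w \<otimes>\<^bsub>W\<^esub> w') (cn S)) x = weight_chain (\<lambda>S. w (cn S)) x + weight_chain (\<lambda>S. w' (cn S)) x" for x
    by (auto simp: weight_chain_def scaleR_add_left split: prod.splits)
  then show ?thesis
    unfolding mult_Z
    by (intro real_chain_inj[of _ "int p"]) (auto simp: weight_cycle_C real_chain_mult real_chain_weight_cycle)
qed

abbreviation cl :: "('v set \<Rightarrow> int) \<Rightarrow> ('v face \<Rightarrow> 'v set ext) set" where
  "cl \<equiv> cycle_class N \<Delta> \<nu> p"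

lemma cycle_class_hom: "cl \<in> hom W (trop_homology N \<Delta> \<nu> p (int p))"
proof (rule homI)
  interpret normal "B (int p)" "Z (int p)" by (rule normal_B)
  show "cl w \<in> carrier (trop_homology N \<Delta> \<nu> p (int p))" if "w \<in> carrier W" for w
    using weight_cycle_Z[OF that] by (auto simp: cycle_class_def trop_homology_def FactGroup_def RCOSETS_def)
  show "cl (w \<otimes>\<^bsub>W\<^esub> w') = cl w \<otimes>\<^bsub>trop_homology N \<Delta> \<nu> p (int p)\<^esub> cl w'" if "w \<in> carrier W" "w' \<in> carrier W" for w w'
    using that weight_cycle_Z rcos_sum[OF weight_cycle_Z weight_cycle_Z, of w w']
    by (simp add: cycle_class_def trop_homology_def FactGroup_def weight_cycle_mult)
qed

text \<open>Equality of classes makes the weight chain of the difference a boundary, so the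
  difference is zero by \<open>weight_chain_boundary\<close>. Off the p-dimensional cones both
  weights are \<open>undefined\<close>.\<close>

lemma cycle_class_inj: "inj_on cl (carrier W)"
proof (rule inj_onI)
  interpret normal "B (int p)" "Z (int p)" by (rule normal_B)
  fix w w' assume w: "w \<in> carrier W" "w' \<in> carrier W" and "cl w = cl w'"
  then have "wc w \<in> B (int p) #>\<^bsub>Z (int p)\<^esub> wc w'"
    using rcos_self[OF weight_cycle_Z[OF w(1)] subgroup_B] by (simp add: cycle_class_def)
  then obtain c where c: "c \<in> B (int p)" "wc w = c \<otimes>\<^bsub>C (int p)\<^esub> wc w'" by (auto simp: r_coset_def mult_Z)
  then obtain b where b: "b \<in> chains (int p + 1)" "boundary b = real_chain (int p) c" "c \<in> carrier (C (int p))"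
    by (auto simp: B_eq)
  have sum: "weight_chain (\<lambda>S. w (cn S)) x = boundary b x + weight_chain (\<lambda>S. w' (cn S)) x" for x
    using real_chain_mult[OF b(3) weight_cycle_C[of w'], of x] b(2) c(2) by (simp add: real_chain_weight_cycle[symmetric])
  have "boundary b (T, S) = weight_chain (\<lambda>S. w (cn S) - w' (cn S)) (T, S)" for T S
    using sum[of "(T, S)"]
    by (cases "T = {} \<and> S \<in> K \<and> card S = p")
       (simp_all add: weight_chain_def scaleR_diff_left if_not_P del: de_Morgan_conj)
  then have "boundary b x = weight_chain (\<lambda>S. w (cn S) - w' (cn S)) x" for x
    by (cases x) simp
  then have bd: "boundary b = weight_chain (\<lambda>S. w (cn S) - w' (cn S))" by (rule ext)
  have eq: "w (cn S) = w' (cn S)" if "S \<in> K" "card S = p" for S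
    using weight_chain_boundary[OF b(1) bd that] by simp
  have "w \<in> cones \<Delta> p \<rightarrow>\<^sub>E UNIV" "w' \<in> cones \<Delta> p \<rightarrow>\<^sub>E UNIV" using w by (auto simp: carrier_W)
  then show "w = w'" by (rule PiE_ext) (use eq in \<open>auto simp: cones_eq\<close>)
qed

text \<open>The weight found on the complex is carried to the cones and made
  \<open>undefined\<close> elsewhere. It is balanced because its weight chain differs from a cycle
  by a boundary.\<close>

lemma cycle_class_surj: "carrier (trop_homology N \<Delta> \<nu> p (int p)) \<subseteq> cl ` carrier W"
proof
  interpret normal "B (int p)" "Z (int p)" by (rule normal_B)
  fix X assume "X \<in> carrier (trop_homology N \<Delta> \<nu> p (int p))"
  then obtain z where z: "z \<in> carrier (Z (int p))" "X = B (int p) #>\<^bsub>Z (int p)\<^esub> z"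
    by (auto simp: trop_homology_def FactGroup_def RCOSETS_def)
  then have zC: "z \<in> carrier (C (int p))" and closed: "\<And>x. boundary (real_chain (int p) z) x = 0"
    by (auto simp: carrier_Z)
  obtain w b where b: "b \<in> chains (int p + 1)" and wb: "\<And>x. real_chain (int p) z x = weight_chain w x + boundary b x"
    using cycle_eq_weight_chain[OF real_chain_chains[OF zC] closed] by blast
  define w' where "w' = (\<lambda>\<sigma>\<in>cones \<Delta> p. w (inv_into K cn \<sigma>))"
  have w'w: "w' (cn S) = w S" if "S \<in> K" "card S = p" for S
    using that inv_into_f_f[OF inj_cn] by (auto simp: w'_def cones_eq)
  have wc_eq: "weight_chain (\<lambda>S. w' (cn S)) = weight_chain w"
    using w'w by (auto simp: weight_chain_def fun_eq_iff)
  have "boundary (weight_chain w) x = 0" for x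
  proof -
    have "real_chain (int p) z = (\<lambda>x. weight_chain w x + boundary b x)" using wb by (rule ext)
    then have "boundary (weight_chain w) x + boundary (boundary b) x = 0"
      using closed[of x] by (simp add: boundary_add)
    then show ?thesis by (cases x) (simp add: boundary_boundary)
  qed
  then have "balanced (\<lambda>S. w' (cn S))"
    using weight_chain_cycle_iff[of "\<lambda>S. w' (cn S)"] by (simp add: wc_eq)
  then have w'W: "w' \<in> carrier W" by (simp add: carrier_W w'_def)
  obtain c where c: "c \<in> carrier (C (int p))" "real_chain (int p) c = boundary b"
    using real_chain_surj[of "boundary b" "int p"] boundary_chains[OF b] by auto
  then have cB: "c \<in> B (int p)" using b by (auto simp: B_eq)
  interpret G: group "C (int p)" by (rule group_C)
  have "z = c \<otimes>\<^bsub>C (int p)\<^esub> wc w'"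
    using c zC weight_cycle_C by (intro real_chain_inj[of _ "int p"]) (auto simp: real_chain_mult real_chain_weight_cycle wc_eq wb)
  then have "z \<in> B (int p) #>\<^bsub>Z (int p)\<^esub> wc w'"
    using cB by (auto simp: r_coset_def mult_Z)
  then have "X = cl w'"
    using repr_independence[OF _ weight_cycle_Z[OF w'W] subgroup_B] z(2) by (simp add: cycle_class_def)
  then show "X \<in> cl ` carrier W" using w'W by blast
qed

theorem cycle_class_iso: "cl \<in> iso W (trop_homology N \<Delta> \<nu> p (int p))"
  using cycle_class_hom cycle_class_inj cycle_class_surj
  by (auto simp: iso_def bij_betw_def hom_def)

theorem homology_vanishes:
  assumes "p < q \<or> (p > q \<and> q = 0)"
  shows "trivial_group (trop_homology N \<Delta> \<nu> p (int q))"
proof (rule trivial_homology)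
  fix c assume c: "c \<in> chains (int q)" "\<And>x. boundary c x = 0"
  show "\<exists>b\<in>chains (int q + 1). boundary b = c"
    using assms
  proof
    assume "p < q"
    then show ?thesis using exact_above[OF c] by (metis of_nat_less_iff)
  next
    assume "p > q \<and> q = 0"
    then show ?thesis using exact_zero[of c] c(1) by auto
  qed
qed

end

theorem theorem1p4:
  fixes N :: "'v::real_vector set"
    and \<Delta> :: "'v set set"
    and \<nu> :: "'v face \<Rightarrow> 'v set ext"
  assumes "free_lattice N"
    and "fan N \<Delta>"
    and "unimodular N \<Delta>"
    and "orientation N \<Delta> \<nu>"
  shows "(\<forall>p::nat. cycle_class N \<Delta> \<nu> p \<in>
            iso (minkowski_weights N \<Delta> p) (trop_homology N \<Delta> \<nu> p (int p))) \<and>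
         (\<forall>p q::nat. p < q \<or> (p > q \<and> q = 0) \<longrightarrow>
            trivial_group (trop_homology N \<Delta> \<nu> p (int q)))"
proof -
  interpret F: unimodular_fan N \<Delta> using assms by unfold_locales
  interpret L: lattice_complex N F.complex by (rule F.lattice_complex)
  interpret oriented_fan N F.complex \<Delta> \<nu>
    using F.fan_eq F.inj_on_complex F.complex_face_iff assms(4) by unfold_locales
  have "tropical_fan N F.complex \<Delta> \<nu>" by unfold_locales
  then show ?thesis
    using tropical_fan.cycle_class_iso tropical_fan.homology_vanishes by blast
qed

end
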